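(* Let $h$ be an arbitrary $\varrho$-connection on the affine bundle $\pi:E\to M$, let $\mathsf{c}:I\to\mathsf{V}$ be a $\varrho$-admissible curve with projection $c_M$, let $a\in I$, $e\in E_{c_M(a)}$, $\overline e\in\overline E_{c_M(a)}$. Then Lie transport of vertical vectors on $E$ along the horizontal lift $c^h_e$ of $\mathsf{c}$ is equivalent to Lie transport of vertical vectors on $c_M^*E$ along integral curves of the vector field $\Lambda_c$, in the sense that, for $$Y_{e,\overline e}(u)=T\phi^h_{u,a}\big(v(e,\overline e)\big),\qquad \Upsilon_{e,\overline e}(u)=T\phi_{u,a}\big(v_{c_M^*E}((a,e),(a,\overline e))\big),$$ one has $Tc_M^1\big(\Upsilon_{e,\overline e}(u)\big)=Y_{e,\overline e}(u)$ for all $u$ in the domain of the integral curve $\gamma_e$. If moreover $h$ is affine with linear part $\overline h$, the translates in both cases are compatible with the affine nature of the flow maps between fixed fibres: the flow maps satisfy $$\phi^h_{u,a}(e+\overline e)=c^h_e(u)+c^{\overline h}_{\overline e}(u),\qquad \gamma_{e+\overline e}(u)=\gamma_e(u)+\overline\gamma_{\overline e}(u),$$ and the translates are given by $$Y_{e,\overline e}(u)=v\big(c^h_e(u),c^{\overline h}_{\overline e}(u)\big),\qquad \Upsilon_{e,\overline e}(u)=v_{c_M^*E}\big(\gamma_e(u),\overline\gamma_{\overline e}(u)\big).$$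
   Context: Everything is smooth. $\pi:E\to M$ is an affine bundle modelled on the vector bundle $\overline\pi:\overline E\to M$; $\tau:\mathsf{V}\to M$ is a vector bundle with anchor $\varrho:\mathsf{V}\to TM$ (vector bundle map over the identity); $\pi^*\mathsf{V}=E\times_M\mathsf{V}$. For $e\in E_m$, $\overline e\in\overline E_m$, $v(e,\overline e)\in T_eE$ is the tangent vector at $t=0$ of $t\mapsto e+t\overline e$. A $\varrho$-connection on $\pi$ is a linear bundle map $h:\pi^*\mathsf{V}\to TE$ over $E$ with $T\pi\circ h=\varrho\circ p_{\mathsf V}$, with $p_{\mathsf V}:\pi^*\mathsf{V}\to\mathsf{V}$ the projection. A $\varrho$-connection $\overline h$ on $\overline\pi$ is linear if its connection coefficients are linear in the linear fibre coordinates of $\overline E$. $h$ is affine with linear part $\overline h$ if $\overline h$ is a linear $\varrho$-connection on $\overline\pi$ such that, with $\Sigma(e,\overline e)=e+\overline e$ on $E\times_M\overline E$, $h(e+\overline e,\mathsf{v})=T\Sigma_{(e,\overline e)}\big(h(e,\mathsf{v}),\overline h(\overline e,\mathsf{v})\big)$ for all $e\in E_m,\overline e\in\overline E_m,\mathsf{v}\in\mathsf{V}_m$. A curve $\mathsf{c}:I\to\mathsf{V}$ on an interval $I$, with projection $c_M=\tau\circ\mathsf{c}$, is $\varrho$-admissible if $\dot c_M=\varrho\circ\mathsf{c}$. Its $h$-horizontal lift $c^h_e$ through $e\in E_{c_M(a)}$ is the solution of $\dot\psi(u)=h(\psi(u),\mathsf{c}(u))$ with $\psi(a)=e$ (a curve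 in $E$ over $c_M$); $\phi^h_{u,a}(e)=c^h_e(u)$ maps (where defined) $E_{c_M(a)}$ to $E_{c_M(u)}$. The $\overline h$-horizontal lift $c^{\overline h}_{\overline e}$ in $\overline E$ is defined likewise. $c_M^*E\to I$ and $c_M^*\overline E\to I$ are the pullback bundles, with points $(u,e)$, $e\in E_{c_M(u)}$, resp. $(u,\overline e)$; $c_M^1:c_M^*E\to E$, $(u,e)\mapsto e$, and $\overline c_M^1:c_M^*\overline E\to\overline E$, $(u,\overline e)\mapsto\overline e$ are the canonical maps. $c_M^*E$ is an affine bundle over $I$ modelled on $c_M^*\overline E$ and $v_{c_M^*E}$ is its vertical lift: $v_{c_M^*E}((u,e),(u,\overline e))$ is the tangent vector at $t=0$ of $t\mapsto(u,e+t\overline e)$. $\Lambda_c$ is the unique vector field on $c_M^*E$ projecting onto the coordinate field $d/du$ on $I$ with $Tc_M^1(\Lambda_c(u,e))=h(e,\mathsf{c}(u))$; in the affine case $\overline\Lambda_c$ is the analogous vector field on $c_M^*\overline E$ defined with $\overline h$ and $\overline c_M^1$. $\gamma_e$ (resp. $\overline\gamma_{\overline e}$) is the integral curve of $\Lambda_c$ (resp. $\overline\Lambda_c$) passing through $(a,e)$ (resp. $(a,\overline e)$) at $u=a$, and $\phi_{u,a}$ is the flow of $\Lambda_c$ with $\phi_{a,a}=\mathrm{id}$, so $\phi_{u,a}(a,e)=\gamma_e(u)$. Equalities are understood for $u$ where both sides are defined. *)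

theory Defs
  imports "HOL-Analysis.Analysis"
begin

section \<open>Smooth functions between finite-dimensional normed spaces\<close>

text \<open>
  Model spaces are finite-dimensional Banach spaces rather than types of class
  \<open>euclidean_space\<close>: the latter have positive dimension, whereas manifolds of dimension 0
  and bundles of rank 0 are admitted here.
\<close>

definition finite_dim :: "'a::real_normed_vector itself \<Rightarrow> bool" where
  "finite_dim _ \<longleftrightarrow> (\<exists>B::'a set. finite B \<and> span B = UNIV)"

primrec Ck_on :: "nat \<Rightarrow> ('a::real_normed_vector \<Rightarrow> 'b::real_normed_vector) \<Rightarrow> 'a set \<Rightarrow> bool" where
  "Ck_on 0 f W \<longleftrightarrow> continuous_on W f"
| "Ck_on (Suc n) f W \<longleftrightarrow> (\<forall>x\<in>W. f differentiable (at x)) \<and>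
     (\<forall>v. Ck_on n (\<lambda>x. frechet_derivative f (at x) v) W)"

text \<open>On a set that need not be open (such as an interval containing an end point), smooth
  means locally extendable to a smooth function on an open set.\<close>

definition smooth_on :: "('a::real_normed_vector \<Rightarrow> 'b::real_normed_vector) \<Rightarrow> 'a set \<Rightarrow> bool" where
  "smooth_on f X \<longleftrightarrow> (\<forall>x\<in>X. \<exists>W g. open W \<and> x \<in> W \<and> (\<forall>n. Ck_on n g W) \<and> (\<forall>y\<in>W \<inter> X. g y = f y))"


section \<open>Manifolds and tangent vectors\<close>

type_synonym ('x, 'a) chart = "'x set \<times> ('x \<Rightarrow> 'a)"
type_synonym ('x, 'a) atlas = "('x, 'a) chart set"

definition pts :: "('x, 'a) atlas \<Rightarrow> 'x set" where
  "pts A = \<Union> (fst ` A)"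

definition atlas_top :: "('x, 'a::topological_space) atlas \<Rightarrow> 'x topology" where
  "atlas_top A = topology (\<lambda>W. W \<subseteq> pts A \<and>
     (\<forall>c\<in>A. \<exists>G. open G \<and> fst c \<inter> W = {p \<in> fst c. snd c p \<in> G}))"

lemma istopology_atlas_top:
  "istopology (\<lambda>W. W \<subseteq> pts A \<and> (\<forall>c\<in>A. \<exists>G. open G \<and> fst c \<inter> W = {p \<in> fst c. snd c p \<in> G}))"
  unfolding istopology_def
proof (intro conjI allI impI ballI)
  fix S T c
  assume S: "S \<subseteq> pts A \<and> (\<forall>c\<in>A. \<exists>G. open G \<and> fst c \<inter> S = {p \<in> fst c. snd c p \<in> G})"
    and T: "T \<subseteq> pts A \<and> (\<forall>c\<in>A. \<exists>G. open G \<and> fst c \<inter> T = {p \<in> fst c. snd c p \<in> G})"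
  show "S \<inter> T \<subseteq> pts A" using S by blast
  assume "c \<in> A"
  then obtain G G' where "open G" "fst c \<inter> S = {p \<in> fst c. snd c p \<in> G}"
    "open G'" "fst c \<inter> T = {p \<in> fst c. snd c p \<in> G'}"
    using S T by meson
  then show "\<exists>G. open G \<and> fst c \<inter> (S \<inter> T) = {p \<in> fst c. snd c p \<in> G}"
    by (intro exI[of _ "G \<inter> G'"]) auto
next
  fix K c
  assume K: "\<forall>S\<in>K. S \<subseteq> pts A \<and> (\<forall>c\<in>A. \<exists>G. open G \<and> fst c \<inter> S = {p \<in> fst c. snd c p \<in> G})"
  show "\<Union>K \<subseteq> pts A" using K by blast
  assume "c \<in> A"
  then have "\<forall>S\<in>K. \<exists>G. open G \<and> fst c \<inter> S = {p \<in> fst c. snd c p \<in> G}" using K by blast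
  then obtain g where g: "\<forall>S\<in>K. open (g S) \<and> fst c \<inter> S = {p \<in> fst c. snd c p \<in> g S}"
    by metis
  then show "\<exists>G. open G \<and> fst c \<inter> \<Union>K = {p \<in> fst c. snd c p \<in> G}"
    by (intro exI[of _ "\<Union>S\<in>K. g S"]) blast
qed

definition transition :: "('x, 'a) chart \<Rightarrow> ('y, 'b) chart \<Rightarrow> ('x \<Rightarrow> 'y) \<Rightarrow> 'a \<Rightarrow> 'b" where
  "transition c d f = snd d \<circ> f \<circ> inv_into (fst c) (snd c)"

definition manifold :: "('x, 'a::real_normed_vector) atlas \<Rightarrow> bool" where
  "manifold A \<longleftrightarrow> finite_dim TYPE('a) \<and>
     (\<forall>c\<in>A. inj_on (snd c) (fst c)) \<and>
     (\<forall>c\<in>A. \<forall>d\<in>A. open (snd c ` (fst c \<inter> fst d)) \<and>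
        smooth_on (transition c d id) (snd c ` (fst c \<inter> fst d))) \<and>
     Hausdorff_space (atlas_top A) \<and> second_countable (atlas_top A)"

definition smooth_map :: "('x, 'a::real_normed_vector) atlas \<Rightarrow> ('y, 'b::real_normed_vector) atlas
    \<Rightarrow> ('x \<Rightarrow> 'y) \<Rightarrow> bool" where
  "smooth_map A B f \<longleftrightarrow> continuous_map (atlas_top A) (atlas_top B) f \<and>
     (\<forall>c\<in>A. \<forall>d\<in>B. smooth_on (transition c d f) (snd c ` {p \<in> fst c. f p \<in> fst d}))"

text \<open>
  A tangent vector at \<open>p\<close> is the family of its coordinate vectors with respect to the charts
  around \<open>p\<close>, any two of which are related by the derivative of the coordinate change.  The
  component is 0 at anything that is not a chart around \<open>p\<close>, so that equality of tangent
  vectors is equality in HOL.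

  All derivatives are taken within the image of the chart.  For the manifolds without boundary
  that image is open; it is not open for a bundle over an interval with an end point.
\<close>

type_synonym ('x, 'a) tvec = "'x \<times> (('x, 'a) chart \<Rightarrow> 'a)"

definition tspace :: "('x, 'a::real_normed_vector) atlas \<Rightarrow> 'x \<Rightarrow> ('x, 'a) tvec set" where
  "tspace A p = {(p, \<xi>) | \<xi>.
     (\<forall>c. c \<notin> A \<or> p \<notin> fst c \<longrightarrow> \<xi> c = 0) \<and>
     (\<forall>c\<in>A. \<forall>d\<in>A. p \<in> fst c \<inter> fst d \<longrightarrow>
        \<xi> d = frechet_derivative (transition c d id)
                (at (snd c p) within snd c ` (fst c \<inter> fst d)) (\<xi> c))}"

definition tadd :: "('x, 'a::real_normed_vector) tvec \<Rightarrow> ('x, 'a) tvec \<Rightarrow> ('x, 'a) tvec" where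
  "tadd X Y = (fst X, \<lambda>c. snd X c + snd Y c)"

definition tscale :: "real \<Rightarrow> ('x, 'a::real_normed_vector) tvec \<Rightarrow> ('x, 'a) tvec" where
  "tscale r X = (fst X, \<lambda>c. r *\<^sub>R snd X c)"

definition tangent_atlas :: "('x, 'a::real_normed_vector) atlas \<Rightarrow> (('x, 'a) tvec, 'a \<times> 'a) atlas" where
  "tangent_atlas A =
     (\<lambda>c. ((\<Union>p\<in>fst c. tspace A p), (\<lambda>X. (snd c (fst X), snd X c)))) ` A"

text \<open>
  \<open>tmap A B S f\<close> is the tangent map of a map \<open>f\<close> that is defined on a subset \<open>S\<close> of the
  manifold \<open>A\<close>.  Here \<open>S\<close> is either the whole manifold or a relatively open part of a fibre of
  a bundle.  In the latter case the derivative within \<open>S\<close> is not unique, but its value on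
  vectors tangent to the fibre is, and the map is only applied to those.
\<close>

definition tmap :: "('x, 'a::real_normed_vector) atlas \<Rightarrow> ('y, 'b::real_normed_vector) atlas \<Rightarrow>
    'x set \<Rightarrow> ('x \<Rightarrow> 'y) \<Rightarrow> ('x, 'a) tvec \<Rightarrow> ('y, 'b) tvec" where
  "tmap A B S f X = (f (fst X), \<lambda>d. if d \<in> B \<and> f (fst X) \<in> fst d then
      (let c = (SOME c. c \<in> A \<and> fst X \<in> fst c) in
        frechet_derivative (transition c d f)
          (at (snd c (fst X)) within snd c ` (fst c \<inter> S)) (snd X c))
      else 0)"

definition has_velocity :: "('x, 'a::real_normed_vector) atlas \<Rightarrow> real set \<Rightarrow> (real \<Rightarrow> 'x) \<Rightarrow> real
    \<Rightarrow> ('x, 'a) tvec \<Rightarrow> bool" where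
  "has_velocity A J \<eta> t X \<longleftrightarrow> X \<in> tspace A (\<eta> t) \<and>
     (\<forall>d\<in>A. \<eta> t \<in> fst d \<longrightarrow> ((\<lambda>s. snd d (\<eta> s)) has_vector_derivative snd X d) (at t within J))"

definition velocity :: "('x, 'a::real_normed_vector) atlas \<Rightarrow> real set \<Rightarrow> (real \<Rightarrow> 'x) \<Rightarrow> real
    \<Rightarrow> ('x, 'a) tvec" where
  "velocity A J \<eta> t = (\<eta> t, \<lambda>d. if d \<in> A \<and> \<eta> t \<in> fst d
     then vector_derivative (\<lambda>s. snd d (\<eta> s)) (at t within J) else 0)"

definition interval_atlas :: "real set \<Rightarrow> (real, real) atlas" where
  "interval_atlas I = {(I, \<lambda>u. u)}"


section \<open>Bundles\<close>

text \<open>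
  A local trivialization over \<open>U\<close> is represented by its fibre component, a function from the
  part of the total space over \<open>U\<close> to the model fibre.  Together with the charts of the base the
  trivializations determine the atlas of the total space.
\<close>

record ('x, 'm, 'f) fbundle =
  tot :: "'x set"
  prj :: "'x \<Rightarrow> 'm"
  trivs :: "('m set \<times> ('x \<Rightarrow> 'f)) set"

record ('x, 'm, 'f) vbundle = "('x, 'm, 'f) fbundle" +
  vadd :: "'x \<Rightarrow> 'x \<Rightarrow> 'x"
  vscale :: "real \<Rightarrow> 'x \<Rightarrow> 'x"

record ('x, 'm, 'f, 'w) abundle = "('x, 'm, 'f) fbundle" +
  act :: "'x \<Rightarrow> 'w \<Rightarrow> 'x"

definition fibre :: "('x, 'm, 'f, 'z) fbundle_scheme \<Rightarrow> 'm \<Rightarrow> 'x set" where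
  "fibre B m = {x \<in> tot B. prj B x = m}"

definition adapted_chart :: "('x, 'm, 'f, 'z) fbundle_scheme \<Rightarrow> ('m, 'a) chart
    \<Rightarrow> 'm set \<times> ('x \<Rightarrow> 'f) \<Rightarrow> ('x, 'a \<times> 'f) chart" where
  "adapted_chart B c y = ({x \<in> tot B. prj B x \<in> fst c \<inter> fst y}, \<lambda>x. (snd c (prj B x), snd y x))"

definition bundle_atlas :: "('m, 'a) atlas \<Rightarrow> ('x, 'm, 'f, 'z) fbundle_scheme \<Rightarrow> ('x, 'a \<times> 'f) atlas" where
  "bundle_atlas A B = {adapted_chart B c y | c y. c \<in> A \<and> y \<in> trivs B}"

definition fibre_bundle :: "('m, 'a::real_normed_vector) atlas
    \<Rightarrow> ('x, 'm, 'f::real_normed_vector, 'z) fbundle_scheme \<Rightarrow> bool" where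
  "fibre_bundle A B \<longleftrightarrow> prj B ` tot B \<subseteq> pts A \<and>
     (\<Union> (fst ` trivs B)) = pts A \<and>
     (\<forall>y\<in>trivs B. openin (atlas_top A) (fst y) \<and> (\<forall>m\<in>fst y. bij_betw (snd y) (fibre B m) UNIV)) \<and>
     manifold (bundle_atlas A B)"

text \<open>The vector space axioms for the fibres follow because the trivializations are bijective
  on fibres and transport the operations to those of the model fibre; likewise, below, for the
  axioms of an affine space.\<close>

definition vector_bundle :: "('m, 'a::real_normed_vector) atlas
    \<Rightarrow> ('x, 'm, 'f::real_normed_vector, 'z) vbundle_scheme \<Rightarrow> bool" where
  "vector_bundle A B \<longleftrightarrow> fibre_bundle A B \<and>
     (\<forall>m\<in>pts A. \<forall>v\<in>fibre B m. \<forall>w\<in>fibre B m. \<forall>r.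
        vadd B v w \<in> fibre B m \<and> vscale B r v \<in> fibre B m) \<and>
     (\<forall>y\<in>trivs B. \<forall>m\<in>fst y. \<forall>v\<in>fibre B m. \<forall>w\<in>fibre B m. \<forall>r.
        snd y (vadd B v w) = snd y v + snd y w \<and> snd y (vscale B r v) = r *\<^sub>R snd y v)"

text \<open>The linear part \<open>z\<close> of an affine trivialization has to be a smooth trivialization of the
  modelling vector bundle, that is, it may be adjoined to the given ones.\<close>

definition affine_bundle :: "('m, 'a::real_normed_vector) atlas
    \<Rightarrow> ('x, 'm, 'f::real_normed_vector, 'w) abundle \<Rightarrow> ('w, 'm, 'f) vbundle \<Rightarrow> bool" where
  "affine_bundle A E Eb \<longleftrightarrow> fibre_bundle A E \<and> vector_bundle A Eb \<and>
     (\<forall>m\<in>pts A. \<forall>e\<in>fibre E m. \<forall>w\<in>fibre Eb m. act E e w \<in> fibre E m) \<and>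
     (\<forall>y\<in>trivs E. \<exists>z. vector_bundle A (Eb\<lparr>trivs := insert (fst y, z) (trivs Eb)\<rparr>) \<and>
        (\<forall>m\<in>fst y. \<forall>e\<in>fibre E m. \<forall>w\<in>fibre Eb m. snd y (act E e w) = snd y e + z w))"

definition vlift :: "('m, 'a::real_normed_vector) atlas
    \<Rightarrow> ('x, 'm, 'f::real_normed_vector, 'w) abundle \<Rightarrow> ('w, 'm, 'f) vbundle \<Rightarrow> 'x \<Rightarrow> 'w
    \<Rightarrow> ('x, 'a \<times> 'f) tvec" where
  "vlift A E Eb e w = velocity (bundle_atlas A E) UNIV (\<lambda>t. act E e (vscale Eb t w)) 0"

text \<open>The atlas of the total space of a pullback along \<open>f : N \<rightarrow> M\<close> comes from \<^const>\<open>bundle_atlas\<close>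
  for the atlas of \<open>N\<close>.  The fibre product of two bundles over \<open>M\<close> is the pullback of the second
  along the projection of the first.\<close>

definition pb_tot :: "'n set \<Rightarrow> ('n \<Rightarrow> 'm) \<Rightarrow> ('x, 'm, 'f, 'z) fbundle_scheme \<Rightarrow> ('n \<times> 'x) set" where
  "pb_tot N f B = {(n, x). n \<in> N \<and> x \<in> tot B \<and> prj B x = f n}"

definition pb_trivs :: "'n set \<Rightarrow> ('n \<Rightarrow> 'm) \<Rightarrow> ('x, 'm, 'f, 'z) fbundle_scheme
    \<Rightarrow> ('n set \<times> ('n \<times> 'x \<Rightarrow> 'f)) set" where
  "pb_trivs N f B = (\<lambda>y. ({n \<in> N. f n \<in> fst y}, snd y \<circ> snd)) ` trivs B"

definition pullback :: "'n set \<Rightarrow> ('n \<Rightarrow> 'm) \<Rightarrow> ('x, 'm, 'f, 'z) fbundle_scheme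
    \<Rightarrow> ('n \<times> 'x, 'n, 'f) fbundle" where
  "pullback N f B = \<lparr>tot = pb_tot N f B, prj = fst, trivs = pb_trivs N f B\<rparr>"

definition vpullback :: "'n set \<Rightarrow> ('n \<Rightarrow> 'm) \<Rightarrow> ('x, 'm, 'f) vbundle \<Rightarrow> ('n \<times> 'x, 'n, 'f) vbundle" where
  "vpullback N f B = \<lparr>tot = pb_tot N f B, prj = fst, trivs = pb_trivs N f B,
     vadd = (\<lambda>(n, x) (_, y). (n, vadd B x y)), vscale = (\<lambda>r (n, x). (n, vscale B r x))\<rparr>"

definition apullback :: "'n set \<Rightarrow> ('n \<Rightarrow> 'm) \<Rightarrow> ('x, 'm, 'f, 'w) abundle
    \<Rightarrow> ('n \<times> 'x, 'n, 'f, 'n \<times> 'w) abundle" where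
  "apullback N f E = \<lparr>tot = pb_tot N f E, prj = fst, trivs = pb_trivs N f E,
     act = (\<lambda>(n, e) (_, w). (n, act E e w))\<rparr>"


section \<open>Anchored vector bundles and connections\<close>

definition anchor :: "('m, 'a::real_normed_vector) atlas
    \<Rightarrow> ('v, 'm, 'k::real_normed_vector) vbundle \<Rightarrow> ('v \<Rightarrow> ('m, 'a) tvec) \<Rightarrow> bool" where
  "anchor A V \<rho> \<longleftrightarrow> smooth_map (bundle_atlas A V) (tangent_atlas A) \<rho> \<and>
     (\<forall>m\<in>pts A. \<forall>v\<in>fibre V m. \<forall>w\<in>fibre V m. \<forall>r. \<rho> v \<in> tspace A m \<and>
        \<rho> (vadd V v w) = tadd (\<rho> v) (\<rho> w) \<and> \<rho> (vscale V r v) = tscale r (\<rho> v))"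

definition connection :: "('m, 'a::real_normed_vector) atlas
    \<Rightarrow> ('x, 'm, 'f::real_normed_vector, 'z) fbundle_scheme \<Rightarrow> ('v, 'm, 'k::real_normed_vector) vbundle
    \<Rightarrow> ('v \<Rightarrow> ('m, 'a) tvec) \<Rightarrow> ('x \<times> 'v \<Rightarrow> ('x, 'a \<times> 'f) tvec) \<Rightarrow> bool" where
  "connection A B V \<rho> h \<longleftrightarrow>
     smooth_map (bundle_atlas (bundle_atlas A B) (pullback (tot B) (prj B) V))
       (tangent_atlas (bundle_atlas A B)) h \<and>
     (\<forall>m\<in>pts A. \<forall>x\<in>fibre B m. \<forall>v\<in>fibre V m. \<forall>w\<in>fibre V m. \<forall>r.
        h (x, v) \<in> tspace (bundle_atlas A B) x \<and>
        h (x, vadd V v w) = tadd (h (x, v)) (h (x, w)) \<and>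
        h (x, vscale V r v) = tscale r (h (x, v)) \<and>
        tmap (bundle_atlas A B) A (tot B) (prj B) (h (x, v)) = \<rho> v)"

text \<open>
  Over a base chart \<open>c\<close> and trivializations \<open>y\<close> of \<open>B\<close> and \<open>z\<close> of \<open>V\<close>, the connection
  coefficients at \<open>m\<close> with fibre coordinates \<open>f\<close> form the linear map taking the coordinates \<open>k\<close>
  of an element of \<open>V\<close> to the fibre component of its lift (up to the sign convention).
\<close>

definition conn_coeff :: "('x, 'm, 'f::real_normed_vector, 'z) fbundle_scheme
    \<Rightarrow> ('v, 'm, 'k::real_normed_vector) vbundle \<Rightarrow> ('x \<times> 'v \<Rightarrow> ('x, 'a \<times> 'f) tvec)
    \<Rightarrow> ('m, 'a::real_normed_vector) chart \<Rightarrow> 'm set \<times> ('x \<Rightarrow> 'f) \<Rightarrow> 'm set \<times> ('v \<Rightarrow> 'k)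
    \<Rightarrow> 'm \<Rightarrow> 'f \<Rightarrow> 'k \<Rightarrow> 'f" where
  "conn_coeff B V h c y z m f k =
     snd (snd (h (inv_into (fibre B m) (snd y) f, inv_into (fibre V m) (snd z) k)) (adapted_chart B c y))"

definition linear_connection :: "('m, 'a::real_normed_vector) atlas
    \<Rightarrow> ('w, 'm, 'f::real_normed_vector) vbundle \<Rightarrow> ('v, 'm, 'k::real_normed_vector) vbundle
    \<Rightarrow> ('v \<Rightarrow> ('m, 'a) tvec) \<Rightarrow> ('w \<times> 'v \<Rightarrow> ('w, 'a \<times> 'f) tvec) \<Rightarrow> bool" where
  "linear_connection A Eb V \<rho> hb \<longleftrightarrow> connection A Eb V \<rho> hb \<and>
     (\<forall>c\<in>A. \<forall>y\<in>trivs Eb. \<forall>z\<in>trivs V. \<forall>m\<in>fst c \<inter> fst y \<inter> fst z. \<forall>k.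
        linear (\<lambda>f. conn_coeff Eb V hb c y z m f k))"

text \<open>The pair of tangent vectors \<open>X\<close>, \<open>X'\<close> of \<open>B\<close> and \<open>B'\<close> with the same projection to the
  base, as a tangent vector of the fibre product.\<close>

definition fp_atlas :: "('m, 'a) atlas \<Rightarrow> ('x, 'm, 'f, 'z) fbundle_scheme
    \<Rightarrow> ('y, 'm, 'g, 'zz) fbundle_scheme \<Rightarrow> ('x \<times> 'y, ('a \<times> 'f) \<times> 'g) atlas" where
  "fp_atlas A B B' = bundle_atlas (bundle_atlas A B) (pullback (tot B) (prj B) B')"

definition fp_tvec :: "('m, 'a::real_normed_vector) atlas
    \<Rightarrow> ('x, 'm, 'f::real_normed_vector, 'z) fbundle_scheme
    \<Rightarrow> ('y, 'm, 'g::real_normed_vector, 'zz) fbundle_scheme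
    \<Rightarrow> ('x, 'a \<times> 'f) tvec \<Rightarrow> ('y, 'a \<times> 'g) tvec \<Rightarrow> ('x \<times> 'y, ('a \<times> 'f) \<times> 'g) tvec" where
  "fp_tvec A B B' X X' = (THE Z. Z \<in> tspace (fp_atlas A B B') (fst X, fst X') \<and>
     tmap (fp_atlas A B B') (bundle_atlas A B) (pb_tot (tot B) (prj B) B') fst Z = X \<and>
     tmap (fp_atlas A B B') (bundle_atlas A B') (pb_tot (tot B) (prj B) B') snd Z = X')"

definition affine_connection :: "('m, 'a::real_normed_vector) atlas
    \<Rightarrow> ('x, 'm, 'f::real_normed_vector, 'w) abundle \<Rightarrow> ('w, 'm, 'f) vbundle
    \<Rightarrow> ('v, 'm, 'k::real_normed_vector) vbundle \<Rightarrow> ('v \<Rightarrow> ('m, 'a) tvec)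
    \<Rightarrow> ('x \<times> 'v \<Rightarrow> ('x, 'a \<times> 'f) tvec) \<Rightarrow> ('w \<times> 'v \<Rightarrow> ('w, 'a \<times> 'f) tvec) \<Rightarrow> bool" where
  "affine_connection A E Eb V \<rho> h hb \<longleftrightarrow>
     connection A E V \<rho> h \<and> linear_connection A Eb V \<rho> hb \<and>
     (\<forall>m\<in>pts A. \<forall>e\<in>fibre E m. \<forall>w\<in>fibre Eb m. \<forall>v\<in>fibre V m.
        h (act E e w, v) =
          tmap (fp_atlas A E Eb) (bundle_atlas A E) (pb_tot (tot E) (prj E) Eb) (\<lambda>(e, w). act E e w)
            (fp_tvec A E Eb (h (e, v)) (hb (w, v))))"


section \<open>Integral curves, horizontal lifts and Lie transport\<close>

definition admissible :: "('m, 'a::real_normed_vector) atlas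
    \<Rightarrow> ('v, 'm, 'k::real_normed_vector) vbundle \<Rightarrow> ('v \<Rightarrow> ('m, 'a) tvec)
    \<Rightarrow> real set \<Rightarrow> (real \<Rightarrow> 'v) \<Rightarrow> bool" where
  "admissible A V \<rho> I c \<longleftrightarrow> smooth_map (interval_atlas I) (bundle_atlas A V) c \<and>
     (\<forall>u\<in>I. has_velocity A I (prj V \<circ> c) u (\<rho> (c u)))"

text \<open>\<open>solves A D F J \<psi>\<close>: on the interval \<open>J\<close> the curve \<open>\<psi>\<close> in \<open>A\<close> satisfies
  \<open>\<psi>'(u) = F u (\<psi> u)\<close>, where \<open>D u\<close> is the domain of \<open>F u\<close>.  The maximal solution through \<open>p\<close> at
  time \<open>a\<close> is \<open>sol A D F a p\<close>, with domain \<open>sol_dom A D F a p\<close>.\<close>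

definition solves :: "('x, 'a::real_normed_vector) atlas \<Rightarrow> (real \<Rightarrow> 'x set)
    \<Rightarrow> (real \<Rightarrow> 'x \<Rightarrow> ('x, 'a) tvec) \<Rightarrow> real set \<Rightarrow> (real \<Rightarrow> 'x) \<Rightarrow> bool" where
  "solves A D F J \<psi> \<longleftrightarrow> is_interval J \<and> continuous_map (top_of_set J) (atlas_top A) \<psi> \<and>
     (\<forall>u\<in>J. \<psi> u \<in> D u \<and> has_velocity A J \<psi> u (F u (\<psi> u)))"

definition sol_dom :: "('x, 'a::real_normed_vector) atlas \<Rightarrow> (real \<Rightarrow> 'x set)
    \<Rightarrow> (real \<Rightarrow> 'x \<Rightarrow> ('x, 'a) tvec) \<Rightarrow> real \<Rightarrow> 'x \<Rightarrow> real set" where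
  "sol_dom A D F a p = {u. \<exists>J \<psi>. solves A D F J \<psi> \<and> a \<in> J \<and> \<psi> a = p \<and> u \<in> J}"

definition sol :: "('x, 'a::real_normed_vector) atlas \<Rightarrow> (real \<Rightarrow> 'x set)
    \<Rightarrow> (real \<Rightarrow> 'x \<Rightarrow> ('x, 'a) tvec) \<Rightarrow> real \<Rightarrow> 'x \<Rightarrow> real \<Rightarrow> 'x" where
  "sol A D F a p u = (THE q. \<exists>J \<psi>. solves A D F J \<psi> \<and> a \<in> J \<and> \<psi> a = p \<and> u \<in> J \<and> \<psi> u = q)"

definition lift_state :: "('x, 'm, 'f, 'z) fbundle_scheme \<Rightarrow> ('v, 'm, 'k) vbundle
    \<Rightarrow> real set \<Rightarrow> (real \<Rightarrow> 'v) \<Rightarrow> real \<Rightarrow> 'x set" where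
  "lift_state B V I c u = (if u \<in> I then fibre B (prj V (c u)) else {})"

definition hlift_dom :: "('m, 'a::real_normed_vector) atlas
    \<Rightarrow> ('x, 'm, 'f::real_normed_vector, 'z) fbundle_scheme \<Rightarrow> ('v, 'm, 'k) vbundle
    \<Rightarrow> ('x \<times> 'v \<Rightarrow> ('x, 'a \<times> 'f) tvec) \<Rightarrow> real set \<Rightarrow> (real \<Rightarrow> 'v) \<Rightarrow> real \<Rightarrow> 'x \<Rightarrow> real set" where
  "hlift_dom A B V h I c a x =
     sol_dom (bundle_atlas A B) (lift_state B V I c) (\<lambda>u q. h (q, c u)) a x"

definition hlift :: "('m, 'a::real_normed_vector) atlas
    \<Rightarrow> ('x, 'm, 'f::real_normed_vector, 'z) fbundle_scheme \<Rightarrow> ('v, 'm, 'k) vbundle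
    \<Rightarrow> ('x \<times> 'v \<Rightarrow> ('x, 'a \<times> 'f) tvec) \<Rightarrow> real set \<Rightarrow> (real \<Rightarrow> 'v) \<Rightarrow> real \<Rightarrow> 'x \<Rightarrow> real \<Rightarrow> 'x" where
  "hlift A B V h I c a x u =
     sol (bundle_atlas A B) (lift_state B V I c) (\<lambda>u q. h (q, c u)) a x u"

definition hflow :: "('m, 'a::real_normed_vector) atlas
    \<Rightarrow> ('x, 'm, 'f::real_normed_vector, 'z) fbundle_scheme \<Rightarrow> ('v, 'm, 'k) vbundle
    \<Rightarrow> ('x \<times> 'v \<Rightarrow> ('x, 'a \<times> 'f) tvec) \<Rightarrow> real set \<Rightarrow> (real \<Rightarrow> 'v) \<Rightarrow> real \<Rightarrow> real \<Rightarrow> 'x \<Rightarrow> 'x" where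
  "hflow A B V h I c u a x = hlift A B V h I c a x u"

definition hflow_dom :: "('m, 'a::real_normed_vector) atlas
    \<Rightarrow> ('x, 'm, 'f::real_normed_vector, 'z) fbundle_scheme \<Rightarrow> ('v, 'm, 'k) vbundle
    \<Rightarrow> ('x \<times> 'v \<Rightarrow> ('x, 'a \<times> 'f) tvec) \<Rightarrow> real set \<Rightarrow> (real \<Rightarrow> 'v) \<Rightarrow> real \<Rightarrow> real \<Rightarrow> 'x set" where
  "hflow_dom A B V h I c u a = {x \<in> fibre B (prj V (c a)). u \<in> hlift_dom A B V h I c a x}"

text \<open>An integral curve of \<open>\<Lambda>\<close> through a point over \<open>a\<close> is parametrized so that it is over \<open>u\<close>
  at time \<open>u\<close>.  Hence the flow of \<open>\<Lambda>\<close> from time \<open>a\<close> to time \<open>u\<close> is taken as a map from the fibre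
  over \<open>a\<close> to the fibre over \<open>u\<close>; vertical vectors see no more of it.\<close>

abbreviation curve_pb :: "('x, 'm, 'f, 'z) fbundle_scheme \<Rightarrow> ('v, 'm, 'k) vbundle
    \<Rightarrow> real set \<Rightarrow> (real \<Rightarrow> 'v) \<Rightarrow> (real \<times> 'x, real, 'f) fbundle" where
  "curve_pb B V I c \<equiv> pullback I (prj V \<circ> c) B"

abbreviation curve_atlas :: "('x, 'm, 'f, 'z) fbundle_scheme \<Rightarrow> ('v, 'm, 'k) vbundle
    \<Rightarrow> real set \<Rightarrow> (real \<Rightarrow> 'v) \<Rightarrow> (real \<times> 'x, real \<times> 'f) atlas" where
  "curve_atlas B V I c \<equiv> bundle_atlas (interval_atlas I) (curve_pb B V I c)"

definition Lam :: "('m, 'a::real_normed_vector) atlas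
    \<Rightarrow> ('x, 'm, 'f::real_normed_vector, 'z) fbundle_scheme \<Rightarrow> ('v, 'm, 'k) vbundle
    \<Rightarrow> ('x \<times> 'v \<Rightarrow> ('x, 'a \<times> 'f) tvec) \<Rightarrow> real set \<Rightarrow> (real \<Rightarrow> 'v)
    \<Rightarrow> real \<times> 'x \<Rightarrow> (real \<times> 'x, real \<times> 'f) tvec" where
  "Lam A B V h I c p = (THE Z. Z \<in> tspace (curve_atlas B V I c) p \<and>
     tmap (curve_atlas B V I c) (interval_atlas I) (tot (curve_pb B V I c)) fst Z
       = velocity (interval_atlas I) I (\<lambda>s. s) (fst p) \<and>
     tmap (curve_atlas B V I c) (bundle_atlas A B) (tot (curve_pb B V I c)) snd Z
       = h (snd p, c (fst p)))"

definition icurve_dom :: "('m, 'a::real_normed_vector) atlas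
    \<Rightarrow> ('x, 'm, 'f::real_normed_vector, 'z) fbundle_scheme \<Rightarrow> ('v, 'm, 'k) vbundle
    \<Rightarrow> ('x \<times> 'v \<Rightarrow> ('x, 'a \<times> 'f) tvec) \<Rightarrow> real set \<Rightarrow> (real \<Rightarrow> 'v) \<Rightarrow> real \<Rightarrow> 'x \<Rightarrow> real set" where
  "icurve_dom A B V h I c a x =
     sol_dom (curve_atlas B V I c) (\<lambda>_. tot (curve_pb B V I c)) (\<lambda>_. Lam A B V h I c) a (a, x)"

definition icurve :: "('m, 'a::real_normed_vector) atlas
    \<Rightarrow> ('x, 'm, 'f::real_normed_vector, 'z) fbundle_scheme \<Rightarrow> ('v, 'm, 'k) vbundle
    \<Rightarrow> ('x \<times> 'v \<Rightarrow> ('x, 'a \<times> 'f) tvec) \<Rightarrow> real set \<Rightarrow> (real \<Rightarrow> 'v) \<Rightarrow> real \<Rightarrow> 'x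
    \<Rightarrow> real \<Rightarrow> real \<times> 'x" where
  "icurve A B V h I c a x u =
     sol (curve_atlas B V I c) (\<lambda>_. tot (curve_pb B V I c)) (\<lambda>_. Lam A B V h I c) a (a, x) u"

definition Lam_flow :: "('m, 'a::real_normed_vector) atlas
    \<Rightarrow> ('x, 'm, 'f::real_normed_vector, 'z) fbundle_scheme \<Rightarrow> ('v, 'm, 'k) vbundle
    \<Rightarrow> ('x \<times> 'v \<Rightarrow> ('x, 'a \<times> 'f) tvec) \<Rightarrow> real set \<Rightarrow> (real \<Rightarrow> 'v) \<Rightarrow> real \<Rightarrow> real
    \<Rightarrow> real \<times> 'x \<Rightarrow> real \<times> 'x" where
  "Lam_flow A B V h I c u a p = icurve A B V h I c a (snd p) u"

definition Lam_flow_dom :: "('m, 'a::real_normed_vector) atlas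
    \<Rightarrow> ('x, 'm, 'f::real_normed_vector, 'z) fbundle_scheme \<Rightarrow> ('v, 'm, 'k) vbundle
    \<Rightarrow> ('x \<times> 'v \<Rightarrow> ('x, 'a \<times> 'f) tvec) \<Rightarrow> real set \<Rightarrow> (real \<Rightarrow> 'v) \<Rightarrow> real \<Rightarrow> real
    \<Rightarrow> (real \<times> 'x) set" where
  "Lam_flow_dom A B V h I c u a =
     {p \<in> fibre (curve_pb B V I c) a. u \<in> icurve_dom A B V h I c a (snd p)}"

definition lie_Y :: "('m, 'a::real_normed_vector) atlas
    \<Rightarrow> ('x, 'm, 'f::real_normed_vector, 'w) abundle \<Rightarrow> ('w, 'm, 'f) vbundle \<Rightarrow> ('v, 'm, 'k) vbundle
    \<Rightarrow> ('x \<times> 'v \<Rightarrow> ('x, 'a \<times> 'f) tvec) \<Rightarrow> real set \<Rightarrow> (real \<Rightarrow> 'v) \<Rightarrow> real \<Rightarrow> 'x \<Rightarrow> 'w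
    \<Rightarrow> real \<Rightarrow> ('x, 'a \<times> 'f) tvec" where
  "lie_Y A E Eb V h I c a e w u =
     tmap (bundle_atlas A E) (bundle_atlas A E) (hflow_dom A E V h I c u a) (hflow A E V h I c u a)
       (vlift A E Eb e w)"

definition lie_Ups :: "('m, 'a::real_normed_vector) atlas
    \<Rightarrow> ('x, 'm, 'f::real_normed_vector, 'w) abundle \<Rightarrow> ('w, 'm, 'f) vbundle \<Rightarrow> ('v, 'm, 'k) vbundle
    \<Rightarrow> ('x \<times> 'v \<Rightarrow> ('x, 'a \<times> 'f) tvec) \<Rightarrow> real set \<Rightarrow> (real \<Rightarrow> 'v) \<Rightarrow> real \<Rightarrow> 'x \<Rightarrow> 'w
    \<Rightarrow> real \<Rightarrow> (real \<times> 'x, real \<times> 'f) tvec" where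
  "lie_Ups A E Eb V h I c a e w u =
     tmap (curve_atlas E V I c) (curve_atlas E V I c)
       (Lam_flow_dom A E V h I c u a) (Lam_flow A E V h I c u a)
       (vlift (interval_atlas I) (apullback I (prj V \<circ> c) E) (vpullback I (prj V \<circ> c) Eb) (a, e) (a, w))"

end

theory Submission
  imports Defs
begin

text \<open>
  In a local trivialization a lift of the admissible curve, over the base curve, is determined by its
  fibre component, which solves a time-dependent ordinary differential equation on the model fibre; the same
  equation describes the integral curves of \<open>\<Lambda>\<^sub>c\<close>, which are therefore \<open>u \<mapsto> (u, c\<^sup>h\<^sub>e(u))\<close>.
  Uniqueness, openness of the flow domain and differentiability in the initial value are proved for this
  equation on short intervals and propagated along the curve by connectedness.  By the chain rule both
  transported vectors then are velocities at \<open>t = 0\<close>, of \<open>t \<mapsto> \<phi>(e + tw)\<close> and of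
  \<open>t \<mapsto> (u, \<phi>(e + tw))\<close>, which gives the first claim.  If \<open>h\<close> is affine, the sum of an \<open>h\<close>-lift and a
  lift of the linear part is an \<open>h\<close>-lift, and scaling preserves lifts of the linear part; so
  \<open>\<phi>(e + tw) = \<phi>(e) + t \<phi>(w)\<close> with the flow of the linear part in the last term.
\<close>

section \<open>Ordinary differential equations on a compact interval\<close>

text \<open>Two features of the setting shape the work. The interval \<open>I\<close> may contain
  end points, so a chart of the pullback bundle has as image a strip over a relatively open part of
  \<open>I\<close>, which need not be open. Derivatives within such a strip are still unique, since
  enough directions remain. The flow, by contrast, is a map between two fibres, and a derivative
  within a fibre is not unique; only its values on vertical vectors are determined, because these
  are velocities of lines that stay in the fibre. For this reason both translates are rewritten as
  velocities of curves before anything is compared.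

  The field \<open>Lam\<close> and the tangent vector \<open>fp_tvec\<close> of the fibre product
  are given by definite descriptions, so each requires existence and uniqueness. Both are obtained
  in the same way: the two projections force the components in every chart, and these components are
  then checked to transform as a tangent vector. The fibre component of a lift suffices because the
  base component of \<open>h\<close> is the anchor and the curve is admissible.\<close>

lemma norm_diff_le_of_vector_derivative:
  fixes q :: "real \<Rightarrow> 'b::real_normed_vector"
  assumes "convex T"
    and "\<And>t. t \<in> T \<Longrightarrow> (q has_vector_derivative q' t) (at t within T)"
    and "\<And>t. t \<in> T \<Longrightarrow> norm (q' t) \<le> B"
    and "s \<in> T" "t \<in> T"
  shows "norm (q t - q s) \<le> B * \<bar>t - s\<bar>"
proof -
  have "norm (q t - q s) \<le> B * norm (t - s)"
  proof (rule differentiable_bound[OF assms(1), where f' = "\<lambda>t d. d *\<^sub>R q' t"])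
    fix x assume "x \<in> T"
    then show "(q has_derivative (\<lambda>d. d *\<^sub>R q' x)) (at x within T)"
      using assms(2) by (simp add: has_vector_derivative_def)
    show "onorm (\<lambda>d. d *\<^sub>R q' x) \<le> B"
      using assms(3)[OF \<open>x \<in> T\<close>]
      by (intro onorm_le) (metis abs_ge_zero mult.commute mult_right_mono norm_scaleR real_norm_def)
  qed (use assms in auto)
  then show ?thesis by simp
qed

text \<open>On short intervals the maximum of the norm can be absorbed, so no exponential is needed.\<close>

lemma short_gronwall:
  fixes r :: "real \<Rightarrow> 'b::real_normed_vector"
  assumes der: "\<And>t. t \<in> {\<alpha>..\<beta>} \<Longrightarrow> (r has_vector_derivative r' t) (at t within {\<alpha>..\<beta>})"
    and bd: "\<And>t. t \<in> {\<alpha>..\<beta>} \<Longrightarrow> norm (r' t) \<le> L * norm (r t) + \<eta>"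
    and "0 \<le> L" "0 \<le> \<eta>" and short: "(\<beta> - \<alpha>) * L \<le> 1/2"
    and s: "s \<in> {\<alpha>..\<beta>}" and t: "t \<in> {\<alpha>..\<beta>}"
  shows "norm (r t) \<le> 2 * (norm (r s) + (\<beta> - \<alpha>) * \<eta>)"
proof -
  have "continuous_on {\<alpha>..\<beta>} r"
    using der by (meson continuous_on_eq_continuous_within has_vector_derivative_continuous)
  then have "continuous_on {\<alpha>..\<beta>} (\<lambda>t. norm (r t))" by (intro continuous_intros)
  then obtain m where m: "m \<in> {\<alpha>..\<beta>}" "\<And>t. t \<in> {\<alpha>..\<beta>} \<Longrightarrow> norm (r t) \<le> norm (r m)"
    using continuous_attains_sup[of "{\<alpha>..\<beta>}" "\<lambda>t. norm (r t)"] s by auto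
  let ?B = "L * norm (r m) + \<eta>"
  have "norm (r m - r s) \<le> ?B * \<bar>m - s\<bar>"
  proof (rule norm_diff_le_of_vector_derivative[OF _ der])
    fix t assume "t \<in> {\<alpha>..\<beta>}"
    show "norm (r' t) \<le> ?B"
      using bd[OF \<open>t \<in> _\<close>] mult_left_mono[OF m(2)[OF \<open>t \<in> _\<close>] \<open>0 \<le> L\<close>] by simp
  qed (use m s in auto)
  also have "\<dots> \<le> ?B * (\<beta> - \<alpha>)"
    using m(1) s assms(3,4) by (intro mult_left_mono) auto
  also have "\<dots> = ((\<beta> - \<alpha>) * L) * norm (r m) + (\<beta> - \<alpha>) * \<eta>" by (simp add: algebra_simps)
  also have "\<dots> \<le> 1/2 * norm (r m) + (\<beta> - \<alpha>) * \<eta>"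
    using mult_right_mono[OF short norm_ge_zero[of "r m"]] by simp
  \<comment> \<open>The half of \<open>norm (r m)\<close> on the right moves to the left, which is
    the origin of the factor 2.\<close>
  finally have "norm (r m) \<le> 2 * (norm (r s) + (\<beta> - \<alpha>) * \<eta>)"
    using norm_triangle_sub[of "r m" "r s"] by (simp add: field_simps)
  then show ?thesis using m(2)[OF t] by linarith
qed

text \<open>The invariance assumption \<open>inv\<close> is phrased with antiderivatives \<open>P\<close>, so that the proof is
  symmetric in the two directions of time.\<close>

lemma picard:
  fixes g :: "real \<Rightarrow> 'b::banach \<Rightarrow> 'b"
  assumes s: "s \<in> {\<alpha>..\<beta>}" and "closed C" "x \<in> C"
    and cont: "continuous_on ({\<alpha>..\<beta>} \<times> C) (\<lambda>(t, q). g t q)"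
    and lip: "\<And>t p q. t \<in> {\<alpha>..\<beta>} \<Longrightarrow> p \<in> C \<Longrightarrow> q \<in> C \<Longrightarrow> norm (g t p - g t q) \<le> L * norm (p - q)"
    and "0 \<le> L" and short: "(\<beta> - \<alpha>) * L \<le> 1/2"
    and inv: "\<And>p P t. (\<And>t. t \<in> {\<alpha>..\<beta>} \<Longrightarrow> p t \<in> C) \<Longrightarrow> P s = x \<Longrightarrow>
      (\<And>t. t \<in> {\<alpha>..\<beta>} \<Longrightarrow> (P has_vector_derivative g t (p t)) (at t within {\<alpha>..\<beta>})) \<Longrightarrow>
      t \<in> {\<alpha>..\<beta>} \<Longrightarrow> P t \<in> C"
  shows "\<exists>q. q s = x \<and> (\<forall>t\<in>{\<alpha>..\<beta>}. q t \<in> C \<and> (q has_vector_derivative g t (q t)) (at t within {\<alpha>..\<beta>}))"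
proof -
  let ?T = "{\<alpha>..\<beta>}"
  \<comment> \<open>Clamping time to the interval turns a continuous function on it into a bounded
    continuous function on the whole line, so that the iteration can run in the complete space of
    such functions.\<close>
  define k where "k t = max \<alpha> (min \<beta> t)" for t :: real
  have k_in: "k t \<in> ?T" for t using s by (auto simp: k_def)
  have k_id: "k t = t" if "t \<in> ?T" for t using that by (auto simp: k_def)
  have k_cont: "continuous_on X k" for X unfolding k_def by (intro continuous_intros)
  define S where "S = {f :: real \<Rightarrow>\<^sub>C 'b. \<forall>t. apply_bcontfun f t \<in> C}"
  have "S = PiC UNIV (\<lambda>_. C)" by (auto simp: S_def intro!: mem_PiCI dest: mem_PiCD)
  then have "closed S" using closed_PiC[of UNIV "\<lambda>_. C"] \<open>closed C\<close> by simp
  then have S: "complete S" "S \<noteq> {}"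
    using \<open>x \<in> C\<close> by (auto simp: complete_eq_closed S_def intro!: exI[of _ "const_bcontfun x"])
  \<comment> \<open>A difference of two integrals from \<alpha>, because \<open>t\<close> may lie on
    either side of \<open>s\<close>.\<close>
  define J where "J f t = x + (integral {\<alpha>..t} (\<lambda>\<tau>. g \<tau> (apply_bcontfun f \<tau>))
    - integral {\<alpha>..s} (\<lambda>\<tau>. g \<tau> (apply_bcontfun f \<tau>)))" for f :: "real \<Rightarrow>\<^sub>C 'b" and t
  have Jder: "(J f has_vector_derivative g t (apply_bcontfun f t)) (at t within ?T)"
    if "f \<in> S" "t \<in> ?T" for f t
  proof -
    have "continuous_on ?T (\<lambda>\<tau>. (\<tau>, apply_bcontfun f \<tau>))"
      by (intro continuous_intros continuous_on_apply_bcontfun)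
    from continuous_on_compose2[OF cont this] have "continuous_on ?T (\<lambda>\<tau>. g \<tau> (apply_bcontfun f \<tau>))"
      using that(1) by (auto simp: S_def)
    from integral_has_vector_derivative[OF this that(2)] show ?thesis
      unfolding J_def by (auto intro!: derivative_eq_intros)
  qed
  have Js: "J f s = x" for f by (simp add: J_def)
  have JC: "J f t \<in> C" if "f \<in> S" "t \<in> ?T" for f t
    using inv[OF _ Js Jder[OF that(1)] that(2)] that by (auto simp: S_def)
  define P where "P f = Bcontfun (\<lambda>t. J f (k t))" for f
  have P: "apply_bcontfun (P f) t = J f (k t)" if "f \<in> S" for f t
  proof -
    have "continuous_on ?T (J f)"
      using Jder[OF that] by (meson continuous_on_eq_continuous_within has_vector_derivative_continuous)
    then have "continuous_on UNIV (\<lambda>t. J f (k t))" "bounded (J f ` ?T)"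
      using continuous_on_compose2[of ?T "J f" UNIV k] k_cont k_in
        compact_continuous_image[of ?T "J f"] by (auto simp: image_subset_iff intro: compact_imp_bounded)
    then have "(\<lambda>t. J f (k t)) \<in> bcontfun"
      unfolding bcontfun_def using k_in by (auto elim!: bounded_subset)
    then show ?thesis by (simp add: P_def Bcontfun_inverse)
  qed
  have "\<exists>!f\<in>S. P f = f"
  proof (rule Banach_fix[OF S])
    show "P ` S \<subseteq> S" using JC k_in P by (auto simp: S_def)
    fix f f' assume f: "f \<in> S" "f' \<in> S"
    show "dist (P f) (P f') \<le> 1/2 * dist f f'"
    proof (rule dist_bound)
      fix t
      \<comment> \<open>Both images take the value \<open>x\<close> at \<open>s\<close>, so a bound
        on the derivative of their difference gives the contraction constant
        \<open>(\<beta> - \<alpha>) * L\<close>, at most one half.\<close>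
      have "norm ((J f (k t) - J f' (k t)) - (J f s - J f' s)) \<le> L * dist f f' * \<bar>k t - s\<bar>"
      proof (rule norm_diff_le_of_vector_derivative[of ?T])
        fix \<tau> assume \<tau>: "\<tau> \<in> ?T"
        show "((\<lambda>t. J f t - J f' t) has_vector_derivative
            g \<tau> (apply_bcontfun f \<tau>) - g \<tau> (apply_bcontfun f' \<tau>)) (at \<tau> within ?T)"
          using Jder f \<tau> by (auto intro!: derivative_intros)
        have "norm (g \<tau> (apply_bcontfun f \<tau>) - g \<tau> (apply_bcontfun f' \<tau>))
            \<le> L * dist (apply_bcontfun f \<tau>) (apply_bcontfun f' \<tau>)"
          using lip \<tau> f by (auto simp: S_def dist_norm)
        also have "\<dots> \<le> L * dist f f'" using \<open>0 \<le> L\<close> by (intro mult_left_mono dist_bounded)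
        finally show "norm (g \<tau> (apply_bcontfun f \<tau>) - g \<tau> (apply_bcontfun f' \<tau>)) \<le> L * dist f f'" .
      qed (use s k_in in auto)
      also have "\<dots> \<le> L * dist f f' * (\<beta> - \<alpha>)"
        using k_in[of t] s \<open>0 \<le> L\<close> by (intro mult_left_mono) (auto simp: abs_if)
      also have "\<dots> = ((\<beta> - \<alpha>) * L) * dist f f'" by simp
      also have "\<dots> \<le> 1/2 * dist f f'" by (intro mult_right_mono short) simp
      finally show "dist (apply_bcontfun (P f) t) (apply_bcontfun (P f') t) \<le> 1/2 * dist f f'"
        by (simp add: P f Js dist_norm)
    qed
  qed auto
  then obtain f where f: "f \<in> S" "P f = f" by blast
  have eq: "apply_bcontfun f t = J f (k t)" for t using P[OF f(1)] f(2) by simp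
  have "(apply_bcontfun f has_vector_derivative g t (apply_bcontfun f t)) (at t within ?T)"
    if "t \<in> ?T" for t
    using Jder[OF f(1) that] eq k_id that
    by (metis (no_types, lifting) has_vector_derivative_transform)
  moreover have "apply_bcontfun f s = x" using eq[of s] k_id[OF s] Js by simp
  ultimately show ?thesis using f(1) by (auto simp: S_def)
qed

text \<open>By continuity at \<open>(ts, qs)\<close> the field and its derivative stay within
  distance 1 of their values there. The bound on the derivative becomes a Lipschitz bound because
  balls are convex.\<close>

lemma C1_local_bounds:
  fixes G :: "real \<Rightarrow> 'f::real_normed_vector \<Rightarrow> 'f"
  assumes ts: "ts \<in> N"
    and contG: "continuous_on (N \<times> UNIV) (\<lambda>(t, q). G t q)"
    and contD: "continuous_on (N \<times> UNIV) (\<lambda>(t, q). DG t q :: 'f \<Rightarrow>\<^sub>L 'f)"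
    and der: "\<forall>t\<in>N. \<forall>q. (G t has_derivative blinfun_apply (DG t q)) (at q)"
  shows "\<exists>d R M L. 0 < d \<and> 0 < R \<and> 0 < M \<and> 0 < L \<and>
    (\<forall>t\<in>N. \<bar>t - ts\<bar> \<le> d \<longrightarrow> (\<forall>q\<in>cball qs R. norm (G t q) \<le> M \<and> norm (DG t q) \<le> L \<and>
      (\<forall>p\<in>cball qs R. norm (G t p - G t q) \<le> L * norm (p - q))))"
proof -
  define M L where "M = norm (G ts qs) + 1" and "L = norm (DG ts qs) + 1"
  obtain d1 where d1: "d1 > 0" "\<And>t q. t \<in> N \<Longrightarrow> dist (t, q) (ts, qs) < d1 \<Longrightarrow> dist (G t q) (G ts qs) < 1"
    using contG[unfolded continuous_on_iff, rule_format, of "(ts, qs)" 1] ts by auto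
  obtain d2 where d2: "d2 > 0" "\<And>t q. t \<in> N \<Longrightarrow> dist (t, q) (ts, qs) < d2 \<Longrightarrow> dist (DG t q) (DG ts qs) < 1"
    using contD[unfolded continuous_on_iff, rule_format, of "(ts, qs)" 1] ts by auto
  \<comment> \<open>A third, because the distance in the product is bounded by the sum of two
    distances of at most \<open>d\<close> and has to be strictly less than
    \<open>min d1 d2\<close>.\<close>
  define d where "d = min d1 d2 / 3"
  have d: "d > 0" using d1(1) d2(1) by (simp add: d_def)
  have near: "dist (t, q) (ts, qs) < min d1 d2" if "\<bar>t - ts\<bar> \<le> d" "q \<in> cball qs d" for t q
  proof -
    have "dist (t, q) (ts, qs) \<le> dist t ts + dist q qs"
      using sqrt_sum_squares_le_sum_abs[of "dist t ts" "dist q qs"] by (simp add: dist_Pair_Pair)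
    also have "\<dots> \<le> 2 * d" using that by (simp add: dist_real_def dist_commute)
    finally show ?thesis using d unfolding d_def by linarith
  qed
  have GM: "norm (G t q) \<le> M" if "t \<in> N" "\<bar>t - ts\<bar> \<le> d" "q \<in> cball qs d" for t q
    using d1(2)[OF that(1), of q] near[OF that(2,3)] norm_triangle_sub[of "G t q" "G ts qs"]
    by (simp add: M_def dist_norm)
  have DL: "norm (DG t q) \<le> L" if "t \<in> N" "\<bar>t - ts\<bar> \<le> d" "q \<in> cball qs d" for t q
    using d2(2)[OF that(1), of q] near[OF that(2,3)] norm_triangle_sub[of "DG t q" "DG ts qs"]
    by (simp add: L_def dist_norm)
  have lip: "norm (G t p - G t q) \<le> L * norm (p - q)"
    if t: "t \<in> N" "\<bar>t - ts\<bar> \<le> d" and "p \<in> cball qs d" "q \<in> cball qs d" for t p q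
  proof (rule differentiable_bound[of "cball qs d" "G t" "\<lambda>q. blinfun_apply (DG t q)"])
    fix x assume "x \<in> cball qs d"
    then show "onorm (blinfun_apply (DG t x)) \<le> L" using DL[OF t] by (simp add: norm_blinfun.rep_eq)
    show "(G t has_derivative blinfun_apply (DG t x)) (at x within cball qs d)"
      using der t(1) by (blast intro: has_derivative_at_withinI)
  qed (use that in auto)
  have "0 < M" "0 < L" by (simp_all add: M_def L_def add_nonneg_pos)
  show ?thesis
    by (rule exI[of _ d], rule exI[of _ d], rule exI[of _ M], rule exI[of _ L])
      (intro conjI ballI impI d \<open>0 < M\<close> \<open>0 < L\<close> GM DL lip)
qed

text \<open>Cutting the interval of radius \<epsilon> about \<open>ts\<close> down to the given one
  leaves a relative neighbourhood of \<open>ts\<close>, even if \<open>ts\<close> is an end point.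
  Its length is at most twice \<epsilon>, hence the bound \<open>1 / (2 * K)\<close>.\<close>

lemma short_interval:
  fixes ts :: real
  assumes "ts \<in> {\<alpha>0..\<beta>0}" "0 < d" "0 < K"
  obtains \<alpha> \<beta> \<epsilon> where "ts \<in> {\<alpha>..\<beta>}" "{\<alpha>..\<beta>} \<subseteq> {\<alpha>0..\<beta>0}" "\<And>t. t \<in> {\<alpha>..\<beta>} \<Longrightarrow> \<bar>t - ts\<bar> \<le> d"
    "(\<beta> - \<alpha>) * K \<le> 1" "0 < \<epsilon>" "\<And>t. t \<in> {\<alpha>0..\<beta>0} \<Longrightarrow> \<bar>t - ts\<bar> < \<epsilon> \<Longrightarrow> t \<in> {\<alpha>..\<beta>}"
proof -
  define \<epsilon> where "\<epsilon> = min d (1 / (2 * K))"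
  have \<epsilon>: "0 < \<epsilon>" "\<epsilon> \<le> d" "2 * \<epsilon> \<le> 1 / K" using assms by (auto simp: \<epsilon>_def min_def)
  define \<alpha> \<beta> where "\<alpha> = max \<alpha>0 (ts - \<epsilon>)" and "\<beta> = min \<beta>0 (ts + \<epsilon>)"
  have "\<beta> - \<alpha> \<le> 2 * \<epsilon>" by (simp add: \<alpha>_def \<beta>_def)
  then have "\<beta> - \<alpha> \<le> 1 / K" using \<epsilon> by linarith
  then have "(\<beta> - \<alpha>) * K \<le> 1" using \<open>0 < K\<close> by (simp add: field_simps)
  then show ?thesis using \<epsilon> assms(1) by (intro that[of \<alpha> \<beta> \<epsilon>]) (auto simp: \<alpha>_def \<beta>_def)
qed

text \<open>Solutions come from \<open>picard\<close>, and their derivative in the initial value is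
  the solution of the variational equation. The initial time \<open>s\<close> is arbitrary in the
  short interval rather than fixed to be \<open>ts\<close>, because the continuation along a curve
  restarts the flow at any time near \<open>ts\<close>.\<close>

theorem ode_local_flow:
  fixes G :: "real \<Rightarrow> 'f::banach \<Rightarrow> 'f"
  assumes ts: "ts \<in> {\<alpha>0..\<beta>0}"
    and contG: "continuous_on ({\<alpha>0..\<beta>0} \<times> UNIV) (\<lambda>(t, q). G t q)"
    and contD: "continuous_on ({\<alpha>0..\<beta>0} \<times> UNIV) (\<lambda>(t, q). DG t q :: 'f \<Rightarrow>\<^sub>L 'f)"
    and der: "\<forall>t\<in>{\<alpha>0..\<beta>0}. \<forall>q. (G t has_derivative blinfun_apply (DG t q)) (at q)"
  obtains \<alpha> \<beta> \<epsilon> R \<Phi> where "ts \<in> {\<alpha>..\<beta>}" "{\<alpha>..\<beta>} \<subseteq> {\<alpha>0..\<beta>0}"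
    "0 < \<epsilon>" "\<And>t. t \<in> {\<alpha>0..\<beta>0} \<Longrightarrow> \<bar>t - ts\<bar> < \<epsilon> \<Longrightarrow> t \<in> {\<alpha>..\<beta>}" "0 < R"
    "\<And>s x. s \<in> {\<alpha>..\<beta>} \<Longrightarrow> x \<in> ball qs R \<Longrightarrow> \<Phi> s x s = x"
    "\<And>s x t. s \<in> {\<alpha>..\<beta>} \<Longrightarrow> x \<in> ball qs R \<Longrightarrow> t \<in> {\<alpha>..\<beta>} \<Longrightarrow>
       (\<Phi> s x has_vector_derivative G t (\<Phi> s x t)) (at t within {\<alpha>..\<beta>})"
    "\<And>s x t. s \<in> {\<alpha>..\<beta>} \<Longrightarrow> x \<in> ball qs R \<Longrightarrow> t \<in> {\<alpha>..\<beta>} \<Longrightarrow> (\<lambda>x. \<Phi> s x t) differentiable (at x)"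
proof -
  obtain d R0 M L where pos: "0 < d" "0 < R0" "0 < M" "0 < L"
    and bounds: "\<forall>t\<in>{\<alpha>0..\<beta>0}. \<bar>t - ts\<bar> \<le> d \<longrightarrow> (\<forall>q\<in>cball qs R0. norm (G t q) \<le> M \<and> norm (DG t q) \<le> L \<and>
      (\<forall>p\<in>cball qs R0. norm (G t p - G t q) \<le> L * norm (p - q)))"
    using C1_local_bounds[OF ts contG contD der, of qs] by (elim exE conjE) (rule that)
  note M = bounds[rule_format, THEN conjunct1]
  note L = bounds[rule_format, THEN conjunct2, THEN conjunct1]
  note lip = bounds[rule_format, THEN conjunct2, THEN conjunct2, rule_format]
  \<comment> \<open>Solutions start within half the radius \<open>R0\<close> and may move by the
    other half. The constant \<open>K\<close> combines the two conditions on the length of the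
    interval: the contraction factor 1/2, and a displacement of at most \<open>R\<close> at speed
    \<open>M\<close>.\<close>
  define R where "R = R0 / 2"
  define K where "K = max (2 * L) (M / R)"
  have "0 < R" "0 < K" using pos by (auto simp: R_def K_def)
  obtain \<alpha> \<beta> \<epsilon> where ab: "ts \<in> {\<alpha>..\<beta>}" "{\<alpha>..\<beta>} \<subseteq> {\<alpha>0..\<beta>0}" "\<And>t. t \<in> {\<alpha>..\<beta>} \<Longrightarrow> \<bar>t - ts\<bar> \<le> d"
    "(\<beta> - \<alpha>) * K \<le> 1" "0 < \<epsilon>" "\<And>t. t \<in> {\<alpha>0..\<beta>0} \<Longrightarrow> \<bar>t - ts\<bar> < \<epsilon> \<Longrightarrow> t \<in> {\<alpha>..\<beta>}"
    using short_interval[OF ts \<open>0 < d\<close> \<open>0 < K\<close>] by metis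
  have "0 \<le> \<beta> - \<alpha>" using ab(1) by simp
  have "(\<beta> - \<alpha>) * (2 * L) \<le> (\<beta> - \<alpha>) * K" "(\<beta> - \<alpha>) * (M / R) \<le> (\<beta> - \<alpha>) * K"
    using \<open>0 \<le> \<beta> - \<alpha>\<close> by (intro mult_left_mono; simp add: K_def)+
  then have short: "(\<beta> - \<alpha>) * L \<le> 1/2" and "(\<beta> - \<alpha>) * (M / R) \<le> 1" using ab(4) by auto
  then have shortM: "(\<beta> - \<alpha>) * M \<le> R" using \<open>0 < R\<close> by (simp add: field_simps)
  let ?T = "{\<alpha>..\<beta>}" and ?C = "cball qs R0"
  have T: "t \<in> {\<alpha>0..\<beta>0}" "\<bar>t - ts\<bar> \<le> d" if "t \<in> ?T" for t using ab that by auto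
  have sol: "\<exists>q. q s = x \<and> (\<forall>t\<in>?T. q t \<in> ?C \<and> (q has_vector_derivative G t (q t)) (at t within ?T))"
    if s: "s \<in> ?T" and x: "x \<in> ball qs R" for s x
  proof (rule picard[OF s])
    show "x \<in> ?C" using x \<open>0 < R\<close> by (simp add: R_def)
    show "continuous_on (?T \<times> ?C) (\<lambda>(t, q). G t q)"
      by (rule continuous_on_subset[OF contG]) (use ab(2) in auto)
    fix p P t
    assume p: "\<And>t. t \<in> ?T \<Longrightarrow> p t \<in> ?C" and "P s = x" and t: "t \<in> ?T"
      and P: "\<And>t. t \<in> ?T \<Longrightarrow> (P has_vector_derivative G t (p t)) (at t within ?T)"
    have "norm (P t - P s) \<le> M * \<bar>t - s\<bar>"
      by (rule norm_diff_le_of_vector_derivative[OF _ P]) (use M T p s t in auto)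
    also have "\<dots> \<le> M * (\<beta> - \<alpha>)" using s t pos by (intro mult_left_mono) auto
    finally have "norm (P t - x) \<le> R" using shortM \<open>P s = x\<close> by (simp add: mult.commute)
    then have "dist x (P t) \<le> R" by (simp add: dist_norm norm_minus_commute)
    then show "P t \<in> ?C" using x dist_triangle[of qs "P t" x] by (simp add: R_def)
  qed (use lip T pos short in auto)
  define \<Phi> where "\<Phi> s x = (SOME q. q s = x \<and> (\<forall>t\<in>?T. q t \<in> ?C \<and>
    (q has_vector_derivative G t (q t)) (at t within ?T)))" for s x
  have \<Phi>: "\<Phi> s x s = x" "t \<in> ?T \<Longrightarrow> \<Phi> s x t \<in> ?C"
    "t \<in> ?T \<Longrightarrow> (\<Phi> s x has_vector_derivative G t (\<Phi> s x t)) (at t within ?T)"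
    if "s \<in> ?T" "x \<in> ball qs R" for s x t
    using someI_ex[OF sol[OF that]] unfolding \<Phi>_def[symmetric] by auto
  have diff: "(\<lambda>x. \<Phi> s x t) differentiable (at x)"
    if s: "s \<in> ?T" and x: "x \<in> ball qs R" and t: "t \<in> ?T" for s x t
  proof -
    \<comment> \<open>The linearization of the field along the solution, that is, the coefficient of
      the variational equation.\<close>
    define A where "A \<tau> = DG \<tau> (\<Phi> s x \<tau>)" for \<tau>
    have \<Phi>cont: "continuous_on ?T (\<Phi> s x)"
      using \<Phi>(3)[OF s x] by (meson continuous_on_eq_continuous_within has_vector_derivative_continuous)
    have Acont: "continuous_on ?T A"
      unfolding A_def
      by (rule continuous_on_compose2[OF contD continuous_on_Pair[OF continuous_on_id \<Phi>cont], unfolded prod.case])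
        (use ab(2) in auto)
    have AL: "norm (A \<tau>) \<le> L" if "\<tau> \<in> ?T" for \<tau>
      unfolding A_def by (intro L T \<Phi>(2) s x that)
    \<comment> \<open>The variational equation is solved in the Banach space of operators, starting
      from the identity. It is globally Lipschitz with constant \<open>L\<close>, so the constraint
      set is the whole space. The solution \<open>W\<close> is the candidate for the
      derivative.\<close>
    have "\<exists>W. W s = id_blinfun \<and> (\<forall>t\<in>?T. W t \<in> UNIV \<and>
        (W has_vector_derivative A t o\<^sub>L W t) (at t within ?T))"
    proof (rule picard[OF s])
      show "continuous_on (?T \<times> UNIV) (\<lambda>(t, q). A t o\<^sub>L q)"
        unfolding split_beta
        by (intro bounded_bilinear.continuous_on[OF bounded_bilinear_blinfun_compose]
            continuous_on_compose2[OF Acont continuous_on_fst] continuous_intros) auto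
      fix \<tau> and p q :: "'f \<Rightarrow>\<^sub>L 'f" assume "\<tau> \<in> ?T"
      have "norm (A \<tau> o\<^sub>L (p - q)) \<le> norm (A \<tau>) * norm (p - q)" by (rule norm_blinfun_compose)
      also have "\<dots> \<le> L * norm (p - q)" by (intro mult_right_mono AL \<open>\<tau> \<in> ?T\<close>) simp
      finally show "norm ((A \<tau> o\<^sub>L p) - (A \<tau> o\<^sub>L q)) \<le> L * norm (p - q)"
        by (simp add: bounded_bilinear.diff_right[OF bounded_bilinear_blinfun_compose])
    qed (use pos short in auto)
    then obtain W where W: "W s = id_blinfun"
      "\<And>t. t \<in> ?T \<Longrightarrow> (W has_vector_derivative A t o\<^sub>L W t) (at t within ?T)" by blast
    have "((\<lambda>y. \<Phi> s y t) has_derivative blinfun_apply (W t)) (at x)"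
      unfolding has_derivative_at_alt
    proof (intro conjI allI impI blinfun.bounded_linear_right)
      fix e :: real assume "0 < e"
      \<comment> \<open>The short estimate is used twice and contributes a factor 2 each time, hence
        the 4. Adding 1 avoids division by zero on a one-point interval.\<close>
      define \<eta> where "\<eta> = e / (4 * (\<beta> - \<alpha> + 1))"
      have "0 < \<eta>" using \<open>0 < e\<close> \<open>0 \<le> \<beta> - \<alpha>\<close> by (simp add: \<eta>_def)
      have "4 * ((\<beta> - \<alpha>) * \<eta>) = e * ((\<beta> - \<alpha>) / (\<beta> - \<alpha> + 1))"
        unfolding \<eta>_def using \<open>0 \<le> \<beta> - \<alpha>\<close> by (simp add: field_simps)
      also have "\<dots> \<le> e * 1" using \<open>0 < e\<close> \<open>0 \<le> \<beta> - \<alpha>\<close> by (intro mult_left_mono) auto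
      finally have \<eta>: "4 * ((\<beta> - \<alpha>) * \<eta>) \<le> e" by simp
      \<comment> \<open>Here \<open>z\<close> is a displacement from the solution. Compactness of
        the time interval yields one radius \<open>\<delta>0\<close> of displacements that works for
        all times.\<close>
      define D where "D = (\<lambda>(z, \<tau>). DG \<tau> (\<Phi> s x \<tau> + z))"
      have c: "continuous_on (UNIV \<times> ?T) (\<lambda>p. (snd p, \<Phi> s x (snd p) + fst p))"
        by (intro continuous_intros continuous_on_compose2[OF \<Phi>cont continuous_on_snd]) auto
      have "continuous_on (UNIV \<times> ?T) D"
        unfolding D_def split_beta
        by (rule continuous_on_compose2[OF contD c, unfolded prod.case]) (use ab(2) in auto)
      then obtain X0 where X0: "0 \<in> X0" "open X0"
        "\<forall>z\<in>X0 \<inter> UNIV. \<forall>\<tau>\<in>?T. dist (D (z, \<tau>)) (D (0, \<tau>)) \<le> \<eta>"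
        using continuous_on_prod_compactE[of UNIV ?T D 0 \<eta>] \<open>0 < \<eta>\<close> by (metis UNIV_I compact_Icc)
      then obtain \<delta>0 where \<delta>0: "0 < \<delta>0" "ball 0 \<delta>0 \<subseteq> X0" using open_contains_ball by blast
      obtain \<delta>1 where \<delta>1: "0 < \<delta>1" "ball x \<delta>1 \<subseteq> ball qs R" using x open_contains_ball open_ball by metis
      \<comment> \<open>The bound \<open>\<delta>1\<close> keeps \<open>y\<close> among the
        admissible initial values. The bound \<open>\<delta>0 / 2\<close> keeps the two solutions
        within \<open>\<delta>0\<close> of each other, since they spread by a factor of at most
        2.\<close>
      define \<delta> where "\<delta> = min \<delta>1 (\<delta>0 / 2)"
      have "0 < \<delta>" using \<delta>0 \<delta>1 by (simp add: \<delta>_def)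
      moreover have "norm (\<Phi> s y t - \<Phi> s x t - blinfun_apply (W t) (y - x)) \<le> e * norm (y - x)"
        if "norm (y - x) < \<delta>" for y
      proof -
        have y: "y \<in> ball qs R" using that \<delta>1(2) by (auto simp: \<delta>_def dist_norm norm_minus_commute)
        \<comment> \<open>First use of the short estimate: Lipschitz dependence on the initial
          value.\<close>
        have dy: "norm (\<Phi> s y \<tau> - \<Phi> s x \<tau>) \<le> 2 * norm (y - x)" if "\<tau> \<in> ?T" for \<tau>
        proof -
          have "norm (\<Phi> s y \<tau> - \<Phi> s x \<tau>) \<le> 2 * (norm (\<Phi> s y s - \<Phi> s x s) + (\<beta> - \<alpha>) * 0)"
          proof (rule short_gronwall[where r = "\<lambda>\<tau>. \<Phi> s y \<tau> - \<Phi> s x \<tau>" and L = L])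
            fix \<tau> assume \<tau>: "\<tau> \<in> ?T"
            show "((\<lambda>\<tau>. \<Phi> s y \<tau> - \<Phi> s x \<tau>) has_vector_derivative
                G \<tau> (\<Phi> s y \<tau>) - G \<tau> (\<Phi> s x \<tau>)) (at \<tau> within ?T)"
              using \<Phi>(3) s x y \<tau> by (auto intro!: derivative_intros)
            show "norm (G \<tau> (\<Phi> s y \<tau>) - G \<tau> (\<Phi> s x \<tau>)) \<le> L * norm (\<Phi> s y \<tau> - \<Phi> s x \<tau>) + 0"
              using lip[OF T[OF \<tau>]] \<Phi>(2)[OF s x \<tau>] \<Phi>(2)[OF s y \<tau>] by simp
          qed (use pos short s that in auto)
          then show ?thesis using \<Phi>(1) s x y by simp
        qed
        \<comment> \<open>Second use: the remainder vanishes at time \<open>s\<close> and satisfies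
          the variational equation up to the linearization error of \<open>G\<close>, which is at
          most \<eta> times the distance of the two solutions.\<close>
        have "norm (\<Phi> s y t - \<Phi> s x t - blinfun_apply (W t) (y - x))
          \<le> 2 * (norm (\<Phi> s y s - \<Phi> s x s - blinfun_apply (W s) (y - x))
              + (\<beta> - \<alpha>) * (\<eta> * (2 * norm (y - x))))"
        proof (rule short_gronwall[where r = "\<lambda>t. \<Phi> s y t - \<Phi> s x t - blinfun_apply (W t) (y - x)" and L = L])
          fix \<tau> assume \<tau>: "\<tau> \<in> ?T"
          let ?r = "\<lambda>t. \<Phi> s y t - \<Phi> s x t - blinfun_apply (W t) (y - x)"
          let ?e = "G \<tau> (\<Phi> s y \<tau>) - G \<tau> (\<Phi> s x \<tau>) - A \<tau> (\<Phi> s y \<tau> - \<Phi> s x \<tau>)"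
          have "((\<lambda>t. blinfun_apply (W t) (y - x)) has_vector_derivative
              blinfun_apply (A \<tau> o\<^sub>L W \<tau>) (y - x)) (at \<tau> within ?T)"
            by (rule bounded_linear.has_vector_derivative[OF blinfun.bounded_linear_left W(2)[OF \<tau>]])
          then show "(?r has_vector_derivative G \<tau> (\<Phi> s y \<tau>) - G \<tau> (\<Phi> s x \<tau>)
              - A \<tau> (W \<tau> (y - x))) (at \<tau> within ?T)"
            using \<Phi>(3) s x y \<tau> by (auto intro!: derivative_intros)
          have seg: "\<Phi> s x \<tau> + v *\<^sub>R (\<Phi> s y \<tau> - \<Phi> s x \<tau>) \<in> ball (\<Phi> s x \<tau>) \<delta>0"
            if "v \<in> {0..1}" for v
          proof -
            have "norm (v *\<^sub>R (\<Phi> s y \<tau> - \<Phi> s x \<tau>)) \<le> 1 * (2 * norm (y - x))"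
              unfolding norm_scaleR using that dy[OF \<tau>] by (intro mult_mono) auto
            also have "\<dots> < \<delta>0" using \<open>norm (y - x) < \<delta>\<close> by (simp add: \<delta>_def)
            finally show ?thesis by (simp add: dist_norm)
          qed
          have "norm ?e \<le> norm (\<Phi> s y \<tau> - \<Phi> s x \<tau>) * \<eta>"
            unfolding A_def
          proof (rule differentiable_bound_linearization[of "\<Phi> s x \<tau>" "\<Phi> s y \<tau>" "ball (\<Phi> s x \<tau>) \<delta>0"
                "G \<tau>" "\<lambda>q. blinfun_apply (DG \<tau> q)" "\<Phi> s x \<tau>" \<eta>])
            fix z assume z: "z \<in> ball (\<Phi> s x \<tau>) \<delta>0"
            show "(G \<tau> has_derivative blinfun_apply (DG \<tau> z)) (at z within ball (\<Phi> s x \<tau>) \<delta>0)"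
              using der T(1)[OF \<tau>] has_derivative_at_withinI by blast
            have "z - \<Phi> s x \<tau> \<in> X0" using z \<delta>0(2) by (auto simp: dist_norm norm_minus_commute)
            then have "dist (D (z - \<Phi> s x \<tau>, \<tau>)) (D (0, \<tau>)) \<le> \<eta>" using X0(3) \<tau> by blast
            then show "onorm (blinfun_apply (DG \<tau> z) - blinfun_apply (DG \<tau> (\<Phi> s x \<tau>))) \<le> \<eta>"
              by (simp add: D_def dist_norm norm_blinfun.rep_eq blinfun.diff_left[abs_def] fun_diff_def)
          qed (use seg \<delta>0 in auto)
          also have "\<dots> \<le> \<eta> * (2 * norm (y - x))"
            using mult_right_mono[OF dy[OF \<tau>], of \<eta>] \<open>0 < \<eta>\<close> by (simp add: mult.commute)
          finally have e: "norm ?e \<le> \<eta> * (2 * norm (y - x))" .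
          have r: "norm (A \<tau> (?r \<tau>)) \<le> L * norm (?r \<tau>)"
            using norm_blinfun[of "A \<tau>" "?r \<tau>"] mult_right_mono[OF AL[OF \<tau>] norm_ge_zero[of "?r \<tau>"]] by linarith
          have "G \<tau> (\<Phi> s y \<tau>) - G \<tau> (\<Phi> s x \<tau>) - A \<tau> (W \<tau> (y - x)) = ?e + A \<tau> (?r \<tau>)"
            by (simp add: blinfun.diff_right)
          then show "norm (G \<tau> (\<Phi> s y \<tau>) - G \<tau> (\<Phi> s x \<tau>) - A \<tau> (W \<tau> (y - x)))
              \<le> L * norm (?r \<tau>) + \<eta> * (2 * norm (y - x))"
            using order_trans[OF norm_triangle_ineq add_mono[OF e r]] by (simp only: add.commute)
        qed (use pos short s t \<open>0 < \<eta>\<close> in auto)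
        also have "\<dots> = 4 * ((\<beta> - \<alpha>) * \<eta>) * norm (y - x)"
          using \<Phi>(1) s x y by (simp add: W(1))
        also have "\<dots> \<le> e * norm (y - x)" by (intro mult_right_mono \<eta>) simp
        finally show ?thesis .
      qed
      ultimately show "\<exists>d>0. \<forall>y. norm (y - x) < d \<longrightarrow>
          norm (\<Phi> s y t - \<Phi> s x t - blinfun_apply (W t) (y - x)) \<le> e * norm (y - x)" by blast
    qed
    then show ?thesis by (auto simp: differentiable_def)
  qed
  show ?thesis
    by (rule that[of \<alpha> \<beta> \<epsilon> R \<Phi>]) (use ab \<open>0 < R\<close> \<Phi> diff in auto)
qed

text \<open>For a short time both solutions stay in the ball where \<open>G\<close> is Lipschitz, by
  continuity. The short estimate with initial distance 0 then makes them agree. The interval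
  \<open>J\<close> may have \<open>ts\<close> as an end point.\<close>

theorem ode_local_unique:
  fixes G :: "real \<Rightarrow> 'f::banach \<Rightarrow> 'f"
  assumes ts: "ts \<in> J" and J: "is_interval J" "J \<subseteq> N"
    and contG: "continuous_on (N \<times> UNIV) (\<lambda>(t, q). G t q)"
    and contD: "continuous_on (N \<times> UNIV) (\<lambda>(t, q). DG t q :: 'f \<Rightarrow>\<^sub>L 'f)"
    and der: "\<forall>t\<in>N. \<forall>q. (G t has_derivative blinfun_apply (DG t q)) (at q)"
    and p: "\<And>t. t \<in> J \<Longrightarrow> (p has_vector_derivative G t (p t)) (at t within J)"
    and q: "\<And>t. t \<in> J \<Longrightarrow> (q has_vector_derivative G t (q t)) (at t within J)"
    and eq: "p ts = q ts"
  obtains \<epsilon> where "0 < \<epsilon>" "\<And>t. t \<in> J \<Longrightarrow> \<bar>t - ts\<bar> < \<epsilon> \<Longrightarrow> p t = q t"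
proof -
  have "ts \<in> N" using ts J by blast
  obtain d R0 M L where pos: "0 < d" "0 < R0" "0 < M" "0 < L"
    and bounds: "\<forall>t\<in>N. \<bar>t - ts\<bar> \<le> d \<longrightarrow> (\<forall>q\<in>cball (p ts) R0. norm (G t q) \<le> M \<and> norm (DG t q) \<le> L \<and>
      (\<forall>u\<in>cball (p ts) R0. norm (G t u - G t q) \<le> L * norm (u - q)))"
    using C1_local_bounds[OF \<open>ts \<in> N\<close> contG contD der, of "p ts"] by (elim exE conjE) (rule that)
  note lip = bounds[rule_format, THEN conjunct2, THEN conjunct2, rule_format]
  have near: "\<exists>e>0. \<forall>t\<in>J. dist t ts < e \<longrightarrow> dist (r t) (r ts) < R0"
    if "\<And>t. t \<in> J \<Longrightarrow> (r has_vector_derivative G t (r t)) (at t within J)" for r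
    using has_vector_derivative_continuous[OF that[OF ts]] ts pos(2)
    unfolding continuous_within_eps_delta by blast
  obtain e1 where e1: "0 < e1" "\<forall>t\<in>J. dist t ts < e1 \<longrightarrow> dist (p t) (p ts) < R0" using near[OF p] by blast
  obtain e2 where e2: "0 < e2" "\<forall>t\<in>J. dist t ts < e2 \<longrightarrow> dist (q t) (q ts) < R0" using near[OF q] by blast
  define \<epsilon> where "\<epsilon> = min (min d (1 / (2 * L))) (min e1 e2)"
  have \<epsilon>: "0 < \<epsilon>" "\<epsilon> \<le> d" "\<epsilon> \<le> 1 / (2 * L)" "\<epsilon> \<le> e1" "\<epsilon> \<le> e2" using pos e1(1) e2(1) by (simp_all add: \<epsilon>_def)
  have "p t = q t" if t: "t \<in> J" "\<bar>t - ts\<bar> < \<epsilon>" for t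
  proof -
    \<comment> \<open>The interval between \<open>t\<close> and \<open>ts\<close>, in whichever
      order, treats both directions of time at once.\<close>
    define \<alpha> \<beta> where "\<alpha> = min t ts" and "\<beta> = max t ts"
    have sub: "{\<alpha>..\<beta>} \<subseteq> J"
    proof -
      have "closed_segment t ts \<subseteq> J"
        using J(1) t(1) ts by (simp add: is_interval_convex_1 closed_segment_subset)
      then show ?thesis by (simp add: closed_segment_eq_real_ivl \<alpha>_def \<beta>_def min_def max_def split: if_splits)
    qed
    have len: "\<beta> - \<alpha> = \<bar>t - ts\<bar>" by (simp add: \<alpha>_def \<beta>_def)
    have "norm (p t - q t) \<le> 2 * (norm (p ts - q ts) + (\<beta> - \<alpha>) * 0)"
    proof (rule short_gronwall[where r = "\<lambda>t. p t - q t" and L = L])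
      fix \<tau> assume \<tau>: "\<tau> \<in> {\<alpha>..\<beta>}"
      then have "\<tau> \<in> J" and near': "\<bar>\<tau> - ts\<bar> < \<epsilon>" using sub t(2) by (auto simp: \<alpha>_def \<beta>_def)
      then show "((\<lambda>t. p t - q t) has_vector_derivative G \<tau> (p \<tau>) - G \<tau> (q \<tau>)) (at \<tau> within {\<alpha>..\<beta>})"
        using p q has_vector_derivative_within_subset[OF _ sub] by (intro derivative_intros) blast+
      have "p \<tau> \<in> cball (p ts) R0" "q \<tau> \<in> cball (p ts) R0"
        using e1(2)[rule_format, OF \<open>\<tau> \<in> J\<close>] e2(2)[rule_format, OF \<open>\<tau> \<in> J\<close>] near' \<epsilon> eq
        by (auto simp: dist_real_def dist_commute[of "p ts"] dist_commute[of "q ts"])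
      then show "norm (G \<tau> (p \<tau>) - G \<tau> (q \<tau>)) \<le> L * norm (p \<tau> - q \<tau>) + 0"
        using lip[of \<tau>] \<open>\<tau> \<in> J\<close> J(2) near' \<epsilon>(2) by auto
    next
      have "(\<beta> - \<alpha>) * L \<le> 1 / (2 * L) * L" using len t(2) \<epsilon>(3) pos(4) by (intro mult_right_mono) auto
      then show "(\<beta> - \<alpha>) * L \<le> 1/2" using pos(4) by simp
    qed (use pos in \<open>auto simp: \<alpha>_def \<beta>_def\<close>)
    then show ?thesis using eq by simp
  qed
  then show ?thesis by (rule that[OF \<epsilon>(1)])
qed

text \<open>On a side of \<open>t\<close> that contains points of \<open>I\<close>, one of them
  serves as bound for a compact interval. On a side without such points \<open>t\<close> is itself
  the end point of \<open>I\<close>, and nothing has to be reached there.\<close>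

lemma interval_neighbourhood:
  fixes t :: real
  assumes "is_interval I" "t \<in> I" "open U" "t \<in> U"
  obtains \<alpha> \<beta> \<epsilon> where "t \<in> {\<alpha>..\<beta>}" "{\<alpha>..\<beta>} \<subseteq> I \<inter> U" "0 < \<epsilon>" "\<And>s. s \<in> I \<Longrightarrow> \<bar>s - t\<bar> < \<epsilon> \<Longrightarrow> s \<in> {\<alpha>..\<beta>}"
proof -
  obtain d where d: "0 < d" "ball t d \<subseteq> U" using assms(3,4) open_contains_ball by blast
  obtain \<alpha>' where a: "\<alpha>' \<in> I" "\<alpha>' \<le> t" "(\<forall>s\<in>I. t \<le> s) \<or> \<alpha>' < t"
    using assms(2) by (cases "\<exists>s\<in>I. s < t") (force simp: not_less)+
  obtain \<beta>' where b: "\<beta>' \<in> I" "t \<le> \<beta>'" "(\<forall>s\<in>I. s \<le> t) \<or> t < \<beta>'"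
    using assms(2) by (cases "\<exists>s\<in>I. t < s") (force simp: not_less)+
  \<comment> \<open>The value 1 is an arbitrary default for a side on which \<open>t\<close> is the
    end point of \<open>I\<close>.\<close>
  define \<epsilon> where "\<epsilon> = min (d/2) (min (if \<alpha>' < t then t - \<alpha>' else 1) (if t < \<beta>' then \<beta>' - t else 1))"
  define \<alpha> \<beta> where "\<alpha> = max \<alpha>' (t - d/2)" and "\<beta> = min \<beta>' (t + d/2)"
  have "closed_segment \<alpha>' \<beta>' \<subseteq> I"
    using assms(1) a b by (simp add: is_interval_convex_1 closed_segment_subset)
  then have sub: "{\<alpha>'..\<beta>'} \<subseteq> I" using a b by (simp add: closed_segment_eq_real_ivl)
  show ?thesis
  proof (rule that[of \<alpha> \<beta> \<epsilon>])
    show "t \<in> {\<alpha>..\<beta>}" using a b d(1) by (simp add: \<alpha>_def \<beta>_def)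
    show "0 < \<epsilon>" using d(1) by (simp add: \<epsilon>_def)
    show "{\<alpha>..\<beta>} \<subseteq> I \<inter> U"
    proof
      fix s assume "s \<in> {\<alpha>..\<beta>}"
      then have "s \<in> {\<alpha>'..\<beta>'}" "s \<in> ball t d" using d(1) by (auto simp: \<alpha>_def \<beta>_def dist_real_def abs_if)
      then show "s \<in> I \<inter> U" using sub d(2) by blast
    qed
    fix s assume s: "s \<in> I" "\<bar>s - t\<bar> < \<epsilon>"
    have "\<alpha>' \<le> s"
    proof (cases "\<alpha>' < t")
      case True
      then have "\<epsilon> \<le> t - \<alpha>'" by (simp add: \<epsilon>_def)
      then show ?thesis using s(2) by linarith
    qed (use a s(1) in force)
    moreover have "s \<le> \<beta>'"
    proof (cases "t < \<beta>'")
      case True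
      then have "\<epsilon> \<le> \<beta>' - t" by (simp add: \<epsilon>_def)
      then show ?thesis using s(2) by linarith
    qed (use b s(1) in force)
    moreover have "\<epsilon> \<le> d / 2" by (simp add: \<epsilon>_def)
    ultimately show "s \<in> {\<alpha>..\<beta>}" using s(2) unfolding \<alpha>_def \<beta>_def by auto
  qed
qed


section \<open>Finite-dimensional spaces and smooth functions\<close>

text \<open>The bound makes the coefficients of a convergent sequence Cauchy, and their limits are
  coefficients of its limit.\<close>

lemma closed_span_of_coefficient_bound:
  fixes B :: "'b::real_normed_vector set"
  assumes "finite B" and C: "\<And>c b. b \<in> B \<Longrightarrow> \<bar>c b\<bar> \<le> C * norm (\<Sum>b\<in>B. c b *\<^sub>R b)"
  shows "closed (span B)"
  unfolding closed_sequential_limits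
proof safe
  fix x l assume x: "\<forall>n. x n \<in> span B" "x \<longlonglongrightarrow> l"
  have "\<exists>c. x n = (\<Sum>b\<in>B. c b *\<^sub>R b)" for n
    using x(1) span_finite[OF assms(1)] by blast
  then obtain c where c: "\<And>n. x n = (\<Sum>b\<in>B. c n b *\<^sub>R b)" by metis
  have "Cauchy x" using x(2) by (rule LIMSEQ_imp_Cauchy)
  have "convergent (\<lambda>n. c n b)" if b: "b \<in> B" for b
  proof (intro Cauchy_convergent CauchyI)
    fix e :: real assume "0 < e"
    \<comment> \<open>Nothing is assumed about the sign of \<open>C\<close>; the replacement is
      positive and can be divided by.\<close>
    define C' where "C' = \<bar>C\<bar> + 1"
    have "0 < C'" "C \<le> C'" by (auto simp: C'_def)
    then obtain M where M: "\<And>m n. m \<ge> M \<Longrightarrow> n \<ge> M \<Longrightarrow> norm (x m - x n) < e / C'"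
      using CauchyD[OF \<open>Cauchy x\<close>, of "e / C'"] \<open>0 < e\<close> by (auto)
    have "norm (c m b - c n b) < e" if "m \<ge> M" "n \<ge> M" for m n
    proof -
      have "\<bar>c m b - c n b\<bar> \<le> C * norm (x m - x n)"
        using C[OF b, of "\<lambda>b. c m b - c n b"] by (simp add: c scaleR_diff_left sum_subtractf)
      also have "\<dots> \<le> C' * norm (x m - x n)" using \<open>C \<le> C'\<close> by (intro mult_right_mono) auto
      also have "\<dots> < e" using M[OF that] \<open>0 < C'\<close> by (simp add: field_simps)
      finally show ?thesis by simp
    qed
    then show "\<exists>M. \<forall>m\<ge>M. \<forall>n\<ge>M. norm (c m b - c n b) < e" by blast
  qed
  then obtain c' where "\<And>b. b \<in> B \<Longrightarrow> (\<lambda>n. c n b) \<longlonglongrightarrow> c' b" unfolding convergent_def by metis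
  then have "x \<longlonglongrightarrow> (\<Sum>b\<in>B. c' b *\<^sub>R b)" unfolding c by (intro tendsto_intros)
  then have "l = (\<Sum>b\<in>B. c' b *\<^sub>R b)" using x(2) LIMSEQ_unique by blast
  then show "l \<in> span B" by (auto intro: span_sum span_scale span_base)
qed

text \<open>Induction on the basis. The span of the old vectors is closed by the previous lemma, so
  the new vector has positive distance \<open>d\<close> from it. This distance bounds the new
  coefficient, and subtracting its contribution leaves a vector to which the induction hypothesis
  applies.\<close>

lemma independent_coefficient_bound:
  fixes B :: "'b::real_normed_vector set"
  assumes "finite B" "independent B"
  shows "\<exists>C. \<forall>c. \<forall>b\<in>B. \<bar>c b\<bar> \<le> C * norm (\<Sum>b\<in>B. c b *\<^sub>R b)"
  using assms
proof (induction B rule: finite_induct)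
  case (insert a B)
  then have a: "a \<notin> span B" and "independent B" by (auto simp: independent_insert)
  then obtain C where C: "\<And>c b. b \<in> B \<Longrightarrow> \<bar>c b\<bar> \<le> C * norm (\<Sum>b\<in>B. c b *\<^sub>R b)"
    using insert.IH by blast
  have cl: "closed (span B)" by (rule closed_span_of_coefficient_bound[OF insert.hyps(1) C])
  define d where "d = infdist a (span B)"
  have d: "0 < d" unfolding d_def
    using a cl in_closed_iff_infdist_zero[of "span B" a] infdist_nonneg[of a "span B"] span_zero[of B] by force
  \<comment> \<open>The first summand serves the old coefficients, through
    \<open>norm s \<le> (1 + norm a / d) * norm x\<close>; the second serves the new one.\<close>
  define C1 where "C1 = \<bar>C\<bar> * (1 + norm a / d) + 1 / d"
  have "\<bar>c b\<bar> \<le> C1 * norm (\<Sum>b\<in>insert a B. c b *\<^sub>R b)" if b: "b \<in> insert a B" for c b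
  proof -
    define s x where "s = (\<Sum>b\<in>B. c b *\<^sub>R b)" and "x = (\<Sum>b\<in>insert a B. c b *\<^sub>R b)"
    have x: "x = c a *\<^sub>R a + s" using insert.hyps by (simp add: x_def s_def)
    have s: "s \<in> span B" unfolding s_def by (intro span_sum span_scale span_base)
    have ca: "\<bar>c a\<bar> * d \<le> norm x"
    proof (cases "c a = 0")
      case False
      have "d \<le> dist a (- (1 / c a) *\<^sub>R s)"
        unfolding d_def using s by (intro infdist_le span_scale)
      also have "\<dots> = norm ((1 / c a) *\<^sub>R x)" using False by (simp add: dist_norm x scaleR_add_right)
      also have "\<dots> = norm x / \<bar>c a\<bar>" by simp
      finally show ?thesis using False by (simp add: field_simps)
    qed simp
    then have ca': "\<bar>c a\<bar> \<le> norm x / d" using d by (simp add: field_simps)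
    have "norm s \<le> norm x + \<bar>c a\<bar> * norm a" using norm_triangle_ineq4[of x "c a *\<^sub>R a"] by (simp add: x)
    also have "\<dots> \<le> norm x + norm x / d * norm a" using ca' by (intro add_left_mono mult_right_mono) auto
    also have "\<dots> = (1 + norm a / d) * norm x" by (simp add: field_simps)
    finally have ns: "norm s \<le> (1 + norm a / d) * norm x" .
    have nn: "0 \<le> \<bar>C\<bar> * (1 + norm a / d)" "0 \<le> 1 / d" using d by auto
    show ?thesis
    proof (cases "b = a")
      case True
      have "norm x / d \<le> C1 * norm x" using mult_right_mono[OF nn(1), of "norm x"]
        by (simp add: C1_def algebra_simps)
      then show ?thesis using True ca' unfolding x_def by simp
    next
      case False
      then have "\<bar>c b\<bar> \<le> C * norm s" using b C unfolding s_def by blast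
      also have "\<dots> \<le> \<bar>C\<bar> * norm s" by (intro mult_right_mono) auto
      also have "\<dots> \<le> \<bar>C\<bar> * ((1 + norm a / d) * norm x)" by (intro mult_left_mono ns) simp
      also have "\<dots> \<le> C1 * norm x" using mult_right_mono[OF nn(2), of "norm x"]
        by (simp add: C1_def algebra_simps)
      finally show ?thesis unfolding x_def .
    qed
  qed
  then show ?case by blast
qed simp

text \<open>\<open>finite_dim\<close> only provides a finite spanning set. After passing to a basis,
  the coefficient bound says that the coordinate functionals are bounded.\<close>

lemma finite_dim_coordinates:
  assumes "finite_dim TYPE('b::real_normed_vector)"
  obtains B :: "'b::real_normed_vector set" and \<phi> :: "'b \<Rightarrow> 'b \<Rightarrow>\<^sub>L real" where "finite B" "\<And>v. v = (\<Sum>b\<in>B. blinfun_apply (\<phi> b) v *\<^sub>R b)"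
proof -
  obtain B0 :: "'b set" where B0: "finite B0" "span B0 = UNIV" using assms by (auto simp: finite_dim_def)
  obtain B where B: "B \<subseteq> B0" "independent B" "B0 \<subseteq> span B" using maximal_independent_subset[of B0] by blast
  have "finite B" using B(1) B0(1) finite_subset by blast
  have sp: "span B = UNIV" using B(3) B0(2) by (metis span_mono span_span top.extremum_uniqueI)
  obtain C where C: "\<And>c b. b \<in> B \<Longrightarrow> \<bar>c b\<bar> \<le> C * norm (\<Sum>b\<in>B. c b *\<^sub>R b)"
    using independent_coefficient_bound[OF \<open>finite B\<close> B(2)] by blast
  have rep: "(\<Sum>b\<in>B. representation B v b *\<^sub>R b) = v" for v
    using sum_representation_eq[OF B(2) _ \<open>finite B\<close> subset_refl] sp by simp
  have "bounded_linear (\<lambda>v. representation B v b)" if "b \<in> B" for b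
  proof (rule bounded_linear_intro[where K = C])
    fix v show "norm (representation B v b) \<le> norm v * C"
      using C[OF that, of "representation B v"] by (simp add: rep mult.commute)
  qed (use sp B(2) in \<open>simp_all add: representation_add representation_scale\<close>)
  then show ?thesis
    using that[OF \<open>finite B\<close>, of "\<lambda>b. Blinfun (\<lambda>v. representation B v b)"] rep
    by (simp add: bounded_linear_Blinfun_apply)
qed

text \<open>An operator on a finite-dimensional space is the sum of its values on a basis times the
  coordinate functionals. \<open>Ck_on\<close> controls the derivative one direction at a time,
  whereas the theorems on differential equations ask for continuity in the operator norm.\<close>

lemma continuous_on_blinfun_of_pointwise:
  fixes D :: "'x::topological_space \<Rightarrow> 'b::real_normed_vector \<Rightarrow>\<^sub>L 'c::real_normed_vector"
  assumes "finite_dim TYPE('b)" and D: "\<And>v. continuous_on X (\<lambda>x. blinfun_apply (D x) v)"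
  shows "continuous_on X D"
proof -
  obtain B and \<phi> :: "'b \<Rightarrow> 'b \<Rightarrow>\<^sub>L real" where B: "finite B" "\<And>v. v = (\<Sum>b\<in>B. blinfun_apply (\<phi> b) v *\<^sub>R b)"
    using finite_dim_coordinates[OF assms(1)] by blast
  have "D x = (\<Sum>b\<in>B. blinfun_scaleR_left (blinfun_apply (D x) b) o\<^sub>L \<phi> b)" for x
  proof (rule blinfun_eqI)
    fix v
    show "blinfun_apply (D x) v = blinfun_apply (\<Sum>b\<in>B. blinfun_scaleR_left (blinfun_apply (D x) b) o\<^sub>L \<phi> b) v"
      by (subst B(2)[of v]) (simp add: blinfun.sum_right blinfun.sum_left blinfun.scaleR_right)
  qed
  moreover have "continuous_on X (\<lambda>x. \<Sum>b\<in>B. blinfun_scaleR_left (blinfun_apply (D x) b) o\<^sub>L \<phi> b)"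
    by (intro continuous_intros bounded_bilinear.continuous_on[OF bounded_bilinear_blinfun_compose]
        bounded_linear.continuous_on[OF bounded_linear_blinfun_scaleR_left] D)
  ultimately show ?thesis by simp
qed

text \<open>\<open>manifold\<close> asserts finite dimension for the model space of the total space;
  this extracts it for the model fibre.\<close>

lemma finite_dim_snd:
  assumes "finite_dim TYPE('a::real_normed_vector \<times> 'b::real_normed_vector)"
  shows "finite_dim TYPE('b)"
proof -
  obtain B :: "('a \<times> 'b) set" where "finite B" "span B = UNIV" using assms by (auto simp: finite_dim_def)
  then have "finite (snd ` B)" "span (snd ` B) = UNIV"
    using linear_span_image[OF linear_snd, of B] by auto
  then show ?thesis by (auto simp: finite_dim_def)
qed

lemma smooth_on_continuous_on:
  assumes "smooth_on f X"
  shows "continuous_on X f"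
  unfolding continuous_on_def
proof
  fix x assume "x \<in> X"
  then obtain W g where W: "open W" "x \<in> W" "\<forall>n. Ck_on n g W" "\<forall>y\<in>W \<inter> X. g y = f y"
    using assms unfolding smooth_on_def by blast
  have "continuous_on W g" using W(3) Ck_on.simps(1) by blast
  then have "(g \<longlongrightarrow> g x) (at x)" using continuous_on_eq_continuous_at[OF W(1)] W(2) isContD by blast
  then have "(g \<longlongrightarrow> f x) (at x within X)" using W(2,4) \<open>x \<in> X\<close> tendsto_within_subset[OF _ subset_UNIV] by fastforce
  moreover have "eventually (\<lambda>y. g y = f y) (at x within X)"
    unfolding eventually_at_topological using W(1,2,4) by (intro exI[of _ W]) auto
  ultimately show "(f \<longlongrightarrow> f x) (at x within X)" by (rule Lim_transform_eventually)
qed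

text \<open>On an open set a local extension coincides with \<open>f\<close> near the point, so the
  two have the same derivatives there.\<close>

lemma smooth_on_open_C1:
  assumes "smooth_on f X" "open X"
  shows "x \<in> X \<Longrightarrow> f differentiable (at x)"
    and "continuous_on X (\<lambda>x. frechet_derivative f (at x) v)"
proof -
  have *: "f differentiable (at x) \<and> isCont (\<lambda>x. frechet_derivative f (at x) v) x" if xX: "x \<in> X" for x
  proof -
    obtain W g where W: "open W" "x \<in> W" "\<forall>n. Ck_on n g W" "\<forall>y\<in>W \<inter> X. g y = f y"
      using assms(1)[unfolded smooth_on_def, rule_format, OF xX] by (elim exE conjE)
    have g: "\<And>y. y \<in> W \<Longrightarrow> g differentiable (at y)" "continuous_on W (\<lambda>x. frechet_derivative g (at x) v)"
      using W(3)[rule_format, of "Suc 0"] unfolding Ck_on.simps by blast+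
    have o: "open (W \<inter> X)" "x \<in> W \<inter> X" using W(1,2) assms(2) xX by auto
    have eq: "frechet_derivative g (at y) = frechet_derivative f (at y)" if "y \<in> W \<inter> X" for y
      by (rule frechet_derivative_transform_within_open[OF g(1) o(1) that]) (use that W(4) in auto)
    have "continuous_on (W \<inter> X) (\<lambda>x. frechet_derivative g (at x) v)"
      using g(2) continuous_on_subset by blast
    then have "continuous_on (W \<inter> X) (\<lambda>x. frechet_derivative f (at x) v)"
      by (rule continuous_on_cong[THEN iffD1, OF refl, rotated]) (simp add: eq)
    then have "isCont (\<lambda>x. frechet_derivative f (at x) v) x"
      using o continuous_on_eq_continuous_at by blast
    moreover have "f differentiable (at x)"
    proof -
      obtain D where "(g has_derivative D) (at x)" using g(1) W(2) by (auto simp: differentiable_def)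
      then have "(f has_derivative D) (at x)"
        by (rule has_derivative_transform_within_open[OF _ o]) (use W(4) in auto)
      then show ?thesis by (auto simp: differentiable_def)
    qed
    ultimately show ?thesis by blast
  qed
  show "x \<in> X \<Longrightarrow> f differentiable (at x)" using * by blast
  show "continuous_on X (\<lambda>x. frechet_derivative f (at x) v)"
    using * continuous_on_eq_continuous_at[OF assms(2)] by blast
qed

section \<open>Atlases and tangent maps\<close>

lemma openin_atlas_top:
  "openin (atlas_top A) W \<longleftrightarrow>
     W \<subseteq> pts A \<and> (\<forall>c\<in>A. \<exists>G. open G \<and> fst c \<inter> W = {p \<in> fst c. snd c p \<in> G})"
  by (simp add: atlas_top_def topology_inverse'[OF istopology_atlas_top])

lemma chart_subset_pts: "c \<in> A \<Longrightarrow> fst c \<subseteq> pts A"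
  by (auto simp: pts_def)

lemma topspace_atlas_top [simp]: "topspace (atlas_top A) = pts A"
proof (rule antisym)
  have "openin (atlas_top A) (pts A)"
    unfolding openin_atlas_top using chart_subset_pts by (auto intro!: exI[of _ UNIV])
  then show "pts A \<subseteq> topspace (atlas_top A)" by (rule openin_subset)
  show "topspace (atlas_top A) \<subseteq> pts A"
    using openin_topspace[of "atlas_top A"] by (rule openin_atlas_top[THEN iffD1, THEN conjunct1])
qed

lemma transition_apply:
  assumes "inj_on (snd c) (fst c)" "p \<in> fst c"
  shows "transition c d f (snd c p) = snd d (f p)"
  using assms by (simp add: transition_def inv_into_f_f)

text \<open>Sets that admit enough directions at \<open>x\<close> for derivatives within them to be unique.\<close>

definition thick :: "'a::real_normed_vector \<Rightarrow> 'a set \<Rightarrow> bool" where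
  "thick x S \<longleftrightarrow> span {v. 0 islimpt {t::real. x + t *\<^sub>R v \<in> S}} = UNIV"

text \<open>Along a direction whose admissible parameters accumulate at 0, the derivative is that of
  a function of one real variable, hence unique. Linearity extends the agreement to the span of
  these directions.\<close>

lemma has_derivative_thick_unique:
  assumes D: "(f has_derivative D) (at x within S)" "(f has_derivative D') (at x within S)" and "thick x S"
  shows "D = D'"
proof
  fix v
  have eq: "D v = D' v" if v: "0 islimpt {t::real. x + t *\<^sub>R v \<in> S}" for v
  proof -
    let ?T = "{t::real. x + t *\<^sub>R v \<in> S}"
    have "((\<lambda>t. f (x + t *\<^sub>R v)) has_vector_derivative E v) (at 0 within ?T)"
      if E: "(f has_derivative E) (at x within S)" for E
    proof -
      have "((\<lambda>t. x + t *\<^sub>R v) has_derivative (\<lambda>t. t *\<^sub>R v)) (at 0 within ?T)"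
        by (auto intro!: derivative_eq_intros)
      moreover have "(f has_derivative E) (at (x + 0 *\<^sub>R v) within (\<lambda>t. x + t *\<^sub>R v) ` ?T)"
        using E by (auto intro: has_derivative_subset)
      ultimately have "((\<lambda>t. f (x + t *\<^sub>R v)) has_derivative (\<lambda>t. E (t *\<^sub>R v))) (at 0 within ?T)"
        by (rule has_derivative_in_compose)
      moreover have "(\<lambda>t. E (t *\<^sub>R v)) = (\<lambda>t. t *\<^sub>R E v)"
        using has_derivative_linear[OF E] by (simp add: linear_cmul)
      ultimately show ?thesis by (simp add: has_vector_derivative_def)
    qed
    from this[OF D(1)] this[OF D(2)] show ?thesis
      using v by (intro vector_derivative_unique_within[of 0 ?T]) (auto simp: trivial_limit_within)
  qed
  show "D v = D' v"
  proof (rule linear_eq_on_span[of D D' "{v. 0 islimpt {t::real. x + t *\<^sub>R v \<in> S}}"])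
    show "v \<in> span {v. 0 islimpt {t::real. x + t *\<^sub>R v \<in> S}}" using \<open>thick x S\<close> by (simp add: thick_def)
  qed (use D[THEN has_derivative_linear] eq in auto)
qed

lemma frechet_derivative_within_eq:
  assumes "(f has_derivative D) (at x within S)" "thick x S"
  shows "frechet_derivative f (at x within S) = D"
proof -
  have "(f has_derivative frechet_derivative f (at x within S)) (at x within S)"
    using assms(1) by (meson differentiableI frechet_derivative_works)
  then show ?thesis using has_derivative_thick_unique assms by blast
qed

lemma thick_open:
  assumes "open S" "x \<in> S"
  shows "thick x S"
proof -
  have "0 islimpt {t::real. x + t *\<^sub>R v \<in> S}" for v
  proof (rule interior_limit_point)
    have "open ((\<lambda>t::real. x + t *\<^sub>R v) -` S)"
      by (intro open_vimage assms continuous_intros)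
    then show "0 \<in> interior {t::real. x + t *\<^sub>R v \<in> S}"
      using assms(2) by (simp add: vimage_def interior_open)
  qed
  then have "{v. 0 islimpt {t::real. x + t *\<^sub>R v \<in> S}} = UNIV" by blast
  then show ?thesis by (simp add: thick_def)
qed

lemma islimpt_interval:
  fixes I :: "real set"
  assumes "is_interval I" "interior I \<noteq> {}" "u \<in> I"
  shows "u islimpt I"
proof (rule connected_imp_perfect)
  show "connected I" using assms(1) by (simp add: is_interval_connected)
  show "I \<noteq> {a}" for a using assms(2) by auto
qed (rule assms(3))

text \<open>The directions \<open>(1, w)\<close> are admissible also at an end point of
  \<open>I\<close>, where the parameter can have only one sign. Their differences are the vertical
  directions, so they span everything.\<close>

lemma thick_strip:
  fixes I :: "real set"
  assumes "u islimpt I" "open U" "u \<in> U"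
  shows "thick (u, q) ((I \<inter> U) \<times> UNIV)"
proof -
  let ?S = "(I \<inter> U) \<times> UNIV" and ?V = "{v. 0 islimpt {t::real. (u, q) + t *\<^sub>R v \<in> (I \<inter> U) \<times> UNIV}}"
  have lim: "0 islimpt {t::real. (u, q) + t *\<^sub>R (1, w) \<in> ?S}" for w
  proof (rule islimptI)
    fix T :: "real set" assume T: "0 \<in> T" "open T"
    have "open (((\<lambda>s. s - u) -` T) \<inter> U)"
      by (intro open_Int open_vimage assms T continuous_intros)
    then obtain s where "s \<in> I" "s \<in> ((\<lambda>s. s - u) -` T) \<inter> U" "s \<noteq> u"
      using islimptE[OF assms(1), of "((\<lambda>s. s - u) -` T) \<inter> U"] T(1) assms(3) by auto
    then show "\<exists>y\<in>{t::real. (u, q) + t *\<^sub>R (1, w) \<in> ?S}. y \<in> T \<and> y \<noteq> 0"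
      by (intro bexI[of _ "s - u"]) auto
  qed
  have "(a, w) \<in> span ?V" for a w
  proof -
    have "(1, w') \<in> span ?V" for w' by (rule span_base) (use lim in simp)
    then have "a *\<^sub>R (1, 0) + ((1, w) - (1, 0)) \<in> span ?V" by (intro span_add span_scale span_diff)
    then show ?thesis by simp
  qed
  then show ?thesis unfolding thick_def by auto
qed

text \<open>The properties that tangent maps rely on, shared by the atlases of manifolds and by the
  atlas of a bundle over an interval with end points, which need not satisfy \<open>manifold\<close>
  as its chart images need not be open.\<close>

definition regular_atlas :: "('x, 'a::real_normed_vector) atlas \<Rightarrow> bool" where
  "regular_atlas A \<longleftrightarrow> (\<forall>c\<in>A. inj_on (snd c) (fst c) \<and> openin (atlas_top A) (fst c)) \<and>
     (\<forall>c\<in>A. \<forall>d\<in>A. \<forall>p\<in>fst c \<inter> fst d.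
        transition c d id differentiable (at (snd c p) within snd c ` (fst c \<inter> fst d)) \<and>
        thick (snd c p) (snd c ` (fst c \<inter> fst d)))"

lemma regular_atlasD:
  assumes "regular_atlas A" "c \<in> A"
  shows "inj_on (snd c) (fst c)" "openin (atlas_top A) (fst c)"
    "p \<in> fst c \<Longrightarrow> thick (snd c p) (snd c ` fst c)"
    "d \<in> A \<Longrightarrow> p \<in> fst c \<Longrightarrow> p \<in> fst d \<Longrightarrow>
      transition c d id differentiable (at (snd c p) within snd c ` (fst c \<inter> fst d))"
    "d \<in> A \<Longrightarrow> p \<in> fst c \<Longrightarrow> p \<in> fst d \<Longrightarrow> thick (snd c p) (snd c ` (fst c \<inter> fst d))"
  using assms unfolding regular_atlas_def by (blast, blast, metis Int_absorb IntI, blast, blast)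

lemma manifoldD:
  assumes "manifold A" "c \<in> A" "d \<in> A"
  shows "inj_on (snd c) (fst c)" "open (snd c ` (fst c \<inter> fst d))"
    "smooth_on (transition c d id) (snd c ` (fst c \<inter> fst d))" "open (snd c ` fst c)"
  using assms unfolding manifold_def by (blast, blast, blast, metis Int_absorb)

lemma manifold_openin_chart:
  assumes "manifold A" "c \<in> A"
  shows "openin (atlas_top A) (fst c)"
  unfolding openin_atlas_top
proof (intro conjI ballI chart_subset_pts assms)
  fix d assume d: "d \<in> A"
  have "fst d \<inter> fst c = {p \<in> fst d. snd d p \<in> snd d ` (fst d \<inter> fst c)}"
    using manifoldD(1)[OF assms(1) d d] by (auto simp: inj_on_def)
  then show "\<exists>G. open G \<and> fst d \<inter> fst c = {p \<in> fst d. snd d p \<in> G}"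
    using manifoldD(2)[OF assms(1) d assms(2)] by blast
qed

lemma manifold_open_image:
  assumes "manifold A" "c \<in> A" "openin (atlas_top A) W"
  shows "open (snd c ` (fst c \<inter> W))"
proof -
  obtain G where G: "open G" "fst c \<inter> W = {p \<in> fst c. snd c p \<in> G}"
    using assms by (auto simp: openin_atlas_top)
  then have "snd c ` (fst c \<inter> W) = snd c ` fst c \<inter> G" by auto
  then show ?thesis using G(1) manifoldD(4)[OF assms(1,2,2)] by auto
qed

lemma manifold_transition_differentiable:
  assumes "manifold A" "c \<in> A" "d \<in> A" "p \<in> fst c" "p \<in> fst d"
  shows "transition c d id differentiable (at (snd c p))"
  using smooth_on_open_C1(1)[OF manifoldD(3,2)[OF assms(1-3)]] assms(4,5) by blast

lemma manifold_imp_regular_atlas: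
  assumes "manifold A"
  shows "regular_atlas A"
  unfolding regular_atlas_def
proof (intro conjI ballI)
  fix c d p assume c: "c \<in> A" "d \<in> A" "p \<in> fst c \<inter> fst d"
  show "transition c d id differentiable (at (snd c p) within snd c ` (fst c \<inter> fst d))"
    using manifold_transition_differentiable[OF assms c(1,2)] c(3) by (blast intro: differentiable_at_withinI)
  show "thick (snd c p) (snd c ` (fst c \<inter> fst d))"
    using manifoldD(2)[OF assms c(1,2)] c(3) by (blast intro: thick_open)
qed (use manifoldD(1)[OF assms] manifold_openin_chart[OF assms] in blast)+

text \<open>Since an open set of the manifold is cut out in the chart by an open set of the model
  space, intersecting with it leaves the filter unchanged. Derivatives can thus be computed where
  further charts are defined.\<close>

lemma at_within_chart_openin:
  assumes "c \<in> A" "openin (atlas_top A) W" "p \<in> fst c" "p \<in> W"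
  shows "at (snd c p) within snd c ` (fst c \<inter> S) = at (snd c p) within snd c ` (fst c \<inter> S \<inter> W)"
proof -
  obtain G where G: "open G" "fst c \<inter> W = {p \<in> fst c. snd c p \<in> G}"
    using assms by (auto simp: openin_atlas_top)
  have p: "snd c p \<in> G" using G(2) assms by blast
  have "snd c ` (fst c \<inter> S) \<inter> G - {snd c p} = snd c ` (fst c \<inter> S \<inter> W) \<inter> G - {snd c p}"
    using G(2) by blast
  from at_within_nhd[OF p G(1) this] show ?thesis .
qed

lemma continuous_map_atlasI:
  fixes \<psi> :: "real \<Rightarrow> 'x"
  assumes "\<And>t. t \<in> J \<Longrightarrow> \<exists>c\<in>A. \<psi> t \<in> fst c \<and> eventually (\<lambda>s. \<psi> s \<in> fst c) (at t within J) \<and>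
    continuous (at t within J) (\<lambda>s. snd c (\<psi> s))"
  shows "continuous_map (top_of_set J) (atlas_top A) \<psi>"
  unfolding continuous_map
proof (intro conjI allI impI)
  show "\<psi> ` topspace (top_of_set J) \<subseteq> topspace (atlas_top A)"
    using assms chart_subset_pts by fastforce
  fix W assume W: "openin (atlas_top A) W"
  have "\<exists>e>0. \<forall>s\<in>J. dist s t < e \<longrightarrow> \<psi> s \<in> W" if t: "t \<in> J" "\<psi> t \<in> W" for t
  proof -
    obtain c where c: "c \<in> A" "\<psi> t \<in> fst c" "eventually (\<lambda>s. \<psi> s \<in> fst c) (at t within J)"
      "continuous (at t within J) (\<lambda>s. snd c (\<psi> s))" using assms[OF t(1)] by blast
    obtain G where G: "open G" "fst c \<inter> W = {p \<in> fst c. snd c p \<in> G}"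
      using W c(1) unfolding openin_atlas_top by blast
    have "snd c (\<psi> t) \<in> G" using G(2) c(2) t(2) by blast
    then have "eventually (\<lambda>s. snd c (\<psi> s) \<in> G) (at t within J)"
      using c(4) G(1) by (simp add: continuous_within topological_tendstoD)
    with c(3) have "eventually (\<lambda>s. \<psi> s \<in> W) (at t within J)"
      by eventually_elim (use G(2) in blast)
    then obtain e where "0 < e" "\<forall>s\<in>J. s \<noteq> t \<and> dist s t < e \<longrightarrow> \<psi> s \<in> W"
      unfolding eventually_at by blast
    then show ?thesis using t(2) by metis
  qed
  then show "openin (top_of_set J) {x \<in> topspace (top_of_set J). \<psi> x \<in> W}"
    unfolding openin_euclidean_subtopology_iff by auto
qed

section \<open>Tangent vectors and tangent maps in charts\<close>

lemma fst_tmap [simp]: "fst (tmap A B S f X) = f (fst X)"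
  by (simp add: tmap_def)

lemma tspaceD:
  assumes "X \<in> tspace A p"
  shows "fst X = p" "c \<notin> A \<or> p \<notin> fst c \<Longrightarrow> snd X c = 0"
    "c \<in> A \<Longrightarrow> d \<in> A \<Longrightarrow> p \<in> fst c \<Longrightarrow> p \<in> fst d \<Longrightarrow> snd X d =
       frechet_derivative (transition c d id) (at (snd c p) within snd c ` (fst c \<inter> fst d)) (snd X c)"
proof -
  obtain \<xi> where "X = (p, \<xi>)" "\<forall>c. c \<notin> A \<or> p \<notin> fst c \<longrightarrow> \<xi> c = 0"
    "\<forall>c\<in>A. \<forall>d\<in>A. p \<in> fst c \<inter> fst d \<longrightarrow>
        \<xi> d = frechet_derivative (transition c d id)
                (at (snd c p) within snd c ` (fst c \<inter> fst d)) (\<xi> c)"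
    using assms unfolding tspace_def by blast
  then show "fst X = p" "c \<notin> A \<or> p \<notin> fst c \<Longrightarrow> snd X c = 0"
    "c \<in> A \<Longrightarrow> d \<in> A \<Longrightarrow> p \<in> fst c \<Longrightarrow> p \<in> fst d \<Longrightarrow> snd X d =
       frechet_derivative (transition c d id) (at (snd c p) within snd c ` (fst c \<inter> fst d)) (snd X c)"
    unfolding fst_conv snd_conv by (metis fst_conv, metis snd_conv, metis IntI snd_conv)
qed

lemma tspace_eqI:
  assumes "X \<in> tspace A p" "Y \<in> tspace A p" "\<And>c. c \<in> A \<Longrightarrow> p \<in> fst c \<Longrightarrow> snd X c = snd Y c"
  shows "X = Y"
proof (rule prod_eqI)
  show "fst X = fst Y" using tspaceD(1)[OF assms(1)] tspaceD(1)[OF assms(2)] by simp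
  show "snd X = snd Y"
  proof
    fix c show "snd X c = snd Y c"
      using tspaceD(2)[OF assms(1), of c] tspaceD(2)[OF assms(2), of c] assms(3)[of c]
      by (cases "c \<in> A \<and> p \<in> fst c") auto
  qed
qed

lemma tspace_has_derivative:
  assumes "regular_atlas A" "X \<in> tspace A p" "c \<in> A" "d \<in> A" "p \<in> fst c" "p \<in> fst d"
    "(transition c d id has_derivative D) (at (snd c p) within snd c ` (fst c \<inter> fst d))"
  shows "snd X d = D (snd X c)"
  using tspaceD(3)[OF assms(2-6)] frechet_derivative_within_eq[OF assms(7) regular_atlasD(5)[OF assms(1,3,4,5,6)]]
  by simp

text \<open>\<open>tmap\<close> selects some chart of the domain by \<open>SOME\<close>. The chain
  rule through the coordinate change relates it to any other chart \<open>c\<close>, and thickness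
  of the overlap identifies the resulting derivative, so the component can be computed in
  \<open>c\<close>.\<close>

lemma tmap_component:
  assumes reg: "regular_atlas A" and X: "X \<in> tspace A p" and S: "pts A \<subseteq> S"
    and diff: "\<And>c. c \<in> A \<Longrightarrow> p \<in> fst c \<Longrightarrow> transition c d f differentiable (at (snd c p) within snd c ` fst c)"
    and d: "d \<in> B" "f p \<in> fst d" and c: "c \<in> A" "p \<in> fst c"
    and D: "(transition c d f has_derivative D) (at (snd c p) within snd c ` fst c)"
  shows "snd (tmap A B S f X) d = D (snd X c)"
proof -
  define c' where "c' = (SOME c. c \<in> A \<and> p \<in> fst c)"
  have "c' \<in> A \<and> p \<in> fst c'" unfolding c'_def by (rule someI[of _ c]) (use c in blast)
  then have c': "c' \<in> A" "p \<in> fst c'" by blast+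
  have S': "fst c \<inter> S = fst c" if "c \<in> A" for c using chart_subset_pts[OF that] S by blast
  obtain D' where D': "(transition c' d f has_derivative D') (at (snd c' p) within snd c' ` fst c')"
    using diff[OF c'] by (auto simp: differentiable_def)
  let ?T = "snd c' ` (fst c' \<inter> fst c)"
  obtain K where K: "(transition c' c id has_derivative K) (at (snd c' p) within ?T)"
    using regular_atlasD(4)[OF reg c'(1) c(1) c'(2) c(2)] by (auto simp: differentiable_def)
  have im: "transition c' c id ` ?T \<subseteq> snd c ` fst c" "transition c' c id (snd c' p) = snd c p"
    using transition_apply[OF regular_atlasD(1)[OF reg c'(1)], of _ c id] c' by auto
  have "((\<lambda>q. transition c d f (transition c' c id q)) has_derivative (\<lambda>v. D (K v))) (at (snd c' p) within ?T)"
    by (rule has_derivative_in_compose[OF K]) (use has_derivative_subset[OF D im(1)] im(2) in simp)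
  then have "(transition c' d f has_derivative (\<lambda>v. D (K v))) (at (snd c' p) within ?T)"
  proof (rule has_derivative_transform[rotated 2])
    show "snd c' p \<in> ?T" using c c' by blast
    fix q assume "q \<in> ?T"
    then obtain x where x: "q = snd c' x" "x \<in> fst c'" "x \<in> fst c" by blast
    show "transition c' d f q = transition c d f (transition c' c id q)"
      using transition_apply[OF regular_atlasD(1)[OF reg c'(1)] x(2), of d f]
        transition_apply[OF regular_atlasD(1)[OF reg c'(1)] x(2), of c id]
        transition_apply[OF regular_atlasD(1)[OF reg c(1)] x(3), of d f] by (simp add: x(1))
  qed
  moreover have "(transition c' d f has_derivative D') (at (snd c' p) within ?T)"
    by (rule has_derivative_subset[OF D']) auto
  ultimately have "D' = (\<lambda>v. D (K v))"
    using has_derivative_thick_unique regular_atlasD(5)[OF reg c'(1) c(1) c'(2) c(2)] by blast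
  moreover have "snd X c = K (snd X c')"
    by (rule tspace_has_derivative[OF reg X c'(1) c(1) c'(2) c(2) K])
  moreover have "snd (tmap A B S f X) d = D' (snd X c')"
    using d tspaceD(1)[OF X] frechet_derivative_within_eq[OF D' regular_atlasD(3)[OF reg c']]
    unfolding tmap_def snd_conv Let_def by (simp add: c'_def[symmetric] S'[OF c'(1)])
  ultimately show ?thesis by simp
qed

text \<open>If \<open>S\<close> lies in a fibre, \<open>frechet_derivative\<close> within
  \<open>S\<close> is an arbitrary choice. By the chain rule every choice takes the same value on
  the velocity of a curve that stays in \<open>S\<close>.\<close>

lemma tmap_velocity:
  assumes inj: "\<And>c. c \<in> A \<Longrightarrow> inj_on (snd c) (fst c)" and p: "\<eta> 0 \<in> pts A"
    and \<eta>: "\<And>c. c \<in> A \<Longrightarrow> \<eta> 0 \<in> fst c \<Longrightarrow> (\<lambda>t. snd c (\<eta> t)) differentiable (at 0)"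
    and ev: "\<And>c. c \<in> A \<Longrightarrow> \<eta> 0 \<in> fst c \<Longrightarrow> eventually (\<lambda>t. \<eta> t \<in> fst c \<inter> S) (nhds 0)"
    and f: "\<And>c d. c \<in> A \<Longrightarrow> d \<in> B \<Longrightarrow> \<eta> 0 \<in> fst c \<Longrightarrow> f (\<eta> 0) \<in> fst d \<Longrightarrow>
      transition c d f differentiable (at (snd c (\<eta> 0)) within snd c ` (fst c \<inter> S))"
  shows "tmap A B S f (velocity A UNIV \<eta> 0) = velocity B UNIV (\<lambda>t. f (\<eta> t)) 0"
proof (rule prod_eqI)
  show "snd (tmap A B S f (velocity A UNIV \<eta> 0)) = snd (velocity B UNIV (\<lambda>t. f (\<eta> t)) 0)"
  proof
    fix d
    define c where "c = (SOME c. c \<in> A \<and> \<eta> 0 \<in> fst c)"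
    have "\<exists>c. c \<in> A \<and> \<eta> 0 \<in> fst c" using p by (auto simp: pts_def)
    then have "c \<in> A \<and> \<eta> 0 \<in> fst c" unfolding c_def by (rule someI_ex)
    then have c: "c \<in> A" "\<eta> 0 \<in> fst c" by blast+
    show "snd (tmap A B S f (velocity A UNIV \<eta> 0)) d = snd (velocity B UNIV (\<lambda>t. f (\<eta> t)) 0) d"
    proof (cases "d \<in> B \<and> f (\<eta> 0) \<in> fst d")
      case True
      let ?X = "vector_derivative (\<lambda>t. snd c (\<eta> t)) (at 0)"
      let ?D = "frechet_derivative (transition c d f) (at (snd c (\<eta> 0)) within snd c ` (fst c \<inter> S))"
      have D: "(transition c d f has_derivative ?D) (at (snd c (\<eta> 0)) within snd c ` (fst c \<inter> S))"
        using f[OF c(1) _ c(2)] True frechet_derivative_works by blast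
      have v: "((\<lambda>t. snd c (\<eta> t)) has_vector_derivative ?X) (at 0)"
        using \<eta>[OF c] vector_derivative_works by blast
      obtain T where T: "open T" "0 \<in> T" "\<And>t. t \<in> T \<Longrightarrow> \<eta> t \<in> fst c \<inter> S"
        using ev[OF c] by (auto simp: eventually_nhds)
      have eqn: "snd d (f (\<eta> t)) = transition c d f (snd c (\<eta> t))" if "t \<in> T" for t
        using transition_apply[OF inj[OF c(1)], of "\<eta> t" d f] T(3)[OF that] by simp
      have "((\<lambda>t. snd c (\<eta> t)) has_derivative (\<lambda>t. t *\<^sub>R ?X)) (at 0 within T)"
        using v by (simp add: has_vector_derivative_def has_derivative_at_withinI)
      moreover have "(transition c d f has_derivative ?D) (at (snd c (\<eta> 0)) within (\<lambda>t. snd c (\<eta> t)) ` T)"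
        by (rule has_derivative_subset[OF D]) (use T(3) in auto)
      ultimately have "((\<lambda>t. transition c d f (snd c (\<eta> t))) has_derivative (\<lambda>t. ?D (t *\<^sub>R ?X))) (at 0 within T)"
        by (rule has_derivative_in_compose)
      then have "((\<lambda>t. snd d (f (\<eta> t))) has_derivative (\<lambda>t. ?D (t *\<^sub>R ?X))) (at 0 within T)"
        by (rule has_derivative_transform[OF T(2), rotated]) (rule eqn)
      then have "((\<lambda>t. snd d (f (\<eta> t))) has_derivative (\<lambda>t. t *\<^sub>R ?D ?X)) (at 0)"
        unfolding at_within_open[OF T(2,1)] linear_cmul[OF has_derivative_linear[OF D]] .
      then have "((\<lambda>t. snd d (f (\<eta> t))) has_vector_derivative ?D ?X) (at 0)"
        unfolding has_vector_derivative_def .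
      then have "vector_derivative (\<lambda>t. snd d (f (\<eta> t))) (at 0) = ?D ?X" by (rule vector_derivative_at)
      then show ?thesis using True c unfolding tmap_def velocity_def snd_conv fst_conv Let_def by (simp add: c_def[symmetric])
    qed (auto simp: tmap_def velocity_def)
  qed
qed (simp add: velocity_def)

text \<open>\<open>F\<close> is an explicit coordinate form of \<open>f\<close>, usually available
  only where further charts are defined; the open set \<open>W\<close> encodes that
  restriction.\<close>

lemma transition_has_derivativeI:
  assumes C: "C \<in> A" "inj_on (snd C) (fst C)" and W: "openin (atlas_top A) W"
    and p: "p \<in> fst C" "p \<in> W" "p \<in> S"
    and F: "(F has_derivative D) (at (snd C p) within snd C ` (fst C \<inter> S \<inter> W))"
    and eq: "\<And>x. x \<in> fst C \<Longrightarrow> x \<in> S \<Longrightarrow> x \<in> W \<Longrightarrow> snd d (f x) = F (snd C x)"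
  shows "(transition C d f has_derivative D) (at (snd C p) within snd C ` (fst C \<inter> S))"
  unfolding at_within_chart_openin[OF C(1) W p(1,2)]
proof (rule has_derivative_transform[OF _ _ F])
  show "snd C p \<in> snd C ` (fst C \<inter> S \<inter> W)" using p by blast
  fix q assume "q \<in> snd C ` (fst C \<inter> S \<inter> W)"
  then obtain x where x: "q = snd C x" "x \<in> fst C" "x \<in> S" "x \<in> W" by blast
  show "transition C d f q = F q"
    using transition_apply[OF C(2) x(2), of d f] eq[OF x(2,3,4)] by (simp add: x(1))
qed

lemma has_vector_derivative_compose_has_derivative:
  assumes "(p has_vector_derivative p') (at u within J)" "(F has_derivative D) (at (p u))"
  shows "((\<lambda>s. F (p s)) has_vector_derivative D p') (at u within J)"
  using vector_derivative_diff_chain_within[OF assms(1) has_derivative_at_withinI[OF assms(2)]]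
  by (simp add: o_def)

lemma has_vector_derivative_transform_eventually:
  assumes "(f has_vector_derivative f') (at x within s)" "eventually (\<lambda>x'. f x' = g x') (at x within s)"
    "f x = g x" "x \<in> s"
  shows "(g has_vector_derivative f') (at x within s)"
  using assms has_derivative_transform_eventually unfolding has_vector_derivative_def by blast


lemma has_vector_derivative_Un:
  assumes "(f has_vector_derivative f') (at x within S)" "(f has_vector_derivative f') (at x within T)"
  shows "(f has_vector_derivative f') (at x within S \<union> T)"
  using assms unfolding has_vector_derivative_def has_derivative_within unfolding at_within_union
  by (auto simp: filterlim_def filtermap_sup)

lemma differentiable_transform_eventually:
  assumes "f differentiable (at q)" "eventually (\<lambda>z. f z = g z) (nhds q)"
  shows "g differentiable (at q)"
proof -
  obtain D where D: "(f has_derivative D) (at q)" using assms(1) by (auto simp: differentiable_def)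
  obtain U where U: "open U" "q \<in> U" "\<And>z. z \<in> U \<Longrightarrow> f z = g z" using assms(2) by (auto simp: eventually_nhds)
  have "(g has_derivative D) (at q)" by (rule has_derivative_transform_within_open[OF D U])
  then show ?thesis by (auto simp: differentiable_def)
qed


section \<open>Fibre bundles\<close>

lemma fst_adapted_chart [simp]: "fst (adapted_chart B k y) = {x \<in> tot B. prj B x \<in> fst k \<and> prj B x \<in> fst y}"
  by (auto simp: adapted_chart_def)

lemma snd_adapted_chart [simp]: "snd (adapted_chart B k y) x = (snd k (prj B x), snd y x)"
  by (simp add: adapted_chart_def)

lemma adapted_chart_in_bundle_atlas: "k \<in> A \<Longrightarrow> y \<in> trivs B \<Longrightarrow> adapted_chart B k y \<in> bundle_atlas A B"
  unfolding bundle_atlas_def by blast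

lemma pts_bundle_atlas_subset: "pts (bundle_atlas A B) \<subseteq> tot B"
  by (auto simp: pts_def bundle_atlas_def)

lemma bundle_atlasE:
  assumes "C \<in> bundle_atlas A B"
  obtains k y where "C = adapted_chart B k y" "k \<in> A" "y \<in> trivs B"
  using assms by (auto simp: bundle_atlas_def)

lemma openin_bundle_preimage:
  assumes "openin (atlas_top A) W"
  shows "openin (atlas_top (bundle_atlas A B)) {x \<in> pts (bundle_atlas A B). prj B x \<in> W}"
  unfolding openin_atlas_top
proof (intro conjI ballI)
  fix C assume "C \<in> bundle_atlas A B"
  then obtain k y where C: "C = adapted_chart B k y" "k \<in> A" "y \<in> trivs B" by (rule bundle_atlasE)
  obtain G where G: "open G" "fst k \<inter> W = {m \<in> fst k. snd k m \<in> G}"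
    using assms C(2) by (auto simp: openin_atlas_top)
  have "m \<in> W \<longleftrightarrow> snd k m \<in> G" if "m \<in> fst k" for m using G(2) that by blast
  then have "fst C \<inter> {x \<in> pts (bundle_atlas A B). prj B x \<in> W} = {p \<in> fst C. snd C p \<in> G \<times> UNIV}"
    using chart_subset_pts[OF \<open>C \<in> bundle_atlas A B\<close>] by (auto simp: C(1))
  then show "\<exists>G. open G \<and> fst C \<inter> {x \<in> pts (bundle_atlas A B). prj B x \<in> W} = {p \<in> fst C. snd C p \<in> G}"
    using G(1) by (blast intro: open_Times open_UNIV)
qed auto

lemma fibre_bundleD:
  assumes "fibre_bundle A B"
  shows "prj B ` tot B \<subseteq> pts A" "\<Union> (fst ` trivs B) = pts A" "manifold (bundle_atlas A B)"
    "y \<in> trivs B \<Longrightarrow> openin (atlas_top A) (fst y)"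
    "y \<in> trivs B \<Longrightarrow> m \<in> fst y \<Longrightarrow> bij_betw (snd y) (fibre B m) UNIV"
    "y \<in> trivs B \<Longrightarrow> m \<in> fst y \<Longrightarrow> inj_on (snd y) (fibre B m)"
    "y \<in> trivs B \<Longrightarrow> m \<in> fst y \<Longrightarrow> snd y ` fibre B m = UNIV"
  using assms unfolding fibre_bundle_def bij_betw_def by blast+

lemma fibre_bundle_charts:
  assumes "fibre_bundle A B" "m \<in> pts A"
  obtains k y where "k \<in> A" "y \<in> trivs B" "m \<in> fst k" "m \<in> fst y"
proof -
  obtain k where "k \<in> A" "m \<in> fst k" using assms(2) by (auto simp: pts_def)
  moreover obtain y where "y \<in> trivs B" "m \<in> fst y" using assms(2) fibre_bundleD(2)[OF assms(1)] by blast
  ultimately show ?thesis using that by blast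
qed

lemma pts_bundle_atlas:
  assumes "fibre_bundle A B"
  shows "pts (bundle_atlas A B) = tot B"
proof
  show "pts (bundle_atlas A B) \<subseteq> tot B" by (rule pts_bundle_atlas_subset)
  show "tot B \<subseteq> pts (bundle_atlas A B)"
  proof
    fix x assume x: "x \<in> tot B"
    then have "prj B x \<in> pts A" using fibre_bundleD(1)[OF assms] by blast
    then obtain k y where "k \<in> A" "y \<in> trivs B" "prj B x \<in> fst k" "prj B x \<in> fst y"
      using fibre_bundle_charts[OF assms] by metis
    then show "x \<in> pts (bundle_atlas A B)"
      using x adapted_chart_in_bundle_atlas[of k A y B] chart_subset_pts[of "adapted_chart B k y"] by force
  qed
qed

abbreviation tinv :: "('x, 'm, 'f, 'z) fbundle_scheme \<Rightarrow> 'm set \<times> ('x \<Rightarrow> 'f) \<Rightarrow> 'm \<Rightarrow> 'f \<Rightarrow> 'x" where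
  "tinv B y m \<equiv> inv_into (fibre B m) (snd y)"

lemma tinv:
  assumes "fibre_bundle A B" "y \<in> trivs B" "m \<in> fst y"
  shows "tinv B y m q \<in> fibre B m" "snd y (tinv B y m q) = q" "x \<in> fibre B m \<Longrightarrow> tinv B y m (snd y x) = x"
  using fibre_bundleD(6,7)[OF assms] by (auto simp: inv_into_into f_inv_into_f inv_into_f_f)

text \<open>This is the coordinate change of the total space with the base coordinate
  frozen.\<close>

lemma fibre_transition_differentiable:
  assumes B: "fibre_bundle A B" and y: "y \<in> trivs B" "y' \<in> trivs B" and m: "m \<in> fst y" "m \<in> fst y'"
  shows "(\<lambda>q. snd y' (tinv B y m q)) differentiable (at q)"
proof -
  have "m \<in> pts A" using fibre_bundleD(2)[OF B] y(1) m(1) by blast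
  then obtain k where k: "k \<in> A" "m \<in> fst k" by (auto simp: pts_def)
  let ?C = "adapted_chart B k y" and ?C' = "adapted_chart B k y'"
  have C: "?C \<in> bundle_atlas A B" "?C' \<in> bundle_atlas A B" using k y by (auto intro: adapted_chart_in_bundle_atlas)
  have fib: "tinv B y m q \<in> fst ?C" "tinv B y m q \<in> fst ?C'" "prj B (tinv B y m q) = m" for q
    using tinv(1)[OF B y(1) m(1), of q] k m by (auto simp: fibre_def)
  have "transition ?C ?C' id differentiable (at (snd ?C (tinv B y m q)))"
    by (rule manifold_transition_differentiable[OF fibre_bundleD(3)[OF B] C fib(1,2)])
  then have "transition ?C ?C' id differentiable (at (snd k m, q))"
    using fib(3) tinv(2)[OF B y(1) m(1)] by simp
  then obtain D where D: "(transition ?C ?C' id has_derivative D) (at (snd k m, q))"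
    by (auto simp: differentiable_def)
  have "((\<lambda>q. transition ?C ?C' id (snd k m, q)) has_derivative (\<lambda>v. D (0, v))) (at q)"
    by (rule has_derivative_compose[of "Pair (snd k m)" "Pair 0", OF _ D]) (auto intro!: derivative_eq_intros)
  then have "(\<lambda>q. snd (transition ?C ?C' id (snd k m, q))) differentiable (at q)"
    using has_derivative_snd unfolding differentiable_def by blast
  moreover have "snd (transition ?C ?C' id (snd k m, q)) = snd y' (tinv B y m q)" for q
    using transition_apply[OF manifoldD(1)[OF fibre_bundleD(3)[OF B] C(1,1)] fib(1)[of q], of ?C' id]
      fib(3)[of q] tinv(2)[OF B y(1) m(1)] by simp
  ultimately show ?thesis by simp
qed

text \<open>In a chart adapted to \<open>k\<close> the projection is \<open>fst\<close>; in the
  other adapted charts it is \<open>fst\<close> followed by a coordinate change of the base. Applied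
  to \<open>h\<close>, this identifies the base component of a lift.\<close>

lemma tmap_prj:
  assumes A: "manifold A" and B: "fibre_bundle A B" and k: "k \<in> A" "y \<in> trivs B"
    and x: "x \<in> tot B" "prj B x \<in> fst k" "prj B x \<in> fst y" and X: "X \<in> tspace (bundle_atlas A B) x"
  shows "snd (tmap (bundle_atlas A B) A (tot B) (prj B) X) k = fst (snd X (adapted_chart B k y))"
proof -
  have man: "manifold (bundle_atlas A B)" by (rule fibre_bundleD(3)[OF B])
  have D: "(transition (adapted_chart B k' y') k (prj B) has_derivative (\<lambda>v. K (fst v)))
      (at (snd (adapted_chart B k' y') x) within snd (adapted_chart B k' y') ` fst (adapted_chart B k' y'))"
    if k': "k' \<in> A" "y' \<in> trivs B" "x \<in> fst (adapted_chart B k' y')"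
      and K: "(transition k' k id has_derivative K) (at (snd k' (prj B x)))" for k' y' K
  proof -
    let ?C = "adapted_chart B k' y'" and ?W = "{x \<in> pts (bundle_atlas A B). prj B x \<in> fst k}"
    have C: "?C \<in> bundle_atlas A B" using k' by (simp add: adapted_chart_in_bundle_atlas)
    have "(transition ?C k (prj B) has_derivative (\<lambda>v. K (fst v))) (at (snd ?C x) within snd ?C ` (fst ?C \<inter> UNIV))"
    proof (rule transition_has_derivativeI[OF C manifoldD(1)[OF man C C]
          openin_bundle_preimage[OF manifold_openin_chart[OF A k(1)]] k'(3)])
      show "x \<in> ?W" using x pts_bundle_atlas[OF B] by simp
      have "((\<lambda>v. transition k' k id (fst v)) has_derivative (\<lambda>v. K (fst v))) (at (snd ?C x))"
        by (rule has_derivative_compose[OF bounded_linear_imp_has_derivative[OF bounded_linear_fst]]) (use K in \<open>simp only: snd_adapted_chart fst_conv\<close>)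
      then show "((\<lambda>v. transition k' k id (fst v)) has_derivative (\<lambda>v. K (fst v)))
          (at (snd ?C x) within snd ?C ` (fst ?C \<inter> UNIV \<inter> ?W))"
        by (rule has_derivative_at_withinI)
      fix x' assume "x' \<in> fst ?C"
      then show "snd k (prj B x') = transition k' k id (fst (snd ?C x'))"
        using transition_apply[OF manifoldD(1)[OF A k'(1) k'(1)], of "prj B x'" k id] by simp
    qed simp
    then show ?thesis by simp
  qed
  have id: "(transition k k id has_derivative (\<lambda>v. v)) (at (snd k (prj B x)))"
  proof (rule has_derivative_transform_within_open[OF has_derivative_ident manifoldD(4)[OF A k(1) k(1)]])
    show "snd k (prj B x) \<in> snd k ` fst k" using x(2) by blast
    fix q assume "q \<in> snd k ` fst k"
    then show "q = transition k k id q" using transition_apply[OF manifoldD(1)[OF A k(1) k(1)], of _ k id] by auto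
  qed
  show ?thesis
  proof (rule tmap_component[OF manifold_imp_regular_atlas[OF man] X])
    show "(transition (adapted_chart B k y) k (prj B) has_derivative fst)
      (at (snd (adapted_chart B k y) x) within snd (adapted_chart B k y) ` fst (adapted_chart B k y))"
      using D[OF k _ id] x by simp
    fix C assume "C \<in> bundle_atlas A B" "x \<in> fst C"
    then obtain k' y' where C: "C = adapted_chart B k' y'" "k' \<in> A" "y' \<in> trivs B" by (auto elim: bundle_atlasE)
    obtain K where "(transition k' k id has_derivative K) (at (snd k' (prj B x)))"
      using manifold_transition_differentiable[OF A C(2) k(1)] \<open>x \<in> fst C\<close> x(2)
      by (auto simp: C(1) differentiable_def)
    then show "transition C k (prj B) differentiable (at (snd C x) within snd C ` fst C)"
      using D[OF C(2,3)] \<open>x \<in> fst C\<close> unfolding C(1) differentiable_def by blast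
  qed (use k x pts_bundle_atlas[OF B] in \<open>auto intro: adapted_chart_in_bundle_atlas\<close>)
qed

section \<open>Bundles over a curve\<close>

text \<open>\<open>B\<close> is any fibre bundle, so that the locale serves both the affine bundle
  with \<open>h\<close> and its model bundle with the linear part.\<close>

locale lifted_curve =
  fixes A :: "('m, 'a::banach) atlas"
    and B :: "('x, 'm, 'f::banach, 'z) fbundle_scheme"
    and V :: "('v, 'm, 'k::banach) vbundle"
    and \<rho> :: "'v \<Rightarrow> ('m, 'a) tvec"
    and h :: "'x \<times> 'v \<Rightarrow> ('x, 'a \<times> 'f) tvec"
    and c :: "real \<Rightarrow> 'v" and I :: "real set"
  assumes A: "manifold A" and B: "fibre_bundle A B" and V: "vector_bundle A V"
    and conn: "connection A B V \<rho> h"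
    and I: "is_interval I" "interior I \<noteq> {}"
    and adm: "admissible A V \<rho> I c"
begin

abbreviation base :: "real \<Rightarrow> 'm" where
  "base u \<equiv> prj V (c u)"

abbreviation ch :: "('m, 'a) chart \<Rightarrow> 'm set \<times> ('x \<Rightarrow> 'f) \<Rightarrow> ('x, 'a \<times> 'f) chart" where
  "ch k y \<equiv> adapted_chart B k y"

abbreviation tr where
  "tr k y k' y' \<equiv> transition (ch k y) (ch k' y') id"

abbreviation hcomp :: "('m, 'a) chart \<Rightarrow> 'm set \<times> ('x \<Rightarrow> 'f) \<Rightarrow> real \<Rightarrow> 'x \<Rightarrow> 'f" where
  "hcomp k y u x \<equiv> snd (snd (h (x, c u)) (ch k y))"

lemma Vb: "fibre_bundle A V"
  using V by (simp add: vector_bundle_def)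

lemma man_B: "manifold (bundle_atlas A B)"
  by (rule fibre_bundleD(3)[OF B])

lemma c_tot: "u \<in> I \<Longrightarrow> c u \<in> tot V"
  and c_continuous: "continuous_map (atlas_top (interval_atlas I)) (atlas_top (bundle_atlas A V)) c"
proof -
  show cont: "continuous_map (atlas_top (interval_atlas I)) (atlas_top (bundle_atlas A V)) c"
    using adm by (simp add: admissible_def smooth_map_def)
  have "pts (interval_atlas I) = I" by (simp add: pts_def interval_atlas_def)
  then show "u \<in> I \<Longrightarrow> c u \<in> tot V"
    using continuous_map_image_subset_topspace[OF cont] pts_bundle_atlas[OF Vb] by auto
qed

lemma base_pts: "u \<in> I \<Longrightarrow> base u \<in> pts A"
  using c_tot fibre_bundleD(1)[OF Vb] by blast

lemma c_fibre: "u \<in> I \<Longrightarrow> c u \<in> fibre V (base u)"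
  using c_tot by (simp add: fibre_def)

lemma openin_interval_atlas: "openin (atlas_top (interval_atlas I)) W \<longleftrightarrow> (\<exists>G. open G \<and> W = I \<inter> G)"
  unfolding openin_atlas_top interval_atlas_def pts_def by auto

lemma openin_base:
  assumes "openin (atlas_top A) W"
  shows "openin (atlas_top (interval_atlas I)) {u \<in> I. base u \<in> W}"
proof -
  have "pts (interval_atlas I) = I" by (simp add: pts_def interval_atlas_def)
  then have "openin (atlas_top (interval_atlas I)) {u \<in> I. c u \<in> {v \<in> tot V. prj V v \<in> W}}"
    using openin_continuous_map_preimage[OF c_continuous openin_bundle_preimage[OF assms, of V]]
    by (simp add: pts_bundle_atlas[OF Vb])
  moreover have "{u \<in> I. c u \<in> {v \<in> tot V. prj V v \<in> W}} = {u \<in> I. base u \<in> W}"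
    using c_tot by blast
  ultimately show ?thesis by simp
qed

lemma base_open:
  assumes "openin (atlas_top A) W"
  obtains G where "open G" "\<And>u. u \<in> I \<Longrightarrow> base u \<in> W \<longleftrightarrow> u \<in> G"
  using openin_base[OF assms] unfolding openin_interval_atlas by blast

lemma base_eventually:
  assumes "openin (atlas_top A) W" "u \<in> I" "base u \<in> W" "J \<subseteq> I"
  shows "eventually (\<lambda>s. base s \<in> W) (at u within J)"
proof -
  obtain G where G: "open G" "\<And>u. u \<in> I \<Longrightarrow> base u \<in> W \<longleftrightarrow> u \<in> G" using base_open[OF assms(1)] by blast
  then show ?thesis
    unfolding eventually_at_topological using assms(2-4) by (intro exI[of _ G]) blast
qed

lemma base_derivative:
  assumes "k \<in> A" "u \<in> I" "base u \<in> fst k"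
  shows "((\<lambda>s. snd k (base s)) has_vector_derivative snd (\<rho> (c u)) k) (at u within I)"
  using adm assms by (simp add: admissible_def has_velocity_def)

lemma charts:
  assumes "u \<in> I"
  obtains k y where "k \<in> A" "y \<in> trivs B" "base u \<in> fst k" "base u \<in> fst y"
  using fibre_bundle_charts[OF B base_pts[OF assms]] .

lemma h_tspace: "u \<in> I \<Longrightarrow> x \<in> fibre B (base u) \<Longrightarrow> h (x, c u) \<in> tspace (bundle_atlas A B) x"
  using conn base_pts c_fibre unfolding connection_def by blast

text \<open>The condition that \<open>h\<close> projects to the anchor fixes the base component, so
  that only the fibre component \<open>hcomp\<close> carries information.\<close>

lemma h_chart:
  assumes "u \<in> I" "x \<in> fibre B (base u)" "k \<in> A" "y \<in> trivs B" "base u \<in> fst k" "base u \<in> fst y"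
  shows "snd (h (x, c u)) (ch k y) = (snd (\<rho> (c u)) k, hcomp k y u x)"
proof -
  have "tmap (bundle_atlas A B) A (tot B) (prj B) (h (x, c u)) = \<rho> (c u)"
    using conn base_pts[OF assms(1)] c_fibre[OF assms(1)] assms(2) unfolding connection_def by blast
  then show ?thesis
    using tmap_prj[OF A B assms(3,4) _ _ _ h_tspace[OF assms(1,2)]] assms(2,5,6)
    by (auto simp: fibre_def intro: prod_eqI)
qed

lemma transition_B:
  assumes "k \<in> A" "k' \<in> A" "y \<in> trivs B" "y' \<in> trivs B" "x \<in> fibre B m"
    "m \<in> fst k" "m \<in> fst k'" "m \<in> fst y" "m \<in> fst y'"
  shows "tr k y k' y' (snd k m, snd y x) = (snd k' m, snd y' x)"
    "tr k y k' y' differentiable (at (snd k m, snd y x))"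
proof -
  have C: "ch k y \<in> bundle_atlas A B" "ch k' y' \<in> bundle_atlas A B"
    using assms by (auto intro: adapted_chart_in_bundle_atlas)
  have x: "x \<in> fst (ch k y)" "x \<in> fst (ch k' y')" "prj B x = m"
    using assms by (auto simp: fibre_def)
  show "tr k y k' y' (snd k m, snd y x) = (snd k' m, snd y' x)"
    using transition_apply[OF manifoldD(1)[OF man_B C(1,1)] x(1), of "ch k' y'" id] x(3) by simp
  show "tr k y k' y' differentiable (at (snd k m, snd y x))"
    using manifold_transition_differentiable[OF man_B C x(1,2)] x(3) by simp
qed

lemma h_transition:
  assumes u: "u \<in> I" and "k \<in> A" "k' \<in> A" "y \<in> trivs B" "y' \<in> trivs B" "x \<in> fibre B (base u)"
    "base u \<in> fst k" "base u \<in> fst k'" "base u \<in> fst y" "base u \<in> fst y'"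
    and K: "(tr k y k' y' has_derivative K)
      (at (snd k (base u), snd y x))"
  shows "K (snd (\<rho> (c u)) k, hcomp k y u x) = (snd (\<rho> (c u)) k', hcomp k' y' u x)"
proof -
  have C: "ch k y \<in> bundle_atlas A B" "ch k' y' \<in> bundle_atlas A B"
    using assms by (auto intro: adapted_chart_in_bundle_atlas)
  have x: "x \<in> fst (ch k y)" "x \<in> fst (ch k' y')" "prj B x = base u"
    using assms by (auto simp: fibre_def)
  have e: "snd (h (x, c u)) (ch k' y') = K (snd (h (x, c u)) (ch k y))"
    by (rule tspace_has_derivative[OF manifold_imp_regular_atlas[OF man_B] h_tspace[OF u assms(6)] C x(1,2)])
      (use K x(3) in \<open>simp only: snd_adapted_chart has_derivative_at_withinI\<close>)
  show ?thesis
    unfolding h_chart[OF assms(1,6,2,4,7,9), symmetric] h_chart[OF assms(1,6,3,5,8,10), symmetric]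
    by (rule e[symmetric])
qed

lemma snd_transition_derivative:
  assumes "k \<in> A" "k' \<in> A" "y \<in> trivs B" "x \<in> fibre B m" "m \<in> fst k" "m \<in> fst k'" "m \<in> fst y"
    and K: "(tr k y k' y has_derivative K) (at (snd k m, snd y x))"
  shows "snd (K v) = snd v"
proof -
  let ?C = "ch k y" and ?C' = "ch k' y"
  have C: "?C \<in> bundle_atlas A B" "?C' \<in> bundle_atlas A B" using assms by (auto intro: adapted_chart_in_bundle_atlas)
  have x: "x \<in> fst ?C" "x \<in> fst ?C'" "prj B x = m" using assms by (auto simp: fibre_def)
  have "((\<lambda>v. snd (transition ?C ?C' id v)) has_derivative snd) (at (snd k m, snd y x))"
  proof (rule has_derivative_transform_within_open[OF bounded_linear_imp_has_derivative[OF bounded_linear_snd]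
        manifoldD(2)[OF man_B C]])
    show "(snd k m, snd y x) \<in> snd ?C ` (fst ?C \<inter> fst ?C')" using x by (auto intro!: image_eqI[of _ _ x])
    fix q assume "q \<in> snd ?C ` (fst ?C \<inter> fst ?C')"
    then show "snd q = snd (transition ?C ?C' id q)"
      using transition_apply[OF manifoldD(1)[OF man_B C(1,1)], of _ ?C' id] by auto
  qed
  from has_derivative_unique[OF this has_derivative_snd[OF K]] show ?thesis by metis
qed

text \<open>A change of the base chart alone leaves the fibre coordinate untouched, hence also the
  fibre component of a tangent vector.\<close>

lemma hcomp_base_chart:
  assumes "u \<in> I" "k \<in> A" "k' \<in> A" "y \<in> trivs B" "x \<in> fibre B (base u)"
    "base u \<in> fst k" "base u \<in> fst k'" "base u \<in> fst y"
  shows "hcomp k y u x = hcomp k' y u x"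
proof -
  obtain K where K: "(tr k y k' y has_derivative K)
      (at (snd k (base u), snd y x))"
    using transition_B(2)[OF assms(2,3,4,4,5,6,7,8,8)] by (auto simp: differentiable_def)
  show ?thesis
    using h_transition[OF assms(1,2,3,4,4,5,6,7,8,8) K] snd_transition_derivative[OF assms(2-8) K] by (metis snd_conv)
qed


subsection \<open>Solutions in trivializations\<close>

text \<open>The equation of a lift reduced to its fibre component; the base component holds by
  admissibility. A one-point interval is allowed, and the derivative condition is then
  empty.\<close>

definition coord :: "real set \<Rightarrow> (real \<Rightarrow> 'x) \<Rightarrow> bool" where
  "coord J \<psi> \<longleftrightarrow> is_interval J \<and> J \<subseteq> I \<and> (\<forall>u\<in>J. \<psi> u \<in> fibre B (base u)) \<and>
     (\<forall>u\<in>J. \<forall>k\<in>A. \<forall>y\<in>trivs B. base u \<in> fst k \<longrightarrow> base u \<in> fst y \<longrightarrow>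
        ((\<lambda>s. snd y (\<psi> s)) has_vector_derivative hcomp k y u (\<psi> u)) (at u within J))"

lemma coordD:
  assumes "coord J \<psi>"
  shows "is_interval J" "J \<subseteq> I" "u \<in> J \<Longrightarrow> \<psi> u \<in> fibre B (base u)"
    "u \<in> J \<Longrightarrow> k \<in> A \<Longrightarrow> y \<in> trivs B \<Longrightarrow> base u \<in> fst k \<Longrightarrow> base u \<in> fst y \<Longrightarrow>
        ((\<lambda>s. snd y (\<psi> s)) has_vector_derivative hcomp k y u (\<psi> u)) (at u within J)"
  using assms unfolding coord_def by blast+

lemma chart_derivative:
  assumes J: "J \<subseteq> I" "u \<in> J" "\<psi> u \<in> fibre B (base u)" and k: "k \<in> A" "y \<in> trivs B" "base u \<in> fst k" "base u \<in> fst y"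
    and fib: "\<And>s. s \<in> J \<Longrightarrow> \<psi> s \<in> fibre B (base s)"
    and der: "((\<lambda>s. snd y (\<psi> s)) has_vector_derivative hcomp k y u (\<psi> u)) (at u within J)"
  shows "((\<lambda>s. snd (ch k y) (\<psi> s)) has_vector_derivative snd (h (\<psi> u, c u)) (ch k y))
    (at u within J)"
proof -
  have "u \<in> I" using J by blast
  have b: "((\<lambda>s. snd k (base s)) has_vector_derivative snd (\<rho> (c u)) k) (at u within J)"
    using has_vector_derivative_within_subset[OF base_derivative[OF k(1) \<open>u \<in> I\<close> k(3)] J(1)] .
  from has_vector_derivative_Pair[OF b der] show ?thesis
    unfolding h_chart[OF \<open>u \<in> I\<close> J(3) k(1,2,3,4), symmetric]
    by (rule has_vector_derivative_transform[OF J(2), rotated]) (use fib in \<open>simp add: fibre_def\<close>)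
qed

text \<open>One trivialization at each time is enough. The chain rule through the coordinate change
  of the total space gives the others: its base argument moves with the curve, and the resulting
  anchor term is the one that occurs in the transformation of \<open>h\<close>.\<close>

lemma coordI:
  assumes J: "is_interval J" "J \<subseteq> I" and fib: "\<And>u. u \<in> J \<Longrightarrow> \<psi> u \<in> fibre B (base u)"
    and der: "\<And>u. u \<in> J \<Longrightarrow> \<exists>k\<in>A. \<exists>y\<in>trivs B. base u \<in> fst k \<and> base u \<in> fst y \<and>
        ((\<lambda>s. snd y (\<psi> s)) has_vector_derivative hcomp k y u (\<psi> u)) (at u within J)"
  shows "coord J \<psi>"
  unfolding coord_def
proof (intro conjI ballI impI J fib)
  fix u k' y' assume u: "u \<in> J" and k': "k' \<in> A" "y' \<in> trivs B" "base u \<in> fst k'" "base u \<in> fst y'"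
  obtain k y where k: "k \<in> A" "y \<in> trivs B" "base u \<in> fst k" "base u \<in> fst y"
    and d: "((\<lambda>s. snd y (\<psi> s)) has_vector_derivative hcomp k y u (\<psi> u)) (at u within J)"
    using der[OF u] by blast
  have uI: "u \<in> I" using u J by blast
  let ?T = "tr k y k' y'"
  obtain K where K: "(?T has_derivative K) (at (snd k (base u), snd y (\<psi> u)))"
    using transition_B(2)[OF k(1) k'(1) k(2) k'(2) fib[OF u] k(3) k'(3) k(4) k'(4)] by (auto simp: differentiable_def)
  have b: "((\<lambda>s. snd k (base s)) has_vector_derivative snd (\<rho> (c u)) k) (at u within J)"
    using has_vector_derivative_within_subset[OF base_derivative[OF k(1) uI k(3)] J(2)] .
  have "((\<lambda>s. snd (?T (snd k (base s), snd y (\<psi> s)))) has_vector_derivative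
      snd (K (snd (\<rho> (c u)) k, hcomp k y u (\<psi> u)))) (at u within J)"
    by (rule has_vector_derivative_compose_has_derivative[OF has_vector_derivative_Pair[OF b d] has_derivative_snd[OF K]])
  then have "((\<lambda>s. snd (?T (snd k (base s), snd y (\<psi> s)))) has_vector_derivative hcomp k' y' u (\<psi> u)) (at u within J)"
    by (simp only: h_transition[OF uI k(1) k'(1) k(2) k'(2) fib[OF u] k(3) k'(3) k(4) k'(4) K] snd_conv)
  then show "((\<lambda>s. snd y' (\<psi> s)) has_vector_derivative hcomp k' y' u (\<psi> u)) (at u within J)"
  proof (rule has_vector_derivative_transform_eventually)
    have eq: "snd (?T (snd k (base s), snd y (\<psi> s))) = snd y' (\<psi> s)"
      if s: "s \<in> J" "base s \<in> fst k" "base s \<in> fst k'" "base s \<in> fst y" "base s \<in> fst y'" for s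
      using transition_B(1)[OF k(1) k'(1) k(2) k'(2) fib[OF s(1)] s(2-5)] by simp
    show "snd (?T (snd k (base u), snd y (\<psi> u))) = snd y' (\<psi> u)" using eq u k k' by blast
    have "openin (atlas_top A) (fst k \<inter> fst k' \<inter> fst y \<inter> fst y')"
      by (intro openin_Int manifold_openin_chart[OF A] fibre_bundleD(4)[OF B] k k')
    then have "eventually (\<lambda>s. base s \<in> fst k \<inter> fst k' \<inter> fst y \<inter> fst y') (at u within J)"
      by (rule base_eventually) (use uI k k' J in auto)
    moreover have "eventually (\<lambda>s. s \<in> J) (at u within J)" by (simp add: eventually_at_filter)
    ultimately show "eventually (\<lambda>s. snd (?T (snd k (base s), snd y (\<psi> s))) = snd y' (\<psi> s)) (at u within J)"
      by eventually_elim (use eq in blast)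
  qed (rule u)
qed

lemma coord_subset:
  assumes "coord J \<psi>" "J' \<subseteq> J" "is_interval J'"
  shows "coord J' \<psi>"
  unfolding coord_def
  using coordD(1-3)[OF assms(1)] coordD(4)[OF assms(1)] has_vector_derivative_within_subset[OF _ assms(2)] assms(2,3)
  by blast

text \<open>For the converse, the base part of the velocity equation is admissibility together with
  \<open>h_chart\<close>, and continuity into the atlas topology follows from differentiability in
  one chart. From here on lifts are handled through \<open>coord\<close>.\<close>

lemma solves_iff_coord:
  "solves (bundle_atlas A B) (lift_state B V I c) (\<lambda>u q. h (q, c u)) J \<psi> \<longleftrightarrow> coord J \<psi>"
proof
  assume s: "solves (bundle_atlas A B) (lift_state B V I c) (\<lambda>u q. h (q, c u)) J \<psi>"
  have J: "is_interval J" using s by (simp add: solves_def)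
  have l: "u \<in> I" "\<psi> u \<in> fibre B (base u)" "has_velocity (bundle_atlas A B) J \<psi> u (h (\<psi> u, c u))" if "u \<in> J" for u
    using s that by (auto simp: solves_def lift_state_def split: if_splits)
  show "coord J \<psi>"
  proof (rule coordI[OF J])
    fix u assume u: "u \<in> J"
    obtain k y where k: "k \<in> A" "y \<in> trivs B" "base u \<in> fst k" "base u \<in> fst y" using charts[OF l(1)[OF u]] .
    have "((\<lambda>s. snd (ch k y) (\<psi> s)) has_vector_derivative snd (h (\<psi> u, c u)) (ch k y)) (at u within J)"
      using l(3)[OF u] l(2)[OF u] k adapted_chart_in_bundle_atlas[of k A y B]
      unfolding has_velocity_def by (auto simp: fibre_def)
    from has_vector_derivative_compose_has_derivative[OF this bounded_linear_imp_has_derivative[OF bounded_linear_snd]]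
    show "\<exists>k\<in>A. \<exists>y\<in>trivs B. base u \<in> fst k \<and> base u \<in> fst y \<and>
        ((\<lambda>s. snd y (\<psi> s)) has_vector_derivative hcomp k y u (\<psi> u)) (at u within J)"
      using k by auto
  qed (use l in auto)
next
  assume s: "coord J \<psi>"
  note J = coordD(1,2)[OF s]
  have chart: "((\<lambda>s. snd (ch k y) (\<psi> s)) has_vector_derivative
      snd (h (\<psi> u, c u)) (ch k y)) (at u within J)"
    if "u \<in> J" "k \<in> A" "y \<in> trivs B" "base u \<in> fst k" "base u \<in> fst y" for u k y
    by (rule chart_derivative[OF J(2) that(1) coordD(3)[OF s that(1)] that(2-5) coordD(3)[OF s] coordD(4)[OF s that]])
  have "continuous_map (top_of_set J) (atlas_top (bundle_atlas A B)) \<psi>"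
  proof (rule continuous_map_atlasI)
    fix u assume u: "u \<in> J"
    then have uI: "u \<in> I" using J by blast
    obtain k y where k: "k \<in> A" "y \<in> trivs B" "base u \<in> fst k" "base u \<in> fst y" using charts[OF uI] .
    have "openin (atlas_top A) (fst k \<inter> fst y)"
      by (intro openin_Int manifold_openin_chart[OF A] fibre_bundleD(4)[OF B] k)
    then have "eventually (\<lambda>s. base s \<in> fst k \<inter> fst y) (at u within J)"
      by (rule base_eventually) (use uI k J in auto)
    moreover have "eventually (\<lambda>s. s \<in> J) (at u within J)" by (simp add: eventually_at_filter)
    ultimately have "eventually (\<lambda>s. \<psi> s \<in> fst (ch k y)) (at u within J)"
      by eventually_elim (use coordD(3)[OF s] in \<open>auto simp: fibre_def\<close>)
    then show "\<exists>C\<in>bundle_atlas A B. \<psi> u \<in> fst C \<and> eventually (\<lambda>s. \<psi> s \<in> fst C) (at u within J) \<and>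
        continuous (at u within J) (\<lambda>s. snd C (\<psi> s))"
      using k coordD(3)[OF s u] has_vector_derivative_continuous[OF chart[OF u k]]
      by (intro bexI[of _ "ch k y"] adapted_chart_in_bundle_atlas) (auto simp: fibre_def)
  qed
  moreover have "\<psi> u \<in> lift_state B V I c u" "has_velocity (bundle_atlas A B) J \<psi> u (h (\<psi> u, c u))" if u: "u \<in> J" for u
  proof -
    have uI: "u \<in> I" using u J by blast
    then show "\<psi> u \<in> lift_state B V I c u" using coordD(3)[OF s u] by (simp add: lift_state_def)
    show "has_velocity (bundle_atlas A B) J \<psi> u (h (\<psi> u, c u))"
      unfolding has_velocity_def
    proof (intro conjI ballI impI h_tspace uI coordD(3)[OF s u])
      fix C assume "C \<in> bundle_atlas A B" "\<psi> u \<in> fst C"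
      then obtain k y where "C = ch k y" "k \<in> A" "y \<in> trivs B" by (rule_tac bundle_atlasE)
      with \<open>\<psi> u \<in> fst C\<close> show "((\<lambda>s. snd C (\<psi> s)) has_vector_derivative snd (h (\<psi> u, c u)) C) (at u within J)"
        using chart[OF u] coordD(3)[OF s u] by (auto simp: fibre_def simp del: snd_adapted_chart)
    qed
  qed
  ultimately show "solves (bundle_atlas A B) (lift_state B V I c) (\<lambda>u q. h (q, c u)) J \<psi>"
    using J by (simp add: solves_def)
qed

subsection \<open>The pullback bundle and the vector field on it\<close>

abbreviation CA :: "(real \<times> 'x, real \<times> 'f) atlas" where
  "CA \<equiv> curve_atlas B V I c"

abbreviation ctot :: "(real \<times> 'x) set" where
  "ctot \<equiv> tot (curve_pb B V I c)"

abbreviation Lam_c :: "real \<times> 'x \<Rightarrow> (real \<times> 'x, real \<times> 'f) tvec" where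
  "Lam_c \<equiv> Lam A B V h I c"

text \<open>The interval has the identity as its only chart, so the charts of the pullback are
  indexed by trivializations of \<open>B\<close> alone. Different trivializations may yield the same
  chart.\<close>

definition cchart :: "'m set \<times> ('x \<Rightarrow> 'f) \<Rightarrow> (real \<times> 'x, real \<times> 'f) chart" where
  "cchart y = adapted_chart (curve_pb B V I c) (I, \<lambda>u. u) ({u \<in> I. (prj V \<circ> c) u \<in> fst y}, snd y \<circ> snd)"

lemma fst_cchart [simp]: "fst (cchart y) = {(u, x). u \<in> I \<and> x \<in> fibre B (base u) \<and> base u \<in> fst y}"
  by (auto simp: cchart_def pullback_def pb_tot_def fibre_def)

lemma snd_cchart [simp]: "snd (cchart y) p = (fst p, snd y (snd p))"
  by (simp add: cchart_def pullback_def)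

lemma CA_eq: "CA = cchart ` trivs B"
  unfolding bundle_atlas_def interval_atlas_def cchart_def by (auto simp: pullback_def pb_trivs_def)

lemma tot_curve_pb: "ctot = {(u, x). u \<in> I \<and> x \<in> fibre B (base u)}"
  by (auto simp: pullback_def pb_tot_def fibre_def)

lemma prj_curve_pb: "prj (curve_pb B V I c) = fst"
  by (simp add: pullback_def)

lemma fibre_curve_pb: "u \<in> I \<Longrightarrow> fibre (curve_pb B V I c) u = Pair u ` fibre B (base u)"
  by (auto simp: pullback_def pb_tot_def fibre_def)

lemma pts_CA: "pts CA = {(u, x). u \<in> I \<and> x \<in> fibre B (base u)}"
proof
  show "pts CA \<subseteq> {(u, x). u \<in> I \<and> x \<in> fibre B (base u)}" by (auto simp: CA_eq pts_def)
  show "{(u, x). u \<in> I \<and> x \<in> fibre B (base u)} \<subseteq> pts CA"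
  proof clarify
    fix u x assume u: "u \<in> I" "x \<in> fibre B (base u)"
    obtain k y where "k \<in> A" "y \<in> trivs B" "base u \<in> fst k" "base u \<in> fst y" using charts[OF u(1)] .
    then have "cchart y \<in> CA" "(u, x) \<in> fst (cchart y)" using u by (auto simp: CA_eq)
    then show "(u, x) \<in> pts CA" using chart_subset_pts by blast
  qed
qed

lemma openin_CA:
  assumes "openin (atlas_top A) W"
  shows "openin (atlas_top CA) {p \<in> pts CA. base (fst p) \<in> W}"
proof -
  have "{p \<in> pts CA. prj (curve_pb B V I c) p \<in> {u \<in> I. base u \<in> W}} = {p \<in> pts CA. base (fst p) \<in> W}"
    by (auto simp: prj_curve_pb pts_CA)
  then show ?thesis using openin_bundle_preimage[OF openin_base[OF assms], of "curve_pb B V I c"] by simp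
qed

lemma openin_cchart:
  assumes "y \<in> trivs B"
  shows "openin (atlas_top CA) (fst (cchart y))"
proof -
  have "{p \<in> pts CA. base (fst p) \<in> fst y} = fst (cchart y)" by (auto simp: pts_CA)
  then show ?thesis using openin_CA[OF fibre_bundleD(4)[OF B assms]] by simp
qed

lemma inj_cchart:
  assumes "y \<in> trivs B"
  shows "inj_on (snd (cchart y)) (fst (cchart y))"
proof (rule inj_onI)
  fix p p' assume "p \<in> fst (cchart y)" "p' \<in> fst (cchart y)" "snd (cchart y) p = snd (cchart y) p'"
  then show "p = p'"
    using inj_onD[OF fibre_bundleD(6)[OF B assms]] by (auto simp: prod_eq_iff)
qed

text \<open>The map is the coordinate form of the canonical map from the pullback to the bundle. By
  admissibility it sends the direction of \<open>d/du\<close> to the anchor of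
  \<open>c u\<close>.\<close>

lemma strip_derivative:
  assumes "k \<in> A" "u \<in> I" "base u \<in> fst k" "fst ` X \<subseteq> I"
  shows "((\<lambda>v. (snd k (base (fst v)), snd v)) has_derivative (\<lambda>v. (fst v *\<^sub>R snd (\<rho> (c u)) k, snd v)))
    (at (u, q) within X)"
proof -
  have "((\<lambda>s. snd k (base s)) has_derivative (\<lambda>t. t *\<^sub>R snd (\<rho> (c u)) k)) (at (fst (u, q)) within fst ` X)"
    using has_vector_derivative_within_subset[OF base_derivative[OF assms(1-3)] assms(4)]
    by (simp add: has_vector_derivative_def)
  then have "((\<lambda>v. snd k (base (fst v))) has_derivative (\<lambda>v. fst v *\<^sub>R snd (\<rho> (c u)) k)) (at (u, q) within X)"
    by (rule has_derivative_in_compose[OF bounded_linear_imp_has_derivative[OF bounded_linear_fst]])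
  then show ?thesis
    by (rule has_derivative_Pair[OF _ bounded_linear_imp_has_derivative[OF bounded_linear_snd]])
qed

lemma strip_compose:
  assumes k: "k \<in> A" "k' \<in> A" and y: "y \<in> trivs B" "y' \<in> trivs B" and u: "u \<in> I" "x \<in> fibre B (base u)"
    and m: "base u \<in> fst k" "base u \<in> fst k'" "base u \<in> fst y" "base u \<in> fst y'"
    and K: "(tr k y k' y' has_derivative K) (at (snd k (base u), snd y x))"
    and X: "fst ` X \<subseteq> I"
  shows "((\<lambda>v. tr k y k' y' (snd k (base (fst v)), snd v)) has_derivative
      (\<lambda>v. K (fst v *\<^sub>R snd (\<rho> (c u)) k, snd v))) (at (u, snd y x) within X)"
  by (rule has_derivative_compose[OF strip_derivative[OF k(1) u(1) m(1) X]]) (use K in \<open>simp only: fst_conv snd_conv\<close>)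

text \<open>A coordinate change of the pullback is one of the bundle evaluated along the curve. The
  trivializations vary with the base point, which produces the anchor term in the derivative with
  respect to time.\<close>

lemma cchart_transition:
  assumes k: "k \<in> A" and y: "y \<in> trivs B" "y' \<in> trivs B" and u: "u \<in> I" "x \<in> fibre B (base u)"
    and m: "base u \<in> fst k" "base u \<in> fst y" "base u \<in> fst y'"
    and K: "(tr k y k y' has_derivative K) (at (snd k (base u), snd y x))"
  shows "(transition (cchart y) (cchart y') id has_derivative (\<lambda>v. (fst v, snd (K (fst v *\<^sub>R snd (\<rho> (c u)) k, snd v)))))
    (at (u, snd y x) within snd (cchart y) ` (fst (cchart y) \<inter> fst (cchart y')))"
proof -
  let ?W = "{p \<in> pts CA. base (fst p) \<in> fst k}" and ?S = "fst (cchart y')"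
  let ?T = "tr k y k y'"
  have pt: "snd (cchart y) (u, x) = (u, snd y x)" by simp
  have "(transition (cchart y) (cchart y') id has_derivative (\<lambda>v. (fst v, snd (K (fst v *\<^sub>R snd (\<rho> (c u)) k, snd v)))))
    (at (snd (cchart y) (u, x)) within snd (cchart y) ` (fst (cchart y) \<inter> fst (cchart y')))"
  proof (rule transition_has_derivativeI[OF _ inj_cchart[OF y(1)] openin_CA[OF manifold_openin_chart[OF A k]]])
    show "((\<lambda>v. (fst v, snd (?T (snd k (base (fst v)), snd v)))) has_derivative
        (\<lambda>v. (fst v, snd (K (fst v *\<^sub>R snd (\<rho> (c u)) k, snd v)))))
        (at (snd (cchart y) (u, x)) within snd (cchart y) ` (fst (cchart y) \<inter> ?S \<inter> ?W))"
      unfolding pt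
      by (rule has_derivative_Pair[OF bounded_linear_imp_has_derivative[OF bounded_linear_fst]
          has_derivative_snd[OF strip_compose[OF k k y u m(1,1,2,3) K]]]) auto
    fix p assume p: "p \<in> fst (cchart y)" "p \<in> ?S" "p \<in> ?W"
    then show "snd (cchart y') (id p) = (fst (snd (cchart y) p),
        snd (?T (snd k (base (fst (snd (cchart y) p))), snd (snd (cchart y) p))))"
      using transition_B(1)[OF k k y, of "snd p" "base (fst p)"] by auto
  qed (use y u m pts_CA in \<open>auto simp: CA_eq\<close>)
  then show ?thesis by simp
qed

lemma cchart_snd_transition:
  assumes k: "k \<in> A" and y: "y \<in> trivs B" "y' \<in> trivs B" and u: "u \<in> I" "x \<in> fibre B (base u)"
    and m: "base u \<in> fst k" "base u \<in> fst y" "base u \<in> fst y'"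
    and K: "(tr k y k y' has_derivative K) (at (snd k (base u), snd y x))"
  shows "(transition (cchart y) (ch k y') snd has_derivative (\<lambda>v. K (fst v *\<^sub>R snd (\<rho> (c u)) k, snd v)))
    (at (u, snd y x) within snd (cchart y) ` fst (cchart y))"
proof -
  let ?W = "{p \<in> pts CA. base (fst p) \<in> fst k \<inter> fst y'}"
  let ?T = "tr k y k y'"
  have pt: "snd (cchart y) (u, x) = (u, snd y x)" by simp
  have "openin (atlas_top A) (fst k \<inter> fst y')"
    by (intro openin_Int manifold_openin_chart[OF A] fibre_bundleD(4)[OF B] k y)
  note W = openin_CA[OF this]
  have "(transition (cchart y) (ch k y') snd has_derivative (\<lambda>v. K (fst v *\<^sub>R snd (\<rho> (c u)) k, snd v)))
    (at (snd (cchart y) (u, x)) within snd (cchart y) ` (fst (cchart y) \<inter> UNIV))"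
  proof (rule transition_has_derivativeI[OF _ inj_cchart[OF y(1)] W])
    show "((\<lambda>v. ?T (snd k (base (fst v)), snd v)) has_derivative (\<lambda>v. K (fst v *\<^sub>R snd (\<rho> (c u)) k, snd v)))
        (at (snd (cchart y) (u, x)) within snd (cchart y) ` (fst (cchart y) \<inter> UNIV \<inter> ?W))"
      unfolding pt by (rule strip_compose[OF k k y u m(1,1,2,3) K]) auto
    fix p assume p: "p \<in> fst (cchart y)" "p \<in> ?W"
    then show "snd (ch k y') (snd p) = ?T (snd k (base (fst (snd (cchart y) p))), snd (snd (cchart y) p))"
      using transition_B(1)[OF k k y, of "snd p" "base (fst p)"] by (auto simp: fibre_def)
  qed (use y u m pts_CA in \<open>auto simp: CA_eq\<close>)
  then show ?thesis by simp
qed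

lemma cchart_fst_transition:
  assumes y: "y \<in> trivs B" and u: "u \<in> I" "x \<in> fibre B (base u)" "base u \<in> fst y"
  shows "(transition (cchart y) (I, \<lambda>u. u) fst has_derivative fst)
    (at (u, snd y x) within snd (cchart y) ` fst (cchart y))"
proof (rule has_derivative_transform[OF _ _ bounded_linear_imp_has_derivative[OF bounded_linear_fst]])
  show "(u, snd y x) \<in> snd (cchart y) ` fst (cchart y)" using u by (auto intro!: image_eqI[of _ _ "(u, x)"])
  fix q assume "q \<in> snd (cchart y) ` fst (cchart y)"
  then obtain p where p: "q = snd (cchart y) p" "p \<in> fst (cchart y)" by blast
  show "transition (cchart y) (I, \<lambda>u. u) fst q = fst q"
    using transition_apply[OF inj_cchart[OF y] p(2), of "(I, \<lambda>u. u)" fst] by (simp add: p(1))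
qed

lemma I_limit: "u \<in> I \<Longrightarrow> u islimpt I"
  by (rule islimpt_interval[OF I])

lemma CA_thick:
  assumes y: "y \<in> trivs B" "y' \<in> trivs B" and u: "u \<in> I" "base u \<in> fst y" "base u \<in> fst y'"
  shows "thick (u, q) (snd (cchart y) ` (fst (cchart y) \<inter> fst (cchart y')))"
proof -
  have "openin (atlas_top A) (fst y \<inter> fst y')"
    by (intro openin_Int fibre_bundleD(4)[OF B] y)
  then obtain G where G: "open G" "{u \<in> I. base u \<in> fst y \<inter> fst y'} = I \<inter> G"
    using openin_base unfolding openin_interval_atlas by blast
  then have G': "base u \<in> fst y \<inter> fst y' \<longleftrightarrow> u \<in> G" if "u \<in> I" for u using that by blast
  have "snd (cchart y) ` (fst (cchart y) \<inter> fst (cchart y')) = (I \<inter> G) \<times> UNIV"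
  proof (intro equalityI subsetI)
    fix z assume "z \<in> (I \<inter> G) \<times> (UNIV :: 'f set)"
    then obtain s q where s: "z = (s, q)" "s \<in> I" "base s \<in> fst y" "base s \<in> fst y'" using G' by blast
    then show "z \<in> snd (cchart y) ` (fst (cchart y) \<inter> fst (cchart y'))"
      using tinv(1,2)[OF B y(1) s(3), of q] by (intro image_eqI[of _ _ "(s, tinv B y (base s) q)"]) auto
  next
    fix z assume "z \<in> snd (cchart y) ` (fst (cchart y) \<inter> fst (cchart y'))"
    then show "z \<in> (I \<inter> G) \<times> UNIV" using G' by (clarsimp split del: if_split) blast
  qed
  moreover have "u \<in> G" using G'[OF u(1)] u by blast
  ultimately show ?thesis using thick_strip[OF I_limit[OF u(1)] G(1)] by simp
qed

lemma CA_regular: "regular_atlas CA"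
  unfolding regular_atlas_def
proof (intro conjI ballI)
  fix C C' p assume C: "C \<in> CA" "C' \<in> CA" and p: "p \<in> fst C \<inter> fst C'"
  obtain y y' where y: "C = cchart y" "y \<in> trivs B" "C' = cchart y'" "y' \<in> trivs B" using C by (auto simp: CA_eq)
  obtain u x where u: "p = (u, x)" "u \<in> I" "x \<in> fibre B (base u)" "base u \<in> fst y" "base u \<in> fst y'"
    using p by (auto simp: y)
  obtain k where k: "k \<in> A" "base u \<in> fst k" using base_pts[OF u(2)] by (auto simp: pts_def)
  obtain K where K: "(tr k y k y' has_derivative K)
      (at (snd k (base u), snd y x))"
    using transition_B(2)[OF k(1,1) y(2,4) u(3) k(2,2) u(4,5)] by (auto simp: differentiable_def)
  show "transition C C' id differentiable (at (snd C p) within snd C ` (fst C \<inter> fst C'))"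
    using cchart_transition[OF k(1) y(2,4) u(2,3) k(2) u(4,5) K] by (auto simp: y u(1) differentiable_def)
  show "thick (snd C p) (snd C ` (fst C \<inter> fst C'))"
    using CA_thick[OF y(2,4) u(2,4,5)] by (simp add: y u(1))
next
  fix C assume "C \<in> CA"
  then show "inj_on (snd C) (fst C)" "openin (atlas_top CA) (fst C)"
    using inj_cchart openin_cchart by (auto simp only: CA_eq)
qed

section \<open>Existence and uniqueness of the field on the pullback\<close>

lemma velocity_interval:
  assumes "u \<in> I"
  shows "velocity (interval_atlas I) I (\<lambda>s. s) u = (u, \<lambda>d. if d = (I, \<lambda>u. u) then 1 else 0)"
proof -
  have "vector_derivative (\<lambda>s. s) (at u within I) = (1 :: real)"
    using I_limit[OF assms] by (intro vector_derivative_within) (auto simp: trivial_limit_within intro!: derivative_eq_intros)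
  then show ?thesis using assms by (auto simp: velocity_def interval_atlas_def)
qed

text \<open>Written with \<open>fst (u, x)\<close> and \<open>snd (u, x)\<close> in order to match
  the description in \<open>Lam\<close> literally.\<close>

abbreviation is_Lam :: "real \<Rightarrow> 'x \<Rightarrow> (real \<times> 'x, real \<times> 'f) tvec \<Rightarrow> bool" where
  "is_Lam u x Z \<equiv> Z \<in> tspace CA (u, x) \<and>
     tmap CA (interval_atlas I) ctot fst Z = velocity (interval_atlas I) I (\<lambda>s. s) (fst (u, x)) \<and>
     tmap CA (bundle_atlas A B) ctot snd Z = h (snd (u, x), c (fst (u, x)))"

text \<open>Together the two projections read off the whole chart component of \<open>Z\<close>: the
  first gives its time part, the second its fibre part once the time part is known.\<close>

lemma tmap_CA:
  assumes u: "u \<in> I" "x \<in> fibre B (base u)" and Z: "Z \<in> tspace CA (u, x)"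
    and y: "y \<in> trivs B" "base u \<in> fst y"
  shows "snd (tmap CA (interval_atlas I) ctot fst Z) (I, \<lambda>u. u) = fst (snd Z (cchart y))"
    and "k \<in> A \<Longrightarrow> y' \<in> trivs B \<Longrightarrow> base u \<in> fst k \<Longrightarrow> base u \<in> fst y' \<Longrightarrow>
      (tr k y k y' has_derivative K) (at (snd k (base u), snd y x)) \<Longrightarrow>
      snd (tmap CA (bundle_atlas A B) ctot snd Z) (ch k y')
        = K (fst (snd Z (cchart y)) *\<^sub>R snd (\<rho> (c u)) k, snd (snd Z (cchart y)))"
proof -
  have C: "cchart y \<in> CA" "(u, x) \<in> fst (cchart y)" using y u by (auto simp: CA_eq)
  have S: "pts CA \<subseteq> ctot" by (simp add: pts_CA tot_curve_pb)
  show "snd (tmap CA (interval_atlas I) ctot fst Z) (I, \<lambda>u. u) = fst (snd Z (cchart y))"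
  proof (rule tmap_component[OF CA_regular Z S _ _ _ C])
    fix C assume "C \<in> CA" "(u, x) \<in> fst C"
    then obtain y' where y': "C = cchart y'" "y' \<in> trivs B" "base u \<in> fst y'" by (auto simp: CA_eq)
    then show "transition C (I, \<lambda>u. u) fst differentiable (at (snd C (u, x)) within snd C ` fst C)"
      using cchart_fst_transition[OF y'(2) u y'(3)] by (auto simp: differentiable_def)
  qed (use cchart_fst_transition[OF y(1) u y(2)] u in \<open>auto simp: interval_atlas_def\<close>)
  assume k: "k \<in> A" "y' \<in> trivs B" "base u \<in> fst k" "base u \<in> fst y'"
    and K: "(tr k y k y' has_derivative K) (at (snd k (base u), snd y x))"
  show "snd (tmap CA (bundle_atlas A B) ctot snd Z) (ch k y')
        = K (fst (snd Z (cchart y)) *\<^sub>R snd (\<rho> (c u)) k, snd (snd Z (cchart y)))"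
  proof (rule tmap_component[OF CA_regular Z S _ _ _ C])
    show "(transition (cchart y) (ch k y') snd has_derivative
        (\<lambda>v. K (fst v *\<^sub>R snd (\<rho> (c u)) k, snd v))) (at (snd (cchart y) (u, x)) within snd (cchart y) ` fst (cchart y))"
      using cchart_snd_transition[OF k(1) y(1) k(2) u k(3) y(2) k(4) K] by simp
    fix C assume "C \<in> CA" "(u, x) \<in> fst C"
    then obtain y1 where y1: "C = cchart y1" "y1 \<in> trivs B" "base u \<in> fst y1" by (auto simp: CA_eq)
    obtain K1 where K1: "(tr k y1 k y' has_derivative K1)
      (at (snd k (base u), snd y1 x))"
      using transition_B(2)[OF k(1,1) y1(2) k(2) u(2) k(3,3) y1(3) k(4)] by (auto simp: differentiable_def)
    show "transition C (ch k y') snd differentiable (at (snd C (u, x)) within snd C ` fst C)"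
      using cchart_snd_transition[OF k(1) y1(2) k(2) u k(3) y1(3) k(4) K1] by (auto simp: y1(1) differentiable_def)
  qed (use k u in \<open>auto simp: fibre_def intro: adapted_chart_in_bundle_atlas\<close>)
qed

lemma transition_self:
  assumes "k \<in> A" "y \<in> trivs B" "x \<in> fibre B m" "m \<in> fst k" "m \<in> fst y"
  shows "(tr k y k y has_derivative (\<lambda>v. v)) (at (snd k m, snd y x))"
proof -
  let ?C = "ch k y"
  have C: "?C \<in> bundle_atlas A B" using assms by (auto intro: adapted_chart_in_bundle_atlas)
  show ?thesis
  proof (rule has_derivative_transform_within_open[OF has_derivative_ident manifoldD(4)[OF man_B C C]])
    show "(snd k m, snd y x) \<in> snd ?C ` fst ?C" using assms by (auto simp: fibre_def intro!: image_eqI[of _ _ x])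
    fix q assume "q \<in> snd ?C ` fst ?C"
    then show "q = transition ?C ?C id q"
      using transition_apply[OF manifoldD(1)[OF man_B C C], of _ ?C id] by auto
  qed
qed

lemma is_Lam_component:
  assumes u: "u \<in> I" "x \<in> fibre B (base u)" and Z: "is_Lam u x Z"
    and k: "k \<in> A" "y \<in> trivs B" "base u \<in> fst k" "base u \<in> fst y"
  shows "snd Z (cchart y) = (1, hcomp k y u x)"
proof -
  have Z1: "Z \<in> tspace CA (u, x)" using Z by blast
  have 1: "fst (snd Z (cchart y)) = 1"
    using tmap_CA(1)[OF u Z1 k(2,4)] Z velocity_interval[OF u(1)] by simp
  have "snd (h (x, c u)) (ch k y) = (1 *\<^sub>R snd (\<rho> (c u)) k, snd (snd Z (cchart y)))"
    using tmap_CA(2)[OF u Z1 k(2,4) k(1,2,3,4) transition_self[OF k(1,2) u(2) k(3,4)]] Z 1 by simp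
  then have "hcomp k y u x = snd (snd Z (cchart y))" by simp
  with 1 show ?thesis by (simp add: prod_eq_iff)
qed

text \<open>The time part 1 contributes exactly the anchor of \<open>c u\<close>. This completes
  \<open>hcomp\<close> to the full component of \<open>h\<close>, whose transformation is
  known.\<close>

lemma hcomp_cchart_transition:
  assumes u: "u \<in> I" "x \<in> fibre B (base u)" and k: "k \<in> A" "base u \<in> fst k"
    and y: "y \<in> trivs B" "y' \<in> trivs B" "base u \<in> fst y" "base u \<in> fst y'"
  shows "frechet_derivative (transition (cchart y) (cchart y') id)
    (at (u, snd y x) within snd (cchart y) ` (fst (cchart y) \<inter> fst (cchart y'))) (1, hcomp k y u x) = (1, hcomp k y' u x)"
proof -
  obtain K where K: "(tr k y k y' has_derivative K)
      (at (snd k (base u), snd y x))"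
    using transition_B(2)[OF k(1,1) y(1,2) u(2) k(2,2) y(3,4)] by (auto simp: differentiable_def)
  show ?thesis
    unfolding frechet_derivative_within_eq[OF cchart_transition[OF k(1) y(1,2) u k(2) y(3,4) K] CA_thick[OF y(1,2) u(1) y(3,4)]]
    by (simp only: fst_conv snd_conv scaleR_one h_transition[OF u(1) k(1,1) y(1,2) u(2) k(2,2) y(3,4) K])
qed

lemma is_Lam_exists:
  assumes u: "u \<in> I" "x \<in> fibre B (base u)"
  shows "\<exists>Z. is_Lam u x Z"
proof -
  obtain k where k: "k \<in> A" "base u \<in> fst k" using base_pts[OF u(1)] by (auto simp: pts_def)
  \<comment> \<open>A chart of the pullback does not determine the trivialization it comes from, so
    one is selected. That the component is independent of the selection is the content of
    \<open>comp\<close> below.\<close>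
  define P where "P d y \<longleftrightarrow> y \<in> trivs B \<and> d = cchart y \<and> base u \<in> fst y" for d y
  define Z where "Z = ((u, x), \<lambda>d. if d \<in> CA \<and> (u, x) \<in> fst d then (1 :: real, hcomp k (SOME y. P d y) u x) else 0)"
  have some: "P d (SOME y. P d y)" if d: "d \<in> CA" "(u, x) \<in> fst d" for d
  proof -
    obtain y where y: "y \<in> trivs B" "d = cchart y" using d(1) unfolding CA_eq by blast
    then have "P d y" using d(2) by (auto simp: P_def)
    then have "\<exists>y. P d y" by blast
    then show ?thesis by (rule someI_ex)
  qed
  have trans: "(1 :: real, hcomp k (SOME y. P d y) u x) = frechet_derivative (transition b d id)
      (at (snd b (u, x)) within snd b ` (fst b \<inter> fst d)) (1, hcomp k (SOME y. P b y) u x)"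
    if "b \<in> CA" "d \<in> CA" "(u, x) \<in> fst b" "(u, x) \<in> fst d" for b d
  proof -
    define yb yd where "yb = (SOME y. P b y)" and "yd = (SOME y. P d y)"
    have "P b yb" "P d yd" unfolding yb_def yd_def using some that by blast+
    then have y: "yb \<in> trivs B" "yd \<in> trivs B" "base u \<in> fst yb" "base u \<in> fst yd" "b = cchart yb" "d = cchart yd"
      by (auto simp: P_def)
    show ?thesis
      unfolding yb_def[symmetric] yd_def[symmetric]
      using hcomp_cchart_transition[OF u k y(1-4)] by (simp add: y(5,6))
  qed
  have Z: "Z \<in> tspace CA (u, x)"
    unfolding tspace_def mem_Collect_eq
  proof (rule exI[of _ "snd Z"], intro conjI allI impI ballI)
    fix b d assume b: "b \<in> CA" "d \<in> CA" "(u, x) \<in> fst b \<inter> fst d"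
    then have "snd Z b = (1, hcomp k (SOME y. P b y) u x)" "snd Z d = (1, hcomp k (SOME y. P d y) u x)"
      by (simp_all add: Z_def)
    then show "snd Z d = frechet_derivative (transition b d id)
        (at (snd b (u, x)) within snd b ` (fst b \<inter> fst d)) (snd Z b)"
      using trans[of b d] b by (simp only: IntE) blast
  qed (auto simp: Z_def)
  have comp: "snd Z (cchart y) = (1, hcomp k y u x)" if y: "y \<in> trivs B" "base u \<in> fst y" for y
  proof -
    have C: "cchart y \<in> CA" "(u, x) \<in> fst (cchart y)" using u y by (auto simp: CA_eq)
    define y' where "y' = (SOME y'. P (cchart y) y')"
    have "P (cchart y) y'" unfolding y'_def by (rule some[OF C])
    then have y': "y' \<in> trivs B" "cchart y = cchart y'" "base u \<in> fst y'" unfolding P_def by blast+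
    have "snd Z (cchart y) = (1, hcomp k y' u x)" using C by (simp add: Z_def y'_def)
    \<comment> \<open>Both trivializations give the same chart, so the coordinate change between
      them is the identity; the transformation rule then says that their values of
      \<open>hcomp\<close> agree.\<close>
    moreover have "frechet_derivative (transition (cchart y) (cchart y) id)
        (at (snd (cchart y) (u, x)) within snd (cchart y) ` (fst (cchart y) \<inter> fst (cchart y))) = (\<lambda>v. v)"
    proof (rule frechet_derivative_within_eq)
      show "(transition (cchart y) (cchart y) id has_derivative (\<lambda>v. v))
        (at (snd (cchart y) (u, x)) within snd (cchart y) ` (fst (cchart y) \<inter> fst (cchart y)))"
      proof (rule has_derivative_transform[OF _ _ has_derivative_ident])
        show "snd (cchart y) (u, x) \<in> snd (cchart y) ` (fst (cchart y) \<inter> fst (cchart y))"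
          using C(2) by blast
      qed (use transition_apply[OF inj_cchart[OF y(1)], of _ "cchart y" id] in auto)
      show "thick (snd (cchart y) (u, x)) (snd (cchart y) ` (fst (cchart y) \<inter> fst (cchart y)))"
        using CA_thick[OF y(1,1) u(1) y(2,2)] by simp
    qed
    moreover have "frechet_derivative (transition (cchart y) (cchart y') id)
      (at (snd (cchart y) (u, x)) within snd (cchart y) ` (fst (cchart y) \<inter> fst (cchart y'))) (1, hcomp k y u x) = (1, hcomp k y' u x)"
      using hcomp_cchart_transition[OF u k y(1) y'(1) y(2) y'(3)] by simp
    ultimately show ?thesis by (simp only: y'(2)[symmetric])
  qed
  obtain y where y: "y \<in> trivs B" "base u \<in> fst y" using charts[OF u(1)] by metis
  have "tmap CA (interval_atlas I) ctot fst Z = velocity (interval_atlas I) I (\<lambda>s. s) u"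
    unfolding velocity_interval[OF u(1)]
  proof (rule prod_eqI)
    show "snd (tmap CA (interval_atlas I) ctot fst Z) = snd (u, \<lambda>d. if d = (I, \<lambda>u. u) then 1 else 0)"
    proof
      fix d
      show "snd (tmap CA (interval_atlas I) ctot fst Z) d = snd (u, \<lambda>d. if d = (I, \<lambda>u. u) then 1 else 0) d"
      proof (cases "d = (I, \<lambda>u. u)")
        case True
        then show ?thesis using tmap_CA(1)[OF u Z y] comp[OF y] by simp
      next
        case False
        then show ?thesis by (simp add: tmap_def interval_atlas_def)
      qed
    qed
  qed (simp add: Z_def)
  moreover have "tmap CA (bundle_atlas A B) ctot snd Z = h (x, c u)"
  proof (rule prod_eqI)
    note hT = h_tspace[OF u]
    show "fst (tmap CA (bundle_atlas A B) ctot snd Z) = fst (h (x, c u))"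
      using tspaceD(1)[OF hT] by (simp add: Z_def)
    show "snd (tmap CA (bundle_atlas A B) ctot snd Z) = snd (h (x, c u))"
    proof
      fix d
      show "snd (tmap CA (bundle_atlas A B) ctot snd Z) d = snd (h (x, c u)) d"
      proof (cases "d \<in> bundle_atlas A B \<and> x \<in> fst d")
        case True
        then obtain k' y' where d: "d = ch k' y'" "k' \<in> A" "y' \<in> trivs B" "base u \<in> fst k'" "base u \<in> fst y'"
          using u(2) by (auto simp: fibre_def elim!: bundle_atlasE)
        obtain K where K: "(tr k' y k' y' has_derivative K)
            (at (snd k' (base u), snd y x))"
          using transition_B(2)[OF d(2,2) y(1) d(3) u(2) d(4,4) y(2) d(5)] by (auto simp: differentiable_def)
        have "snd (tmap CA (bundle_atlas A B) ctot snd Z) d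
            = K (1 *\<^sub>R snd (\<rho> (c u)) k', hcomp k' y u x)"
          using tmap_CA(2)[OF u Z y d(2-5) K] comp[OF y] hcomp_base_chart[OF u(1) k(1) d(2) y(1) u(2) k(2) d(4) y(2)]
          by (simp only: d(1) fst_conv snd_conv)
        also have "\<dots> = (snd (\<rho> (c u)) k', hcomp k' y' u x)"
          using h_transition[OF u(1) d(2,2) y(1) d(3) u(2) d(4,4) y(2) d(5) K] by (simp only: scaleR_one)
        also have "\<dots> = snd (h (x, c u)) d"
          by (simp only: h_chart[OF u d(2-5), symmetric] d(1))
        finally show ?thesis .
      next
        case False
        then show ?thesis using tspaceD(2)[OF hT, of d] by (auto simp: tmap_def Z_def)
      qed
    qed
  qed
  ultimately show ?thesis using Z by (intro exI[of _ Z]) simp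
qed

lemma Lam:
  assumes u: "u \<in> I" "x \<in> fibre B (base u)"
  shows "Lam_c (u, x) \<in> tspace CA (u, x)"
    "k \<in> A \<Longrightarrow> y \<in> trivs B \<Longrightarrow> base u \<in> fst k \<Longrightarrow> base u \<in> fst y \<Longrightarrow>
      snd (Lam_c (u, x)) (cchart y) = (1, hcomp k y u x)"
proof -
  obtain Z where Z: "is_Lam u x Z" using is_Lam_exists[OF u] by blast
  have "Z' = Z" if Z': "is_Lam u x Z'" for Z'
  proof (rule tspace_eqI)
    show "Z' \<in> tspace CA (u, x)" "Z \<in> tspace CA (u, x)" using Z Z' by auto
    fix C assume "C \<in> CA" "(u, x) \<in> fst C"
    then obtain y where y: "C = cchart y" "y \<in> trivs B" "base u \<in> fst y" by (auto simp: CA_eq)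
    obtain k where k: "k \<in> A" "base u \<in> fst k" using base_pts[OF u(1)] by (auto simp: pts_def)
    show "snd Z' C = snd Z C"
      unfolding y(1) is_Lam_component[OF u Z k(1) y(2) k(2) y(3)] is_Lam_component[OF u Z' k(1) y(2) k(2) y(3)] ..
  qed
  then have "Lam_c (u, x) = Z" unfolding Lam_def using Z by (intro the_equality) blast+
  then show "Lam_c (u, x) \<in> tspace CA (u, x)"
    "k \<in> A \<Longrightarrow> y \<in> trivs B \<Longrightarrow> base u \<in> fst k \<Longrightarrow> base u \<in> fst y \<Longrightarrow>
      snd (Lam_c (u, x)) (cchart y) = (1, hcomp k y u x)"
    using Z is_Lam_component[OF u Z] by auto
qed

section \<open>Integral curves on the pullback compared with lifts\<close>

lemma coord_imp_curve_solves:
  assumes "coord J \<psi>"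
  shows "solves CA (\<lambda>_. ctot) (\<lambda>_. Lam_c) J (\<lambda>u. (u, \<psi> u))"
proof -
  note J = coordD(1,2)[OF assms] and fib = coordD(3)[OF assms] and der = coordD(4)[OF assms]
  have chart: "((\<lambda>s. snd (cchart y) (s, \<psi> s)) has_vector_derivative snd (Lam_c (u, \<psi> u)) (cchart y)) (at u within J)"
    if u: "u \<in> J" and y: "y \<in> trivs B" "base u \<in> fst y" for u y
  proof -
    have uI: "u \<in> I" using u J by blast
    obtain k where k: "k \<in> A" "base u \<in> fst k" using base_pts[OF uI] by (auto simp: pts_def)
    show ?thesis
      unfolding Lam(2)[OF uI fib[OF u] k(1) y(1) k(2) y(2)] snd_cchart fst_conv snd_conv
      by (intro has_vector_derivative_Pair der u k y has_vector_derivative_id)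
  qed
  have "continuous_map (top_of_set J) (atlas_top CA) (\<lambda>u. (u, \<psi> u))"
  proof (rule continuous_map_atlasI)
    fix u assume u: "u \<in> J"
    have uI: "u \<in> I" using u J by blast
    obtain y where y: "y \<in> trivs B" "base u \<in> fst y" using charts[OF uI] by metis
    have "eventually (\<lambda>s. base s \<in> fst y) (at u within J)"
      by (rule base_eventually[OF fibre_bundleD(4)[OF B y(1)] uI y(2) J(2)])
    moreover have "eventually (\<lambda>s. s \<in> J) (at u within J)" by (simp add: eventually_at_filter)
    ultimately have "eventually (\<lambda>s. (s, \<psi> s) \<in> fst (cchart y)) (at u within J)"
      by eventually_elim (use fib J in auto)
    moreover have "(u, \<psi> u) \<in> fst (cchart y)" using uI fib[OF u] y by simp
    moreover have "cchart y \<in> CA" using y by (simp add: CA_eq)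
    ultimately show "\<exists>C\<in>CA. (u, \<psi> u) \<in> fst C \<and> eventually (\<lambda>s. (s, \<psi> s) \<in> fst C) (at u within J) \<and>
        continuous (at u within J) (\<lambda>s. snd C (s, \<psi> s))"
      using has_vector_derivative_continuous[OF chart[OF u y]] by blast
  qed
  moreover have "(u, \<psi> u) \<in> ctot" "has_velocity CA J (\<lambda>u. (u, \<psi> u)) u (Lam_c (u, \<psi> u))"
    if u: "u \<in> J" for u
  proof -
    have uI: "u \<in> I" using u J by blast
    then show "(u, \<psi> u) \<in> ctot" using fib[OF u] by (simp add: tot_curve_pb)
    show "has_velocity CA J (\<lambda>u. (u, \<psi> u)) u (Lam_c (u, \<psi> u))"
      unfolding has_velocity_def
    proof (intro conjI ballI impI Lam(1) uI fib u)
      fix C assume C: "C \<in> CA" "(u, \<psi> u) \<in> fst C"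
      then obtain y where "C = cchart y" "y \<in> trivs B" unfolding CA_eq by blast
      with C show "((\<lambda>s. snd C (s, \<psi> s)) has_vector_derivative snd (Lam_c (u, \<psi> u)) C) (at u within J)"
        using chart[OF u, of y] by simp
    qed
  qed
  ultimately show ?thesis using J(1) by (simp add: solves_def)
qed

text \<open>The time component of an integral curve has derivative 1 and the value \<open>a\<close>
  at \<open>a\<close>, so it is the time itself. Only then does the fibre equation, read off at the
  time component, become the one for \<open>c u\<close>.\<close>

lemma curve_solves_imp_coord:
  assumes s: "solves CA (\<lambda>_. ctot) (\<lambda>_. Lam_c) J \<Psi>" and a: "a \<in> J" "fst (\<Psi> a) = a"
  shows "coord J (\<lambda>u. snd (\<Psi> u))" "\<And>u. u \<in> J \<Longrightarrow> fst (\<Psi> u) = u"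
proof -
  have J: "is_interval J" using s by (simp add: solves_def)
  have tot: "\<Psi> u \<in> ctot" and vel: "has_velocity CA J \<Psi> u (Lam_c (\<Psi> u))" if "u \<in> J" for u
    using s that by (simp_all add: solves_def)
  have *: "\<exists>k\<in>A. \<exists>y\<in>trivs B. base (fst (\<Psi> u)) \<in> fst k \<and> base (fst (\<Psi> u)) \<in> fst y \<and>
      ((\<lambda>s. (fst (\<Psi> s), snd y (snd (\<Psi> s)))) has_vector_derivative (1, hcomp k y (fst (\<Psi> u)) (snd (\<Psi> u)))) (at u within J)"
    if u: "u \<in> J" for u
  proof -
    obtain t x where t: "\<Psi> u = (t, x)" "t \<in> I" "x \<in> fibre B (base t)" using tot[OF u] by (auto simp: tot_curve_pb)
    obtain k y where k: "k \<in> A" "y \<in> trivs B" "base t \<in> fst k" "base t \<in> fst y" using charts[OF t(2)] .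
    have C: "cchart y \<in> CA" "\<Psi> u \<in> fst (cchart y)" using k t by (auto simp: CA_eq)
    have "((\<lambda>s. snd (cchart y) (\<Psi> s)) has_vector_derivative snd (Lam_c (\<Psi> u)) (cchart y)) (at u within J)"
      using vel[OF u] C unfolding has_velocity_def by blast
    then show ?thesis
      unfolding t(1) Lam(2)[OF t(2,3) k] snd_cchart fst_conv snd_conv using k by blast
  qed
  show f: "fst (\<Psi> u) = u" if u: "u \<in> J" for u
  proof -
    have "norm ((fst (\<Psi> u) - u) - (fst (\<Psi> a) - a)) \<le> 0 * \<bar>u - a\<bar>"
    proof (rule norm_diff_le_of_vector_derivative[of J])
      show "convex J" using J by (simp add: is_interval_convex_1)
      fix t assume "t \<in> J"
      from *[OF this] obtain k y where "((\<lambda>s. (fst (\<Psi> s), snd y (snd (\<Psi> s)))) has_vector_derivative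
          (1, hcomp k y (fst (\<Psi> t)) (snd (\<Psi> t)))) (at t within J)" by blast
      from has_vector_derivative_compose_has_derivative[OF this bounded_linear_imp_has_derivative[OF bounded_linear_fst]]
      have "((\<lambda>s. fst (\<Psi> s)) has_vector_derivative 1) (at t within J)" by simp
      from has_vector_derivative_diff[OF this has_vector_derivative_id]
      show "((\<lambda>s. fst (\<Psi> s) - s) has_vector_derivative 0) (at t within J)" by simp
    qed (use u a in auto)
    then show ?thesis using a(2) by simp
  qed
  show "coord J (\<lambda>u. snd (\<Psi> u))"
  proof (rule coordI[OF J])
    show JI: "J \<subseteq> I" using tot f by (force simp: tot_curve_pb)
    fix u assume u: "u \<in> J"
    show "snd (\<Psi> u) \<in> fibre B (base u)" using tot[OF u] f[OF u] by (auto simp: tot_curve_pb)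
    from *[OF u] obtain k y where k: "k \<in> A" "y \<in> trivs B" "base u \<in> fst k" "base u \<in> fst y"
      and d: "((\<lambda>s. (fst (\<Psi> s), snd y (snd (\<Psi> s)))) has_vector_derivative (1, hcomp k y u (snd (\<Psi> u)))) (at u within J)"
      unfolding f[OF u] by blast
    from has_vector_derivative_compose_has_derivative[OF d bounded_linear_imp_has_derivative[OF bounded_linear_snd]]
    show "\<exists>k\<in>A. \<exists>y\<in>trivs B. base u \<in> fst k \<and> base u \<in> fst y \<and>
        ((\<lambda>s. snd y (snd (\<Psi> s))) has_vector_derivative hcomp k y u (snd (\<Psi> u))) (at u within J)"
      using k by auto
  qed
qed


subsection \<open>The local ordinary differential equation\<close>

text \<open>\<open>G\<close> is \<open>hcomp\<close> in fibre coordinates, on a compact piece of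
  \<open>I\<close>. The number \<epsilon> records that this piece is a neighbourhood of
  \<open>t\<close> relative to \<open>I\<close>, also at an end point.\<close>

definition local_field :: "real \<Rightarrow> ('m, 'a) chart \<Rightarrow> 'm set \<times> ('x \<Rightarrow> 'f) \<Rightarrow> real \<Rightarrow> real \<Rightarrow> real
    \<Rightarrow> (real \<Rightarrow> 'f \<Rightarrow> 'f) \<Rightarrow> (real \<Rightarrow> 'f \<Rightarrow> 'f \<Rightarrow>\<^sub>L 'f) \<Rightarrow> bool" where
  "local_field t k y \<alpha> \<beta> \<epsilon> G DG \<longleftrightarrow> k \<in> A \<and> y \<in> trivs B \<and> t \<in> {\<alpha>..\<beta>} \<and> {\<alpha>..\<beta>} \<subseteq> I \<and> 0 < \<epsilon> \<and>
     (\<forall>s\<in>I. \<bar>s - t\<bar> < \<epsilon> \<longrightarrow> s \<in> {\<alpha>..\<beta>}) \<and> (\<forall>s\<in>{\<alpha>..\<beta>}. base s \<in> fst k \<and> base s \<in> fst y) \<and>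
     (\<forall>s\<in>{\<alpha>..\<beta>}. \<forall>x\<in>fibre B (base s). G s (snd y x) = hcomp k y s x) \<and>
     continuous_on ({\<alpha>..\<beta>} \<times> UNIV) (\<lambda>(s, q). G s q) \<and>
     continuous_on ({\<alpha>..\<beta>} \<times> UNIV) (\<lambda>(s, q). DG s q) \<and>
     (\<forall>s\<in>{\<alpha>..\<beta>}. \<forall>q. (G s has_derivative blinfun_apply (DG s q)) (at q))"

text \<open>In charts \<open>h\<close> is a smooth function \<open>H\<close> on an open set of
  coordinates for the base, the fibre and \<open>V\<close>. Along the curve only the fibre
  coordinate remains free, and time enters through the continuous path \<open>pt\<close>. Hence
  \<open>G\<close> is continuous, and so is its derivative in the fibre coordinate.\<close>

lemma local_field_exists:
  assumes t: "t \<in> I"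
  shows "\<exists>k y \<alpha> \<beta> \<epsilon> G DG. local_field t k y \<alpha> \<beta> \<epsilon> G DG"
proof -
  obtain k y where k: "k \<in> A" "y \<in> trivs B" "base t \<in> fst k" "base t \<in> fst y" using charts[OF t] .
  obtain z where z: "z \<in> trivs V" "base t \<in> fst z" using fibre_bundle_charts[OF Vb base_pts[OF t]] by metis
  let ?W = "fst k \<inter> fst y \<inter> fst z"
  have oW: "openin (atlas_top A) ?W"
    by (intro openin_Int manifold_openin_chart[OF A] fibre_bundleD(4)[OF B] fibre_bundleD(4)[OF Vb] k z)
  obtain U where U: "open U" "\<And>u. u \<in> I \<Longrightarrow> base u \<in> ?W \<longleftrightarrow> u \<in> U" using base_open[OF oW] by blast
  have "t \<in> U" using U(2)[OF t] k z by blast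
  obtain \<alpha> \<beta> \<epsilon> where ab: "t \<in> {\<alpha>..\<beta>}" "{\<alpha>..\<beta>} \<subseteq> I \<inter> U" "0 < \<epsilon>" "\<And>s. s \<in> I \<Longrightarrow> \<bar>s - t\<bar> < \<epsilon> \<Longrightarrow> s \<in> {\<alpha>..\<beta>}"
    using interval_neighbourhood[OF I(1) t U(1) \<open>t \<in> U\<close>] by blast
  have abI: "s \<in> I" and abW: "base s \<in> fst k" "base s \<in> fst y" "base s \<in> fst z" if "s \<in> {\<alpha>..\<beta>}" for s
    using that ab(2) U(2)[of s] by blast+
  let ?P = "pullback (tot B) (prj B) V"
  let ?zp = "({x \<in> tot B. prj B x \<in> fst z}, snd z \<circ> snd)"
  define C where "C = ch k y"
  define D where "D = adapted_chart ?P C ?zp"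
  define TD where "TD = ((\<Union>p\<in>fst C. tspace (bundle_atlas A B) p), (\<lambda>X :: ('x, 'a \<times> 'f) tvec. (snd C (fst X), snd X C)))"
  have C: "C \<in> bundle_atlas A B" unfolding C_def using k by (intro adapted_chart_in_bundle_atlas)
  have "?zp \<in> trivs ?P" using z by (auto simp: pullback_def pb_trivs_def)
  then have D: "D \<in> bundle_atlas (bundle_atlas A B) ?P" unfolding D_def using C by (intro adapted_chart_in_bundle_atlas)
  have TD: "TD \<in> tangent_atlas (bundle_atlas A B)" unfolding tangent_atlas_def TD_def using C by blast
  have fstD: "fst D = {(x, v). x \<in> tot B \<and> v \<in> fibre V (prj B x) \<and> prj B x \<in> ?W}"
    by (auto simp: D_def C_def pullback_def pb_tot_def fibre_def)
  have sndD: "snd D (x, v) = ((snd k (prj B x), snd y x), snd z v)" for x v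
    by (simp add: D_def C_def pullback_def)
  have bij: "\<And>m. m \<in> ?W \<Longrightarrow> inj_on (snd y) (fibre B m) \<and> inj_on (snd z) (fibre V m)"
    using fibre_bundleD(6)[OF B k(2)] fibre_bundleD(6)[OF Vb z(1)] by blast
  have injD: "inj_on (snd D) (fst D)"
  proof (rule inj_onI)
    fix p p' assume p: "p \<in> fst D" "p' \<in> fst D" "snd D p = snd D p'"
    obtain x v x' v' where xv: "p = (x, v)" "p' = (x', v')" by fastforce
    have m: "prj B x = prj B x'"
      using p manifoldD(1)[OF A k(1) k(1)] by (auto simp: xv fstD sndD dest: inj_onD)
    then have "x = x'" "v = v'"
      using p bij[of "prj B x"] by (auto simp: xv fstD sndD fibre_def dest: inj_onD)
    then show "p = p'" by (simp add: xv)
  qed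
  define H where "H = transition D TD h"
  define X where "X = (snd k ` ?W \<times> (UNIV :: 'f set)) \<times> (UNIV :: 'k set)"
  have hTD: "h p \<in> fst TD" if p: "p \<in> fst D" for p
  proof -
    obtain x v where xv: "p = (x, v)" "x \<in> tot B" "v \<in> fibre V (prj B x)" "prj B x \<in> ?W" using p by (auto simp: fstD)
    have "prj B x \<in> pts A" using xv(2) fibre_bundleD(1)[OF B] by blast
    then have "h (x, v) \<in> tspace (bundle_atlas A B) x"
      using conn xv unfolding connection_def fibre_def by blast
    then show ?thesis using xv by (auto simp: TD_def C_def)
  qed
  \<comment> \<open>Trivializations are onto the model fibres, so the coordinate expression of
    \<open>h\<close> is defined on a full product over an open set of base coordinates.\<close>
  have imX: "snd D ` {p \<in> fst D. h p \<in> fst TD} = X"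
  proof (intro equalityI subsetI)
    fix w assume "w \<in> X"
    then obtain m q l where w: "w = ((snd k m, q), l)" "m \<in> ?W" by (auto simp: X_def)
    obtain x where x: "x \<in> fibre B m" "snd y x = q"
      using fibre_bundleD(7)[OF B k(2), of m] w(2) by (metis IntE UNIV_I imageE)
    obtain v where v: "v \<in> fibre V m" "snd z v = l"
      using fibre_bundleD(7)[OF Vb z(1), of m] w(2) by (metis IntE UNIV_I imageE)
    have "(x, v) \<in> fst D" using x v w(2) by (auto simp: fstD fibre_def)
    then show "w \<in> snd D ` {p \<in> fst D. h p \<in> fst TD}"
      using hTD x v w(1) by (intro image_eqI[of _ _ "(x, v)"]) (auto simp: sndD fibre_def)
  qed (auto simp: X_def fstD sndD)
  have "snd k ` ?W = snd k ` (fst k \<inter> ?W)" by (rule arg_cong[of _ _ "image (snd k)"]) blast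
  then have oX: "open X"
    unfolding X_def using manifold_open_image[OF A k(1) oW] by (simp add: open_Times)
  have "smooth_on H X"
    using conn D TD unfolding connection_def smooth_map_def H_def imX[symmetric] by blast
  note H = smooth_on_open_C1[OF this oX] and Hcont = smooth_on_continuous_on[OF this]
  define pt where "pt s q = ((snd k (base s), q), snd z (c s))" for s and q :: 'f
  have ptX: "pt s q \<in> X" if "s \<in> {\<alpha>..\<beta>}" for s q
    using abW[OF that] by (auto simp: pt_def X_def)
  define G where "G s q = snd (snd (H (pt s q)))" for s q
  define H' where "H' p = frechet_derivative H (at p)" for p
  have Hder: "(H has_derivative H' p) (at p)" if "p \<in> X" for p
    unfolding H'_def using H(1)[OF that] frechet_derivative_works by blast
  have Gder: "(G s has_derivative (\<lambda>v. snd (snd (H' (pt s q) ((0, v), 0))))) (at q)" if "s \<in> {\<alpha>..\<beta>}" for s q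
  proof -
    have "((\<lambda>q. pt s q) has_derivative (\<lambda>v. ((0, v), 0))) (at q)"
      unfolding pt_def by (auto intro!: derivative_eq_intros)
    from has_derivative_compose[OF this Hder[OF ptX[OF that]]]
    have "((\<lambda>q. H (pt s q)) has_derivative (\<lambda>v. H' (pt s q) ((0, v), 0))) (at q)" .
    from has_derivative_snd[OF has_derivative_snd[OF this]] show ?thesis unfolding G_def .
  qed
  define DG where "DG s q = Blinfun (\<lambda>v. snd (snd (H' (pt s q) ((0, v), 0))))" for s q
  have DG: "blinfun_apply (DG s q) = (\<lambda>v. snd (snd (H' (pt s q) ((0, v), 0))))" if "s \<in> {\<alpha>..\<beta>}" for s q
    unfolding DG_def using has_derivative_bounded_linear[OF Gder[OF that]] by (rule bounded_linear_Blinfun_apply)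
  have kcont: "continuous_on {\<alpha>..\<beta>} (\<lambda>s. snd k (base s))"
    unfolding continuous_on_eq_continuous_within
  proof
    fix s assume s: "s \<in> {\<alpha>..\<beta>}"
    have "{\<alpha>..\<beta>} \<subseteq> I" using abI by blast
    then show "continuous (at s within {\<alpha>..\<beta>}) (\<lambda>s. snd k (base s))"
      using has_vector_derivative_continuous[OF has_vector_derivative_within_subset[OF base_derivative[OF k(1) abI[OF s] abW(1)[OF s]]]]
      by blast
  qed
  have zcont: "continuous_on {\<alpha>..\<beta>} (\<lambda>s. snd z (c s))"
  proof -
    let ?Z = "adapted_chart V k z" and ?J = "(I, \<lambda>u::real. u)"
    have Z: "?Z \<in> bundle_atlas A V" using k z by (intro adapted_chart_in_bundle_atlas)
    have "smooth_map (interval_atlas I) (bundle_atlas A V) c" using adm by (simp add: admissible_def)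
    then have "smooth_on (transition ?J ?Z c) (snd ?J ` {u \<in> fst ?J. c u \<in> fst ?Z})"
      using Z unfolding smooth_map_def interval_atlas_def by blast
    then have "continuous_on {u \<in> I. c u \<in> fst ?Z} (transition ?J ?Z c)"
      using smooth_on_continuous_on by fastforce
    moreover have "{\<alpha>..\<beta>} \<subseteq> {u \<in> I. c u \<in> fst ?Z}"
    proof
      fix s assume s: "s \<in> {\<alpha>..\<beta>}"
      show "s \<in> {u \<in> I. c u \<in> fst ?Z}" using abI[OF s] abW[OF s] c_tot[OF abI[OF s]] by simp
    qed
    ultimately have "continuous_on {\<alpha>..\<beta>} (transition ?J ?Z c)" by (rule continuous_on_subset)
    then have "continuous_on {\<alpha>..\<beta>} (\<lambda>s. snd (transition ?J ?Z c s))" by (rule continuous_on_snd)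
    then show ?thesis
    proof (rule continuous_on_cong[THEN iffD1, OF refl, rotated])
      fix s assume s: "s \<in> {\<alpha>..\<beta>}"
      show "snd (transition ?J ?Z c s) = snd z (c s)"
        using transition_apply[of ?J s ?Z c] abI[OF s] by simp
    qed
  qed
  have ptcont: "continuous_on ({\<alpha>..\<beta>} \<times> UNIV) (\<lambda>p. pt (fst p) (snd p))"
    unfolding pt_def
    by (intro continuous_intros continuous_on_compose2[OF kcont] continuous_on_compose2[OF zcont]) auto
  have ptim: "(\<lambda>p. pt (fst p) (snd p)) ` ({\<alpha>..\<beta>} \<times> UNIV) \<subseteq> X" using ptX by auto
  have "continuous_on ({\<alpha>..\<beta>} \<times> UNIV) (\<lambda>p. G (fst p) (snd p))"
    unfolding G_def by (intro continuous_on_snd continuous_on_compose2[OF Hcont ptcont ptim])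
  moreover have "continuous_on ({\<alpha>..\<beta>} \<times> UNIV) (\<lambda>p. DG (fst p) (snd p))"
  proof (rule continuous_on_blinfun_of_pointwise)
    show "finite_dim TYPE('f)" using man_B finite_dim_snd unfolding manifold_def by blast
    fix v
    have "continuous_on ({\<alpha>..\<beta>} \<times> UNIV) (\<lambda>p. snd (snd (H' (pt (fst p) (snd p)) ((0, v), 0))))"
      unfolding H'_def by (intro continuous_on_snd continuous_on_compose2[OF H(2) ptcont ptim])
    then show "continuous_on ({\<alpha>..\<beta>} \<times> UNIV) (\<lambda>p. blinfun_apply (DG (fst p) (snd p)) v)"
      by (rule continuous_on_cong[THEN iffD1, OF refl, rotated]) (use DG in auto)
  qed
  moreover have "G s (snd y x) = hcomp k y s x" if s: "s \<in> {\<alpha>..\<beta>}" and x: "x \<in> fibre B (base s)" for s x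
  proof -
    have p: "(x, c s) \<in> fst D" using x abW[OF s] c_fibre[OF abI[OF s]] by (auto simp: fstD fibre_def)
    have "H (snd D (x, c s)) = snd TD (h (x, c s))" unfolding H_def by (rule transition_apply[OF injD p])
    then show ?thesis using x by (simp add: G_def pt_def sndD TD_def C_def fibre_def)
  qed
  moreover have "(G s has_derivative blinfun_apply (DG s q)) (at q)" if "s \<in> {\<alpha>..\<beta>}" for s q
    unfolding DG[OF that] by (rule Gder[OF that])
  ultimately have "local_field t k y \<alpha> \<beta> \<epsilon> G DG"
    unfolding local_field_def split_beta using k ab(1,3,4) abI abW by blast
  then show ?thesis by blast
qed

lemma local_fieldD:
  assumes "local_field t k y \<alpha> \<beta> \<epsilon> G DG"
  shows "k \<in> A" "y \<in> trivs B" "t \<in> {\<alpha>..\<beta>}" "{\<alpha>..\<beta>} \<subseteq> I" "0 < \<epsilon>"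
    "s \<in> I \<Longrightarrow> \<bar>s - t\<bar> < \<epsilon> \<Longrightarrow> s \<in> {\<alpha>..\<beta>}" "s \<in> {\<alpha>..\<beta>} \<Longrightarrow> base s \<in> fst k" "s \<in> {\<alpha>..\<beta>} \<Longrightarrow> base s \<in> fst y"
    "s \<in> {\<alpha>..\<beta>} \<Longrightarrow> x \<in> fibre B (base s) \<Longrightarrow> G s (snd y x) = hcomp k y s x"
    "continuous_on ({\<alpha>..\<beta>} \<times> UNIV) (\<lambda>(s, q). G s q)" "continuous_on ({\<alpha>..\<beta>} \<times> UNIV) (\<lambda>(s, q). DG s q)"
    "\<forall>s\<in>{\<alpha>..\<beta>}. \<forall>q. (G s has_derivative blinfun_apply (DG s q)) (at q)"
  using assms unfolding local_field_def by blast+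

subsection \<open>Uniqueness\<close>

lemma coord_local_derivative:
  assumes "coord J \<psi>" "local_field t k y \<alpha> \<beta> \<epsilon> G DG" "s \<in> J" "s \<in> {\<alpha>..\<beta>}" "K \<subseteq> J"
  shows "((\<lambda>s. snd y (\<psi> s)) has_vector_derivative G s (snd y (\<psi> s))) (at s within K)"
  unfolding local_fieldD(9)[OF assms(2,4) coordD(3)[OF assms(1,3)]]
  by (rule has_vector_derivative_within_subset[OF coordD(4)[OF assms(1,3) local_fieldD(1,2,7,8)[OF assms(2)]] assms(5)])
    (rule assms(4))+

text \<open>Both curves lie over the same base curve and can be compared in one trivialization.
  Agreement spreads to nearby times by local uniqueness, disagreement by continuity, and
  connectedness does the rest.\<close>

lemma coord_unique_on:
  assumes \<psi>: "coord K \<psi>" "coord K \<psi>'" and a: "a \<in> K" "u \<in> K" "\<psi> a = \<psi>' a"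
  shows "\<psi> u = \<psi>' u"
proof (rule connected_induction_simple[of K a u "\<lambda>t. \<psi> t = \<psi>' t"])
  note K = coordD(1,2)[OF \<psi>(1)]
  show "connected K" using K(1) by (simp add: is_interval_connected)
  fix t assume t: "t \<in> K"
  have tI: "t \<in> I" using t K by blast
  obtain k y \<alpha> \<beta> \<epsilon> G DG where F: "local_field t k y \<alpha> \<beta> \<epsilon> G DG" using local_field_exists[OF tI] by blast
  note F' = local_fieldD[OF F]
  let ?p = "\<lambda>s. snd y (\<psi> s)" and ?q = "\<lambda>s. snd y (\<psi>' s)"
  have inj: "\<psi> s = \<psi>' s" if "s \<in> K" "s \<in> {\<alpha>..\<beta>}" "?p s = ?q s" for s
    using inj_onD[OF fibre_bundleD(6)[OF B F'(2) F'(8)[OF that(2)]]] that coordD(3)[OF \<psi>(1)] coordD(3)[OF \<psi>(2)] by blast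
  have "\<exists>d>0. \<forall>x\<in>K \<inter> ball t d. \<forall>z\<in>K \<inter> ball t d. \<psi> x = \<psi>' x \<longrightarrow> \<psi> z = \<psi>' z"
  proof (cases "\<psi> t = \<psi>' t")
    case True
    let ?J = "K \<inter> {\<alpha>..\<beta>}"
    have J: "is_interval ?J" "t \<in> ?J" "?J \<subseteq> {\<alpha>..\<beta>}"
      using K(1) is_interval_cc is_interval_Int t F'(3) by blast+
    obtain \<delta> where \<delta>: "0 < \<delta>" "\<And>s. s \<in> ?J \<Longrightarrow> \<bar>s - t\<bar> < \<delta> \<Longrightarrow> ?p s = ?q s"
    proof (rule ode_local_unique[OF J(2,1,3) F'(10,11,12), of ?p ?q])
      fix s assume "s \<in> ?J"
      then have s: "s \<in> K" "s \<in> {\<alpha>..\<beta>}" by blast+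
      show "(?p has_vector_derivative G s (?p s)) (at s within ?J)"
        "(?q has_vector_derivative G s (?q s)) (at s within ?J)"
        by (rule coord_local_derivative[OF \<psi>(1) F s] coord_local_derivative[OF \<psi>(2) F s]; blast)+
    qed (use True in auto)
    have "\<psi> z = \<psi>' z" if "z \<in> K \<inter> ball t (min \<delta> \<epsilon>)" for z
    proof -
      have z: "z \<in> K" "\<bar>z - t\<bar> < \<delta>" "\<bar>z - t\<bar> < \<epsilon>" using that by (auto simp: dist_real_def)
      then have "z \<in> {\<alpha>..\<beta>}" using F'(6) K by blast
      then show ?thesis using inj \<delta>(2) z by blast
    qed
    then show ?thesis using \<delta>(1) F'(5) by (intro exI[of _ "min \<delta> \<epsilon>"]) auto
  next
    case False
    then have ne: "?p t \<noteq> ?q t" using inj[OF t F'(3)] by blast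
    have c: "continuous (at t within K) (\<lambda>s. ?p s - ?q s)"
      using has_vector_derivative_continuous[OF coord_local_derivative[OF \<psi>(1) F t F'(3) subset_refl]]
        has_vector_derivative_continuous[OF coord_local_derivative[OF \<psi>(2) F t F'(3) subset_refl]]
      by (rule continuous_diff)
    then obtain d where d: "0 < d" "\<forall>s\<in>K. dist s t < d \<longrightarrow> dist (?p s - ?q s) (?p t - ?q t) < norm (?p t - ?q t)"
      unfolding continuous_within_eps_delta using ne by (metis right_minus_eq zero_less_norm_iff)
    have "\<psi> x \<noteq> \<psi>' x" if "x \<in> K \<inter> ball t d" for x
      using d(2)[rule_format, of x] that by (auto simp: dist_commute dist_norm)
    then show ?thesis using d(1) by blast
  qed
  then obtain d where d: "0 < d" "\<forall>x\<in>K \<inter> ball t d. \<forall>z\<in>K \<inter> ball t d. \<psi> x = \<psi>' x \<longrightarrow> \<psi> z = \<psi>' z" by blast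
  then show "\<exists>T. openin (top_of_set K) T \<and> t \<in> T \<and> (\<forall>x\<in>T. \<forall>z\<in>T. \<psi> x = \<psi>' x \<longrightarrow> \<psi> z = \<psi>' z)"
    using t by (intro exI[of _ "K \<inter> ball t d"]) (auto simp: openin_open_Int)
qed (use a in auto)

lemma coord_unique:
  assumes "coord J \<psi>" "coord J' \<psi>'" "a \<in> J" "a \<in> J'" "\<psi> a = \<psi>' a" "u \<in> J" "u \<in> J'"
  shows "\<psi> u = \<psi>' u"
proof -
  have K: "is_interval (J \<inter> J')" using coordD(1) assms(1,2) is_interval_Int by blast
  show ?thesis
    by (rule coord_unique_on[OF coord_subset[OF assms(1) _ K] coord_subset[OF assms(2) _ K]]) (use assms in auto)
qed

section \<open>Maximal lifts and maximal integral curves\<close>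

abbreviation dom :: "real \<Rightarrow> 'x \<Rightarrow> real set" where
  "dom a x \<equiv> hlift_dom A B V h I c a x"

abbreviation lft :: "real \<Rightarrow> 'x \<Rightarrow> real \<Rightarrow> 'x" where
  "lft a x u \<equiv> hlift A B V h I c a x u"

lemma dom_iff: "u \<in> dom a x \<longleftrightarrow> (\<exists>J \<psi>. coord J \<psi> \<and> a \<in> J \<and> \<psi> a = x \<and> u \<in> J)"
  by (simp add: hlift_dom_def sol_dom_def solves_iff_coord)

lemma domE:
  assumes "u \<in> dom a x"
  obtains J \<psi> where "coord J \<psi>" "a \<in> J" "\<psi> a = x" "u \<in> J"
  using assms dom_iff by blast

lemma lft_eq:
  assumes "coord J \<psi>" "a \<in> J" "\<psi> a = x" "u \<in> J"
  shows "lft a x u = \<psi> u"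
  unfolding hlift_def sol_def solves_iff_coord
proof (rule the_equality)
  show "\<exists>J \<psi>'. coord J \<psi>' \<and> a \<in> J \<and> \<psi>' a = x \<and> u \<in> J \<and> \<psi>' u = \<psi> u" using assms by blast
  fix q assume "\<exists>J \<psi>'. coord J \<psi>' \<and> a \<in> J \<and> \<psi>' a = x \<and> u \<in> J \<and> \<psi>' u = q"
  then show "q = \<psi> u" using coord_unique assms by metis
qed

lemma dom_subset: "u \<in> dom a x \<Longrightarrow> u \<in> I"
  using coordD(2) by (blast elim: domE)

lemma lft_fibre:
  assumes "u \<in> dom a x"
  shows "lft a x u \<in> fibre B (base u)"
proof -
  obtain J \<psi> where s: "coord J \<psi>" "a \<in> J" "\<psi> a = x" "u \<in> J" using assms by (rule domE)
  show ?thesis unfolding lft_eq[OF s] by (rule coordD(3)[OF s(1,4)])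
qed

text \<open>The predicate \<open>P\<close> makes one equivalence serve twice: for the domain, where
  it is always true, and for the value at \<open>u\<close>.\<close>

lemma curve_solution_iff:
  "(\<exists>\<Psi>. solves CA (\<lambda>_. ctot) (\<lambda>_. Lam_c) J \<Psi> \<and> a \<in> J \<and> \<Psi> a = (a, x) \<and> u \<in> J \<and> P (\<Psi> u))
    \<longleftrightarrow> (\<exists>\<psi>. coord J \<psi> \<and> a \<in> J \<and> \<psi> a = x \<and> u \<in> J \<and> P (u, \<psi> u))"
proof
  assume "\<exists>\<Psi>. solves CA (\<lambda>_. ctot) (\<lambda>_. Lam_c) J \<Psi> \<and> a \<in> J \<and> \<Psi> a = (a, x) \<and> u \<in> J \<and> P (\<Psi> u)"
  then obtain \<Psi> where s: "solves CA (\<lambda>_. ctot) (\<lambda>_. Lam_c) J \<Psi>"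
    and a: "a \<in> J" "\<Psi> a = (a, x)" "u \<in> J" "P (\<Psi> u)" by blast
  have f: "fst (\<Psi> a) = a" using a by simp
  have "\<Psi> u = (u, snd (\<Psi> u))" using curve_solves_imp_coord(2)[OF s a(1) f a(3)] by (metis prod.collapse)
  then have "P (u, snd (\<Psi> u))" using a(4) by metis
  then show "\<exists>\<psi>. coord J \<psi> \<and> a \<in> J \<and> \<psi> a = x \<and> u \<in> J \<and> P (u, \<psi> u)"
    using curve_solves_imp_coord(1)[OF s a(1) f] a by (intro exI[of _ "\<lambda>u. snd (\<Psi> u)"]) simp
next
  assume "\<exists>\<psi>. coord J \<psi> \<and> a \<in> J \<and> \<psi> a = x \<and> u \<in> J \<and> P (u, \<psi> u)"
  then obtain \<psi> where "coord J \<psi>" "a \<in> J" "\<psi> a = x" "u \<in> J" "P (u, \<psi> u)" by blast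
  then show "\<exists>\<Psi>. solves CA (\<lambda>_. ctot) (\<lambda>_. Lam_c) J \<Psi> \<and> a \<in> J \<and> \<Psi> a = (a, x) \<and> u \<in> J \<and> P (\<Psi> u)"
    using coord_imp_curve_solves by (intro exI[of _ "\<lambda>u. (u, \<psi> u)"]) simp
qed

lemma icurve_dom_eq: "icurve_dom A B V h I c a x = dom a x"
proof (rule set_eqI)
  fix u
  show "u \<in> icurve_dom A B V h I c a x \<longleftrightarrow> u \<in> dom a x"
    unfolding icurve_dom_def sol_dom_def mem_Collect_eq dom_iff
    using curve_solution_iff[of _ a x u "\<lambda>_. True"] by simp
qed

lemma icurve_eq:
  assumes "u \<in> dom a x"
  shows "icurve A B V h I c a x u = (u, lft a x u)"
proof -
  obtain J \<psi> where s: "coord J \<psi>" "a \<in> J" "\<psi> a = x" "u \<in> J" using assms by (rule domE)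
  show ?thesis
    unfolding icurve_def sol_def lft_eq[OF s]
  proof (rule the_equality)
    show "\<exists>J \<Psi>. solves CA (\<lambda>_. ctot) (\<lambda>_. Lam_c) J \<Psi> \<and> a \<in> J \<and> \<Psi> a = (a, x) \<and>
        u \<in> J \<and> \<Psi> u = (u, \<psi> u)"
      using curve_solution_iff[of J a x u "\<lambda>z. z = (u, \<psi> u)"] s by blast
    fix q assume "\<exists>J \<Psi>. solves CA (\<lambda>_. ctot) (\<lambda>_. Lam_c) J \<Psi> \<and> a \<in> J \<and> \<Psi> a = (a, x) \<and>
        u \<in> J \<and> \<Psi> u = q"
    then obtain J' \<psi>' where "coord J' \<psi>'" "a \<in> J'" "\<psi>' a = x" "u \<in> J'" "(u, \<psi>' u) = q"
      using curve_solution_iff[of _ a x u "\<lambda>z. z = q"] by blast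
    then show "q = (u, \<psi> u)" using coord_unique[OF s(1) \<open>coord J' \<psi>'\<close> s(2)] s by auto
  qed
qed


subsection \<open>Dependence on the initial value\<close>

text \<open>Closedness ensures that near a point of only one piece the union is just that piece. At
  a common point the derivatives within the two pieces combine; the curves agree on the whole
  overlap by uniqueness.\<close>

lemma coord_glue:
  assumes s: "coord J \<psi>" "coord J' \<psi>'" and cl: "closed J" "closed J'" and b: "b \<in> J" "b \<in> J'" "\<psi> b = \<psi>' b"
  shows "coord (J \<union> J') (\<lambda>t. if t \<in> J then \<psi> t else \<psi>' t)"
proof -
  let ?\<phi> = "\<lambda>t. if t \<in> J then \<psi> t else \<psi>' t"
  have eq: "?\<phi> t = \<psi>' t" if "t \<in> J'" for t using coord_unique[OF s b _ that] by simp
  note J = coordD(1,2)[OF s(1)] and J' = coordD(1,2)[OF s(2)]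
  show ?thesis
    unfolding coord_def
  proof (intro conjI ballI impI)
    show "is_interval (J \<union> J')"
      unfolding is_interval_connected_1 using J(1) J'(1) b by (intro connected_Un) (auto simp: is_interval_connected_1)
    show "J \<union> J' \<subseteq> I" using J J' by blast
    fix u assume u: "u \<in> J \<union> J'"
    show "?\<phi> u \<in> fibre B (base u)" using u coordD(3)[OF s(1)] coordD(3)[OF s(2)] by auto
    fix k y assume k: "k \<in> A" "y \<in> trivs B" "base u \<in> fst k" "base u \<in> fst y"
    have 1: "((\<lambda>s. snd y (?\<phi> s)) has_vector_derivative hcomp k y u (?\<phi> u)) (at u within J)" if uJ: "u \<in> J"
      using coordD(4)[OF s(1) uJ k] uJ by (simp add: has_vector_derivative_transform[OF uJ, of _ "\<lambda>s. snd y (\<psi> s)"])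
    have 2: "((\<lambda>s. snd y (?\<phi> s)) has_vector_derivative hcomp k y u (?\<phi> u)) (at u within J')" if uJ: "u \<in> J'"
      using coordD(4)[OF s(2) uJ k] unfolding eq[OF uJ]
      by (rule has_vector_derivative_transform[OF uJ, rotated]) (simp only: eq)
    have n1: "at u within J \<union> J' = at u within J" if "u \<notin> J'"
      by (rule at_within_nhd[of u "- J'"]) (use that cl in auto)
    have n2: "at u within J \<union> J' = at u within J'" if "u \<notin> J"
      by (rule at_within_nhd[of u "- J"]) (use that cl in auto)
    show "((\<lambda>s. snd y (?\<phi> s)) has_vector_derivative hcomp k y u (?\<phi> u)) (at u within J \<union> J')"
    proof (cases "u \<in> J"; cases "u \<in> J'")
      assume "u \<in> J" "u \<in> J'" then show ?thesis by (intro has_vector_derivative_Un 1 2)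
    next
      assume "u \<in> J" "u \<notin> J'" then show ?thesis using 1 n1 by simp
    next
      assume "u \<notin> J" "u \<in> J'" then show ?thesis using 2 n2 by simp
    qed (use u in blast)
  qed
qed

text \<open>The local flow on the model fibre is carried back to the bundle by the inverse
  trivialization, over the moving base point.\<close>

lemma local_flow:
  assumes t: "t \<in> I" and x: "x \<in> fibre B (base t)"
  shows "\<exists>y\<in>trivs B. \<exists>\<alpha> \<beta> \<epsilon> R \<Phi>. t \<in> {\<alpha>..\<beta>} \<and> {\<alpha>..\<beta>} \<subseteq> I \<and> 0 < \<epsilon> \<and> 0 < R \<and>
    (\<forall>s\<in>I. \<bar>s - t\<bar> < \<epsilon> \<longrightarrow> s \<in> {\<alpha>..\<beta>}) \<and> (\<forall>s\<in>{\<alpha>..\<beta>}. base s \<in> fst y) \<and>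
    (\<forall>s\<in>{\<alpha>..\<beta>}. \<forall>q\<in>ball (snd y x) R. \<Phi> s q s = q \<and> coord {\<alpha>..\<beta>} (\<lambda>r. tinv B y (base r) (\<Phi> s q r)) \<and>
      (\<forall>r\<in>{\<alpha>..\<beta>}. (\<lambda>q. \<Phi> s q r) differentiable (at q)))"
proof -
  obtain k y \<alpha>0 \<beta>0 \<epsilon>0 G DG where F: "local_field t k y \<alpha>0 \<beta>0 \<epsilon>0 G DG" using local_field_exists[OF t] by blast
  note F' = local_fieldD[OF F]
  show ?thesis
  proof (rule ode_local_flow[OF F'(3,10,11,12), of "snd y x"])
    fix \<alpha> \<beta> \<epsilon> R \<Phi>
    assume ab: "t \<in> {\<alpha>..\<beta>}" "{\<alpha>..\<beta>} \<subseteq> {\<alpha>0..\<beta>0}" and \<epsilon>: "0 < \<epsilon>"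
      and near: "\<And>s. s \<in> {\<alpha>0..\<beta>0} \<Longrightarrow> \<bar>s - t\<bar> < \<epsilon> \<Longrightarrow> s \<in> {\<alpha>..\<beta>}" and R: "0 < R"
      and \<Phi>0: "\<And>s q. s \<in> {\<alpha>..\<beta>} \<Longrightarrow> q \<in> ball (snd y x) R \<Longrightarrow> \<Phi> s q s = q"
      and \<Phi>d: "\<And>s q r. s \<in> {\<alpha>..\<beta>} \<Longrightarrow> q \<in> ball (snd y x) R \<Longrightarrow> r \<in> {\<alpha>..\<beta>} \<Longrightarrow>
         (\<Phi> s q has_vector_derivative G r (\<Phi> s q r)) (at r within {\<alpha>..\<beta>})"
      and \<Phi>diff: "\<And>s q r. s \<in> {\<alpha>..\<beta>} \<Longrightarrow> q \<in> ball (snd y x) R \<Longrightarrow> r \<in> {\<alpha>..\<beta>} \<Longrightarrow> (\<lambda>q. \<Phi> s q r) differentiable (at q)"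
    have sub: "s \<in> {\<alpha>0..\<beta>0}" if "s \<in> {\<alpha>..\<beta>}" for s using ab(2) that by blast
    have "coord {\<alpha>..\<beta>} (\<lambda>r. tinv B y (base r) (\<Phi> s q r))" if s: "s \<in> {\<alpha>..\<beta>}" "q \<in> ball (snd y x) R" for s q
    proof (rule coordI)
      show "is_interval {\<alpha>..\<beta>}" by (rule is_interval_cc)
      show "{\<alpha>..\<beta>} \<subseteq> I" using ab(2) F'(4) by blast
      fix r assume r: "r \<in> {\<alpha>..\<beta>}"
      show fib: "tinv B y (base r) (\<Phi> s q r) \<in> fibre B (base r)" by (rule tinv(1)[OF B F'(2) F'(8)[OF sub[OF r]]])
      have "((\<lambda>r. snd y (tinv B y (base r) (\<Phi> s q r))) has_vector_derivative G r (\<Phi> s q r)) (at r within {\<alpha>..\<beta>})"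
        by (rule has_vector_derivative_transform[OF r _ \<Phi>d[OF s r]]) (use tinv(2)[OF B F'(2) F'(8)] sub in blast)
      moreover have "G r (\<Phi> s q r) = hcomp k y r (tinv B y (base r) (\<Phi> s q r))"
        using F'(9)[OF sub[OF r] fib] tinv(2)[OF B F'(2) F'(8)[OF sub[OF r]]] by simp
      ultimately show "\<exists>k\<in>A. \<exists>y'\<in>trivs B. base r \<in> fst k \<and> base r \<in> fst y' \<and>
          ((\<lambda>r. snd y' (tinv B y (base r) (\<Phi> s q r))) has_vector_derivative
            hcomp k y' r (tinv B y (base r) (\<Phi> s q r))) (at r within {\<alpha>..\<beta>})"
        using F'(1,2) F'(7,8)[OF sub[OF r]] by auto
    qed
    note sol = this
    show ?thesis
    proof (rule bexI[OF _ F'(2)], rule exI[of _ \<alpha>], rule exI[of _ \<beta>], rule exI[of _ "min \<epsilon> \<epsilon>0"],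
        rule exI[of _ R], rule exI[of _ \<Phi>], intro conjI ballI impI)
      show "t \<in> {\<alpha>..\<beta>}" by (rule ab(1))
      show "{\<alpha>..\<beta>} \<subseteq> I" using ab(2) F'(4) by (rule subset_trans)
      show "0 < min \<epsilon> \<epsilon>0" using \<epsilon> F'(5) by simp
      show "0 < R" by (rule R)
      show "s \<in> {\<alpha>..\<beta>}" if "s \<in> I" "\<bar>s - t\<bar> < min \<epsilon> \<epsilon>0" for s
        by (rule near[OF F'(6)[OF that(1)]]) (use that(2) in linarith)+
      show "base s \<in> fst y" if "s \<in> {\<alpha>..\<beta>}" for s by (rule F'(8)[OF sub[OF that]])
      fix s q assume s: "s \<in> {\<alpha>..\<beta>}" "q \<in> ball (snd y x) R"
      show "\<Phi> s q s = q" by (rule \<Phi>0[OF s])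
      show "coord {\<alpha>..\<beta>} (\<lambda>r. tinv B y (base r) (\<Phi> s q r))" by (rule sol[OF s])
      show "(\<lambda>q. \<Phi> s q r) differentiable (at q)" if "r \<in> {\<alpha>..\<beta>}" for r by (rule \<Phi>diff[OF s that])
    qed
  qed
qed

text \<open>Openness of the flow domain at \<open>x\<close> and differentiability of the flow are
  kept together, since each step of the continuation needs both. The fibre over \<open>a\<close> is
  parametrized by the model fibre.\<close>

abbreviation flow_differentiable :: "real \<Rightarrow> 'x \<Rightarrow> real \<Rightarrow> bool" where
  "flow_differentiable a x u \<equiv> (\<forall>y\<in>trivs B. \<forall>y'\<in>trivs B. base a \<in> fst y \<longrightarrow> base u \<in> fst y' \<longrightarrow>
     eventually (\<lambda>q. u \<in> dom a (tinv B y (base a) q)) (nhds (snd y x)) \<and>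
     (\<lambda>q. snd y' (lft a (tinv B y (base a) q) u)) differentiable (at (snd y x)))"

text \<open>The flow to \<open>t2\<close> is the flow to \<open>t1\<close> followed by the local
  flow started at \<open>t1\<close>. In coordinates it is the composite of \<open>Q\<close>, the map
  \<open>\<Phi> _ t2\<close> and a change of trivialization in the fibre over
  \<open>t2\<close>.\<close>

lemma flow_differentiable_step:
  assumes a: "a \<in> I" and x: "x \<in> fibre B (base a)" and t1: "t1 \<in> dom a x"
    and fd: "flow_differentiable a x t1"
    and y1: "y1 \<in> trivs B" and ab: "{\<alpha>..\<beta>} \<subseteq> I" "t1 \<in> {\<alpha>..\<beta>}" "t2 \<in> {\<alpha>..\<beta>}"
      "\<And>s. s \<in> {\<alpha>..\<beta>} \<Longrightarrow> base s \<in> fst y1"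
    and U: "open U" "snd y1 (lft a x t1) \<in> U"
    and \<Phi>: "\<And>q. q \<in> U \<Longrightarrow> \<Phi> q t1 = q" "\<And>q. q \<in> U \<Longrightarrow> coord {\<alpha>..\<beta>} (\<lambda>r. tinv B y1 (base r) (\<Phi> q r))"
      "\<And>q. q \<in> U \<Longrightarrow> (\<lambda>q. \<Phi> q t2) differentiable (at q)"
  shows "flow_differentiable a x t2"
proof (intro ballI impI)
  fix y y' assume y: "y \<in> trivs B" "y' \<in> trivs B" "base a \<in> fst y" "base t2 \<in> fst y'"
  let ?e = "\<lambda>q. tinv B y (base a) q" and ?q0 = "snd y x"
  have e0: "?e ?q0 = x" by (rule tinv(3)[OF B y(1,3) x])
  define Q where "Q q = snd y1 (lft a (?e q) t1)" for q
  have ev1: "eventually (\<lambda>q. t1 \<in> dom a (?e q)) (nhds ?q0)" and Qd: "Q differentiable (at ?q0)"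
    using fd y y1 ab unfolding Q_def by blast+
  have Q0: "Q ?q0 \<in> U" using U(2) by (simp add: Q_def e0)
  have "isCont Q ?q0" using Qd by (rule differentiable_imp_continuous_within)
  then have "eventually (\<lambda>q. Q q \<in> U) (at ?q0)"
    unfolding isCont_def by (rule topological_tendstoD[OF _ U(1) Q0])
  then have ev2: "eventually (\<lambda>q. Q q \<in> U) (nhds ?q0)" using Q0 by (simp add: eventually_nhds_conv_at)
  have step: "t2 \<in> dom a (?e q) \<and> lft a (?e q) t2 = tinv B y1 (base t2) (\<Phi> (Q q) t2)"
    if q: "t1 \<in> dom a (?e q)" "Q q \<in> U" for q
  proof -
    obtain J \<psi> where s: "coord J \<psi>" "a \<in> J" "\<psi> a = ?e q" "t1 \<in> J" using q(1) by (rule domE)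
    \<comment> \<open>Only the compact piece between \<open>a\<close> and \<open>t1\<close> is kept,
      so that both pieces to be glued are closed. They may overlap in more than \<open>t1\<close>,
      for instance if \<open>t2\<close> lies between \<open>a\<close> and \<open>t1\<close>.\<close>
    let ?K = "closed_segment a t1" and ?\<psi>' = "\<lambda>r. tinv B y1 (base r) (\<Phi> (Q q) r)"
    have K: "coord ?K \<psi>"
    proof (rule coord_subset[OF s(1)])
      show "?K \<subseteq> J" using coordD(1)[OF s(1)] s(2,4) by (simp add: is_interval_convex_1 closed_segment_subset)
      show "is_interval ?K" by (simp add: is_interval_convex_1)
    qed
    have "?\<psi>' t1 = \<psi> t1"
      using \<Phi>(1)[OF q(2)] tinv(3)[OF B y1 ab(4)[OF ab(2)] coordD(3)[OF s(1,4)]]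
      by (simp add: Q_def lft_eq[OF s])
    from coord_glue[OF K \<Phi>(2)[OF q(2)] _ _ _ ab(2) this[symmetric]]
    have glued: "coord (?K \<union> {\<alpha>..\<beta>}) (\<lambda>t. if t \<in> ?K then \<psi> t else ?\<psi>' t)" by simp
    have "(if t2 \<in> ?K then \<psi> t2 else ?\<psi>' t2) = ?\<psi>' t2"
      using coord_unique[OF K \<Phi>(2)[OF q(2)] _ ab(2) \<open>?\<psi>' t1 = \<psi> t1\<close>[symmetric] _ ab(3)] by auto
    then have "lft a (?e q) t2 = ?\<psi>' t2" using lft_eq[OF glued, of a "?e q" t2] s(3) ab(3) by simp
    moreover have "t2 \<in> dom a (?e q)" unfolding dom_iff using glued s(3) ab(3) by (auto intro!: exI)
    ultimately show ?thesis by blast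
  qed
  show "eventually (\<lambda>q. t2 \<in> dom a (?e q)) (nhds ?q0) \<and>
      (\<lambda>q. snd y' (lft a (?e q) t2)) differentiable (at ?q0)"
  proof
    show "eventually (\<lambda>q. t2 \<in> dom a (?e q)) (nhds ?q0)"
      using ev1 ev2 by eventually_elim (use step in blast)
    have "((\<lambda>q. snd y' (tinv B y1 (base t2) q)) \<circ> ((\<lambda>q. \<Phi> q t2) \<circ> Q)) differentiable (at ?q0)"
      by (intro differentiable_chain_at Qd \<Phi>(3) Q0
          fibre_transition_differentiable[OF B y1 y(2) ab(4)[OF ab(3)] y(4)])
    then show "(\<lambda>q. snd y' (lft a (?e q) t2)) differentiable (at ?q0)"
      by (rule differentiable_transform_eventually) (use ev1 ev2 in \<open>eventually_elim, simp add: step\<close>)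
  qed
qed

text \<open>Induction along the solution. Near every time \<open>t\<close> there is a local flow
  with free starting time, so the property passes from any \<open>t1\<close> to any
  \<open>t2\<close> close to \<open>t\<close>, forwards or backwards.\<close>

theorem flow_differentiable:
  assumes a: "a \<in> I" and x: "x \<in> fibre B (base a)" and u: "u \<in> dom a x"
  shows "flow_differentiable a x u"
proof -
  obtain J \<psi> where s: "coord J \<psi>" "a \<in> J" "\<psi> a = x" "u \<in> J" using u by (rule domE)
  have lJ: "t \<in> dom a x" "lft a x t = \<psi> t" if "t \<in> J" for t
    using s that lft_eq[OF s(1-3) that] unfolding dom_iff by blast+
  show ?thesis
  proof (rule connected_induction_simple[of J a u "flow_differentiable a x"])
    show "connected J" using coordD(1)[OF s(1)] by (simp add: is_interval_connected)
    show "flow_differentiable a x a"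
    proof (intro ballI impI conjI)
      fix y y' assume y: "y \<in> trivs B" "y' \<in> trivs B" "base a \<in> fst y" "base a \<in> fst y'"
      have triv: "a \<in> dom a z \<and> lft a z a = z" if z: "z \<in> fibre B (base a)" for z
      proof -
        \<comment> \<open>The constant curve on the one-point interval is a lift, since every
          derivative condition at the trivial filter holds.\<close>
        have bot: "at a within {a} = bot" by (simp add: at_within_eq_bot_iff)
        have "coord {a} (\<lambda>_. z)"
          unfolding coord_def using a z
          by (auto simp: is_interval_connected_1 has_vector_derivative_def has_derivative_within bounded_linear_scaleR_left bot)
        then show ?thesis using lft_eq[of "{a}" "\<lambda>_. z" a z a] unfolding dom_iff by auto
      qed
      have fib: "tinv B y (base a) q \<in> fibre B (base a)" for q by (rule tinv(1)[OF B y(1,3)])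
      show "eventually (\<lambda>q. a \<in> dom a (tinv B y (base a) q)) (nhds (snd y x))"
        using triv fib by simp
      show "(\<lambda>q. snd y' (lft a (tinv B y (base a) q) a)) differentiable (at (snd y x))"
        using triv fib fibre_transition_differentiable[OF B y] by simp
    qed
    fix t assume t: "t \<in> J"
    have tI: "t \<in> I" using t coordD(2)[OF s(1)] by blast
    obtain y1 \<alpha> \<beta> \<epsilon> R \<Phi> where y1: "y1 \<in> trivs B" and ab: "t \<in> {\<alpha>..\<beta>}" "{\<alpha>..\<beta>} \<subseteq> I" "0 < \<epsilon>" "0 < R"
      and near: "\<forall>s\<in>I. \<bar>s - t\<bar> < \<epsilon> \<longrightarrow> s \<in> {\<alpha>..\<beta>}" and dom: "\<forall>s\<in>{\<alpha>..\<beta>}. base s \<in> fst y1"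
      and \<Phi>: "\<forall>s\<in>{\<alpha>..\<beta>}. \<forall>q\<in>ball (snd y1 (\<psi> t)) R. \<Phi> s q s = q \<and> coord {\<alpha>..\<beta>} (\<lambda>r. tinv B y1 (base r) (\<Phi> s q r)) \<and>
        (\<forall>r\<in>{\<alpha>..\<beta>}. (\<lambda>q. \<Phi> s q r) differentiable (at q))"
      using local_flow[OF tI coordD(3)[OF s(1) t]] by blast
    obtain k where k: "k \<in> A" "base t \<in> fst k" using base_pts[OF tI] by (auto simp: pts_def)
    have "continuous (at t within J) (\<lambda>s. snd y1 (\<psi> s))"
      using has_vector_derivative_continuous[OF coordD(4)[OF s(1) t k(1) y1 k(2)]] dom ab(1) by blast
    then obtain d where d: "0 < d" "\<forall>s\<in>J. dist s t < d \<longrightarrow> dist (snd y1 (\<psi> s)) (snd y1 (\<psi> t)) < R"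
      unfolding continuous_within_eps_delta using ab(4) by blast
    \<comment> \<open>The times at which the solution stays within reach of the local flow: in its
      time interval and in its ball of initial values.\<close>
    let ?T = "J \<inter> ball t (min d \<epsilon>)"
    have inT: "r \<in> J" "r \<in> {\<alpha>..\<beta>}" "snd y1 (\<psi> r) \<in> ball (snd y1 (\<psi> t)) R" if "r \<in> ?T" for r
    proof -
      show "r \<in> J" using that by blast
      have "dist r t < d" "\<bar>r - t\<bar> < \<epsilon>" using that by (auto simp: dist_real_def)
      then show "r \<in> {\<alpha>..\<beta>}" "snd y1 (\<psi> r) \<in> ball (snd y1 (\<psi> t)) R"
        using near d(2) \<open>r \<in> J\<close> coordD(2)[OF s(1)] by (auto simp: dist_commute)
    qed
    have "flow_differentiable a x t2" if T: "t1 \<in> ?T" "t2 \<in> ?T" "flow_differentiable a x t1" for t1 t2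
    proof (rule flow_differentiable_step[OF a x lJ(1)[OF inT(1)[OF T(1)]] T(3) y1 ab(2) inT(2)[OF T(1)] inT(2)[OF T(2)]])
      show "open (ball (snd y1 (\<psi> t)) R)" by simp
      show "snd y1 (lft a x t1) \<in> ball (snd y1 (\<psi> t)) R" using inT(3)[OF T(1)] lJ(2)[OF inT(1)[OF T(1)]] by simp
      show "\<And>q. q \<in> ball (snd y1 (\<psi> t)) R \<Longrightarrow> \<Phi> t1 q t1 = q"
        "\<And>q. q \<in> ball (snd y1 (\<psi> t)) R \<Longrightarrow> coord {\<alpha>..\<beta>} (\<lambda>r. tinv B y1 (base r) (\<Phi> t1 q r))"
        "\<And>q. q \<in> ball (snd y1 (\<psi> t)) R \<Longrightarrow> (\<lambda>q. \<Phi> t1 q t2) differentiable (at q)"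
        using \<Phi> inT(2)[OF T(1)] inT(2)[OF T(2)] by blast+
    qed (use dom in blast)
    then show "\<exists>T. openin (top_of_set J) T \<and> t \<in> T \<and>
        (\<forall>t1\<in>T. \<forall>t2\<in>T. flow_differentiable a x t1 \<longrightarrow> flow_differentiable a x t2)"
      using t d(1) ab(3) by (intro exI[of _ ?T]) (auto simp: openin_open_Int)
  qed (use s in auto)
qed

end

section \<open>Lie transport of vertical vectors\<close>

lemma velocity_cong:
  fixes A :: "('x, 'a::real_normed_vector) atlas" and f g :: "real \<Rightarrow> 'x"
  assumes "eventually (\<lambda>t. f t = g t) (nhds 0)"
  shows "velocity A UNIV f 0 = velocity A UNIV g 0"
proof -
  have 0: "f 0 = g 0" using assms eventually_nhds_x_imp_x by blast
  have "vector_derivative (\<lambda>t. snd d (f t)) (at 0) = vector_derivative (\<lambda>t. snd d (g t)) (at 0)" for d :: "('x, 'a) chart"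
    by (rule vector_derivative_cong_eq) (use assms in \<open>auto elim: eventually_mono\<close>)
  note eq = this
  show ?thesis unfolding velocity_def 0 eq ..
qed

text \<open>An affine trivialization makes the line straight, with direction \<open>z w\<close>.
  Here \<open>z\<close> is homogeneous because it may be adjoined to the trivializations of the
  model bundle. Injectivity on the fibre gives the value at 0.\<close>

lemma act_line:
  assumes E: "affine_bundle A E Eb" and e: "e \<in> fibre E m" and w: "w \<in> fibre Eb m" and m: "m \<in> pts A"
  shows "act E e (vscale Eb t w) \<in> fibre E m" "act E e (vscale Eb 0 w) = e"
    "y \<in> trivs E \<Longrightarrow> m \<in> fst y \<Longrightarrow> \<exists>d. \<forall>t. snd y (act E e (vscale Eb t w)) = snd y e + t *\<^sub>R d"
proof -
  have Eb: "vector_bundle A Eb" and fE: "fibre_bundle A E" using E by (auto simp: affine_bundle_def)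
  have tw: "vscale Eb t w \<in> fibre Eb m" for t using Eb m w unfolding vector_bundle_def by blast
  show act: "act E e (vscale Eb t w) \<in> fibre E m" for t using E m e tw unfolding affine_bundle_def by blast
  show line: "\<exists>d. \<forall>t. snd y (act E e (vscale Eb t w)) = snd y e + t *\<^sub>R d" if y: "y \<in> trivs E" "m \<in> fst y" for y
  proof -
    obtain z where z: "vector_bundle A (Eb\<lparr>trivs := insert (fst y, z) (trivs Eb)\<rparr>)"
      "\<forall>m\<in>fst y. \<forall>e\<in>fibre E m. \<forall>w\<in>fibre Eb m. snd y (act E e w) = snd y e + z w"
      using E y unfolding affine_bundle_def by blast
    have "z (vscale Eb t w) = t *\<^sub>R z w" for t
      using z(1) w y(2) unfolding vector_bundle_def fibre_def by auto
    then have "\<forall>t. snd y (act E e (vscale Eb t w)) = snd y e + t *\<^sub>R z w" using z(2) y(2) e tw by simp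
    then show ?thesis by blast
  qed
  obtain k y where "y \<in> trivs E" "m \<in> fst y" using fibre_bundle_charts[OF fE m] by metis
  then show "act E e (vscale Eb 0 w) = e"
    using line[of y] inj_onD[OF fibre_bundleD(6)[OF fE, of y m]] act e by fastforce
qed

locale affine_lifted_curve = lifted_curve A E V \<rho> h c I
  for A :: "('m, 'a::banach) atlas"
    and E :: "('e, 'm, 'f::banach, 'w) abundle"
    and V :: "('v, 'm, 'k::banach) vbundle"
    and \<rho> h c I +
  fixes Eb :: "('w, 'm, 'f) vbundle"
  assumes aff: "affine_bundle A E Eb"
begin

lemma apullback_atlas: "bundle_atlas (interval_atlas I) (apullback I (prj V \<circ> c) E) = CA"
  by (simp add: bundle_atlas_def adapted_chart_def apullback_def pullback_def)

lemma vlift_apullback: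
  "vlift (interval_atlas I) (apullback I (prj V \<circ> c) E) (vpullback I (prj V \<circ> c) Eb) (s, x) (s, w)
    = velocity CA UNIV (\<lambda>t. (s, act E x (vscale Eb t w))) 0"
  by (simp add: vlift_def apullback_atlas) (simp add: apullback_def vpullback_def)

section \<open>The translates as velocities of transported lines\<close>

context
  fixes a u :: real and e :: 'e and w :: 'w
  assumes a: "a \<in> I" and e: "e \<in> fibre E (base a)" and w: "w \<in> fibre Eb (base a)" and u: "u \<in> dom a e"
begin

private abbreviation line :: "real \<Rightarrow> 'e" where
  "line t \<equiv> act E e (vscale Eb t w)"

lemmas line_fibre = act_line(1)[OF aff e w base_pts[OF a]]
lemmas line_0 = act_line(2)[OF aff e w base_pts[OF a]]
lemmas line_chart = act_line(3)[OF aff e w base_pts[OF a]]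

lemma line_tendsto:
  assumes "y \<in> trivs E" "base a \<in> fst y"
  shows "filterlim (\<lambda>t. snd y (line t)) (nhds (snd y e)) (nhds 0)"
proof -
  obtain d where d: "\<forall>t. snd y (line t) = snd y e + t *\<^sub>R d" using line_chart[OF assms] by blast
  have "isCont (\<lambda>t. snd y e + t *\<^sub>R d) 0" by (intro continuous_intros)
  then have "filterlim (\<lambda>t. snd y e + t *\<^sub>R d) (nhds (snd y e)) (nhds 0)"
    using tendsto_at_iff_tendsto_nhds[of "\<lambda>t. snd y e + t *\<^sub>R d" 0] by (simp add: isCont_def)
  then show ?thesis using d by simp
qed

text \<open>The flow domain is a neighbourhood of \<open>e\<close> in its fibre, and the line is
  continuous in a trivialization.\<close>

lemma line_dom: "eventually (\<lambda>t. u \<in> dom a (line t)) (nhds 0)"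
proof -
  obtain y where y: "y \<in> trivs E" "base a \<in> fst y" using charts[OF a] by metis
  obtain y' where y': "y' \<in> trivs E" "base u \<in> fst y'" using charts[OF dom_subset[OF u]] by metis
  have "eventually (\<lambda>q. u \<in> dom a (tinv E y (base a) q)) (nhds (snd y e))"
    using flow_differentiable[OF a e u] y y' by blast
  from eventually_compose_filterlim[OF this line_tendsto[OF y]] show ?thesis
    using tinv(3)[OF B y line_fibre] by simp
qed

lemma flow_line_differentiable:
  assumes y': "y' \<in> trivs E" "base u \<in> fst y'"
  shows "(\<lambda>t. snd y' (lft a (line t) u)) differentiable (at 0)"
proof -
  obtain y where y: "y \<in> trivs E" "base a \<in> fst y" using charts[OF a] by metis
  obtain d where d: "\<forall>t. snd y (line t) = snd y e + t *\<^sub>R d" using line_chart[OF y] by blast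
  have "(\<lambda>q. snd y' (lft a (tinv E y (base a) q) u)) differentiable (at (snd y e + 0 *\<^sub>R d))"
    using flow_differentiable[OF a e u] y y' by simp
  then have "((\<lambda>q. snd y' (lft a (tinv E y (base a) q) u)) \<circ> (\<lambda>t. snd y e + t *\<^sub>R d)) differentiable (at 0)"
    by (intro differentiable_chain_at) simp_all
  moreover have "tinv E y (base a) (snd y e + t *\<^sub>R d) = line t" for t
    using tinv(3)[OF B y line_fibre, of t] d by simp
  ultimately show ?thesis by (simp add: o_def)
qed

lemma lie_Y_eq:
  "lie_Y A E Eb V h I c a e w u = velocity (bundle_atlas A E) UNIV (\<lambda>t. lft a (line t) u) 0"
proof -
  let ?S = "hflow_dom A E V h I c u a"
  have S: "x \<in> ?S \<longleftrightarrow> x \<in> fibre E (base a) \<and> u \<in> dom a x" for x by (simp add: hflow_dom_def)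
  have "tmap (bundle_atlas A E) (bundle_atlas A E) ?S (hflow A E V h I c u a) (velocity (bundle_atlas A E) UNIV line 0)
    = velocity (bundle_atlas A E) UNIV (\<lambda>t. hflow A E V h I c u a (line t)) 0"
  proof (rule tmap_velocity)
    show "line 0 \<in> pts (bundle_atlas A E)" using line_fibre by (simp add: pts_bundle_atlas[OF B] fibre_def)
    fix C assume C: "C \<in> bundle_atlas A E" "line 0 \<in> fst C"
    then obtain k y where y: "C = ch k y" "k \<in> A" "y \<in> trivs E" "base a \<in> fst k" "base a \<in> fst y"
      using e by (auto simp: line_0 fibre_def elim!: bundle_atlasE)
    obtain d where d: "\<forall>t. snd y (line t) = snd y e + t *\<^sub>R d" using line_chart[OF y(3,5)] by blast
    have "snd C (line t) = (snd k (base a), snd y e + t *\<^sub>R d)" for t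
      using line_fibre[of t] d by (simp add: y(1) fibre_def)
    moreover have "((\<lambda>t. (snd k (base a), snd y e + t *\<^sub>R d)) has_derivative (\<lambda>t. (0, t *\<^sub>R d))) (at 0)"
      by (auto intro!: derivative_eq_intros)
    ultimately show "(\<lambda>t. snd C (line t)) differentiable (at 0)" by (auto simp: differentiable_def)
    show "eventually (\<lambda>t. line t \<in> fst C \<inter> ?S) (nhds 0)"
      using line_dom by eventually_elim (use line_fibre y S in \<open>auto simp: fibre_def\<close>)
    fix D assume D: "D \<in> bundle_atlas A E" "hflow A E V h I c u a (line 0) \<in> fst D"
    have fu: "hflow A E V h I c u a e = lft a e u" by (simp add: hflow_def)
    obtain k' y' where y': "D = ch k' y'" "k' \<in> A" "y' \<in> trivs E" "base u \<in> fst k'" "base u \<in> fst y'"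
      using D lft_fibre[OF u] by (auto simp: line_0 fu fibre_def elim!: bundle_atlasE)
    let ?g = "\<lambda>q. snd y' (lft a (tinv E y (base a) q) u)"
    obtain K where K: "(?g has_derivative K) (at (snd y e))"
      using flow_differentiable[OF a e u] y y' unfolding differentiable_def by blast
    \<comment> \<open>On the fibre the base coordinate is constant, so it leaves the derivative
      undetermined in that direction; ignoring the base coordinate of \<open>v\<close> is one
      admissible choice.\<close>
    have "(transition C D (hflow A E V h I c u a) has_derivative (\<lambda>v. (0, K (snd v))))
      (at (snd C (line 0)) within snd C ` (fst C \<inter> ?S))"
    proof (rule transition_has_derivativeI[OF C(1) manifoldD(1)[OF man_B C(1,1)] openin_topspace C(2)])
      show "line 0 \<in> topspace (atlas_top (bundle_atlas A E))" "line 0 \<in> ?S"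
        using e u by (auto simp: line_0 S pts_bundle_atlas[OF B] fibre_def)
      have "((\<lambda>v. ?g (snd v)) has_derivative (\<lambda>v. K (snd v))) (at (snd C e))"
        by (rule has_derivative_compose[OF bounded_linear_imp_has_derivative[OF bounded_linear_snd]])
          (use K in \<open>simp only: y(1) snd_adapted_chart snd_conv\<close>)
      from has_derivative_Pair[OF has_derivative_const this]
      show "((\<lambda>v. (snd k' (base u), ?g (snd v))) has_derivative (\<lambda>v. (0, K (snd v))))
          (at (snd C (line 0)) within snd C ` (fst C \<inter> ?S \<inter> topspace (atlas_top (bundle_atlas A E))))"
        unfolding line_0 by (rule has_derivative_at_withinI)
      fix x assume x: "x \<in> ?S"
      then show "snd D (hflow A E V h I c u a x) = (snd k' (base u), ?g (snd (snd C x)))"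
        using tinv(3)[OF B y(3,5), of x] lft_fibre[of u a x] by (simp add: S y(1) y'(1) hflow_def fibre_def)
    qed
    then show "transition C D (hflow A E V h I c u a) differentiable (at (snd C (line 0)) within snd C ` (fst C \<inter> ?S))"
      by (auto simp: differentiable_def)
  qed (use manifoldD(1)[OF man_B] in blast)
  then show ?thesis by (simp add: lie_Y_def vlift_def hflow_def)
qed

lemma lie_Ups_eq:
  "lie_Ups A E Eb V h I c a e w u = velocity CA UNIV (\<lambda>t. (u, lft a (line t) u)) 0"
proof -
  let ?S = "Lam_flow_dom A E V h I c u a" and ?F = "Lam_flow A E V h I c u a"
  have S: "p \<in> ?S \<longleftrightarrow> fst p = a \<and> snd p \<in> fibre E (base a) \<and> u \<in> dom a (snd p)" for p
    using a by (cases p) (auto simp: Lam_flow_dom_def fibre_curve_pb icurve_dom_eq)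
  have F: "?F p = (u, lft a (snd p) u)" if "u \<in> dom a (snd p)" for p
    using icurve_eq[OF that] by (simp add: Lam_flow_def)
  have "tmap CA CA ?S ?F (velocity CA UNIV (\<lambda>t. (a, line t)) 0) = velocity CA UNIV (\<lambda>t. ?F (a, line t)) 0"
  proof (rule tmap_velocity)
    show "(a, line 0) \<in> pts CA" using line_fibre a by (simp add: pts_CA)
    fix C assume C: "C \<in> CA" "(a, line 0) \<in> fst C"
    then obtain y where y: "C = cchart y" "y \<in> trivs E" "base a \<in> fst y" by (auto simp: CA_eq)
    obtain d where d: "\<forall>t. snd y (line t) = snd y e + t *\<^sub>R d" using line_chart[OF y(2,3)] by blast
    have "((\<lambda>t. (a, snd y e + t *\<^sub>R d)) has_derivative (\<lambda>t. (0, t *\<^sub>R d))) (at 0)"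
      by (auto intro!: derivative_eq_intros)
    then show "(\<lambda>t. snd C (a, line t)) differentiable (at 0)" using d by (auto simp: y(1) differentiable_def)
    show "eventually (\<lambda>t. (a, line t) \<in> fst C \<inter> ?S) (nhds 0)"
      using line_dom by eventually_elim (use line_fibre y S a in auto)
    fix D assume D: "D \<in> CA" "?F (a, line 0) \<in> fst D"
    then obtain y' where y': "D = cchart y'" "y' \<in> trivs E" "base u \<in> fst y'"
      using u by (auto simp: CA_eq F line_0)
    let ?g = "\<lambda>q. snd y' (lft a (tinv E y (base a) q) u)"
    obtain K where K: "(?g has_derivative K) (at (snd y e))"
      using flow_differentiable[OF a e u] y y' unfolding differentiable_def by blast
    have "(transition C D ?F has_derivative (\<lambda>v. (0, K (snd v)))) (at (snd C (a, line 0)) within snd C ` (fst C \<inter> ?S))"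
    proof (rule transition_has_derivativeI[OF C(1) regular_atlasD(1)[OF CA_regular C(1)] openin_topspace C(2)])
      show "(a, line 0) \<in> topspace (atlas_top CA)" "(a, line 0) \<in> ?S"
        using a e u by (auto simp: line_0 S pts_CA)
      have "((\<lambda>v. ?g (snd v)) has_derivative (\<lambda>v. K (snd v))) (at (snd C (a, e)))"
        by (rule has_derivative_compose[OF bounded_linear_imp_has_derivative[OF bounded_linear_snd]])
          (use K in \<open>simp only: y(1) snd_cchart snd_conv\<close>)
      from has_derivative_Pair[OF has_derivative_const this]
      show "((\<lambda>v. (u, ?g (snd v))) has_derivative (\<lambda>v. (0, K (snd v))))
          (at (snd C (a, line 0)) within snd C ` (fst C \<inter> ?S \<inter> topspace (atlas_top CA)))"
        unfolding line_0 by (rule has_derivative_at_withinI)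
      fix p assume p: "p \<in> ?S"
      then show "snd D (?F p) = (u, ?g (snd (snd C p)))"
        using tinv(3)[OF B y(2,3), of "snd p"] by (simp add: S y(1) y'(1) F)
    qed
    then show "transition C D ?F differentiable (at (snd C (a, line 0)) within snd C ` (fst C \<inter> ?S))"
      by (auto simp: differentiable_def)
  qed (use regular_atlasD(1)[OF CA_regular] in blast)
  \<comment> \<open>The integral curves are identified with lifts only inside the flow domain, that
    is, for small \<open>t\<close>; the velocity at 0 sees no more.\<close>
  moreover have "velocity CA UNIV (\<lambda>t. ?F (a, line t)) 0 = velocity CA UNIV (\<lambda>t. (u, lft a (line t) u)) 0"
    by (rule velocity_cong) (use line_dom in eventually_elim, simp add: F)
  ultimately show ?thesis by (simp add: lie_Ups_def vlift_apullback)
qed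

text \<open>The map \<open>snd\<close> takes the curve behind one translate to the curve behind the
  other, so \<open>tmap_velocity\<close> applies once more, now to the canonical map of the whole
  pullback.\<close>

lemma tmap_lie_Ups:
  "tmap CA (bundle_atlas A E) ctot snd (lie_Ups A E Eb V h I c a e w u) = lie_Y A E Eb V h I c a e w u"
  unfolding lie_Ups_eq lie_Y_eq
proof (rule tmap_velocity[of CA "\<lambda>t. (u, lft a (line t) u)" _ _ snd, simplified snd_conv])
  have uI: "u \<in> I" by (rule dom_subset[OF u])
  have fu: "lft a (line 0) u \<in> fibre E (base u)" using lft_fibre[OF u] by (simp add: line_0)
  show "(u, lft a (line 0) u) \<in> pts CA" using fu uI by (simp add: pts_CA)
  fix C assume C: "C \<in> CA" "(u, lft a (line 0) u) \<in> fst C"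
  then obtain y where y: "C = cchart y" "y \<in> trivs E" "base u \<in> fst y" by (auto simp: CA_eq)
  obtain K where "((\<lambda>t. snd y (lft a (line t) u)) has_derivative K) (at 0)"
    using flow_line_differentiable[OF y(2,3)] by (auto simp: differentiable_def)
  from has_derivative_Pair[OF has_derivative_const this]
  show "(\<lambda>t. snd C (u, lft a (line t) u)) differentiable (at 0)" by (auto simp: y(1) differentiable_def)
  show "eventually (\<lambda>t. (u, lft a (line t) u) \<in> fst C \<inter> ctot) (nhds 0)"
    using line_dom by eventually_elim (use lft_fibre uI y in \<open>auto simp: tot_curve_pb\<close>)
  fix D assume "D \<in> bundle_atlas A E" "lft a (line 0) u \<in> fst D"
  then obtain k' y' where y': "D = ch k' y'" "k' \<in> A" "y' \<in> trivs E" "base u \<in> fst k'" "base u \<in> fst y'"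
    using fu by (auto simp: fibre_def elim!: bundle_atlasE)
  obtain K where K: "(tr k' y k' y' has_derivative K)
      (at (snd k' (base u), snd y (lft a (line 0) u)))"
    using transition_B(2)[OF y'(2,2) y(2) y'(3) fu y'(4,4) y(3) y'(5)] by (auto simp: differentiable_def)
  have "fst C \<inter> ctot = fst C" by (auto simp: y(1) tot_curve_pb)
  then show "transition C D snd differentiable (at (snd C (u, lft a (line 0) u)) within snd C ` (fst C \<inter> ctot))"
    using cchart_snd_transition[OF y'(2) y(2) y'(3) uI fu y'(4) y(3) y'(5) K]
    by (auto simp: y(1) y'(1) differentiable_def simp del: snd_adapted_chart)
qed (use regular_atlasD(1)[OF CA_regular] in blast)

end

end

section \<open>Affine connections\<close>

lemma adapted_chart_trivs_update [simp]: "adapted_chart (B\<lparr>trivs := T\<rparr>) k y = adapted_chart B k y"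
  by (simp add: adapted_chart_def)

lemma has_derivative_fst_self: "(fst has_derivative fst) F"
  by (rule bounded_linear_imp_has_derivative[OF bounded_linear_fst])

lemma has_derivative_snd_self: "(snd has_derivative snd) F"
  by (rule bounded_linear_imp_has_derivative[OF bounded_linear_snd])

lemma has_derivative_compose_fst:
  assumes "(T has_derivative K) (at a)"
  shows "((\<lambda>v. T (fst v)) has_derivative (\<lambda>v. K (fst v))) (at (a, b))"
  by (rule has_derivative_compose[OF has_derivative_fst_self]) (use assms in \<open>simp only: fst_conv\<close>)

lemma has_derivative_compose_fst_fst_snd:
  assumes "(T has_derivative K) (at (m, b))"
  shows "((\<lambda>v. T (fst (fst v), snd v)) has_derivative (\<lambda>v. K (fst (fst v), snd v))) (at ((m, q), b))"
proof -
  have "((\<lambda>v. (fst (fst v), snd v)) has_derivative (\<lambda>v. (fst (fst v), snd v))) (at ((m, q), b))"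
    by (intro has_derivative_Pair has_derivative_fst has_derivative_fst_self has_derivative_snd_self)
  from has_derivative_compose[OF this] show ?thesis using assms by (simp only: fst_conv snd_conv)
qed

locale affine_connection_curve =
  E: lifted_curve A E V \<rho> h c I + Eb: lifted_curve A Eb V \<rho> hb c I
  for A :: "('m, 'a::banach) atlas"
    and E :: "('e, 'm, 'f::banach, 'w) abundle"
    and V :: "('v, 'm, 'k::banach) vbundle"
    and \<rho> h c I
    and Eb :: "('w, 'm, 'f) vbundle"
    and hb +
  assumes aff: "affine_bundle A E Eb"
    and affc: "affine_connection A E Eb V \<rho> h hb"
begin

abbreviation base :: "real \<Rightarrow> 'm" where
  "base u \<equiv> prj V (c u)"

section \<open>Charts and coordinate changes of the fibre product\<close>

abbreviation FA :: "('e \<times> 'w, ('a \<times> 'f) \<times> 'f) atlas" where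
  "FA \<equiv> fp_atlas A E Eb"

definition fchart :: "('m, 'a) chart \<Rightarrow> 'm set \<times> ('e \<Rightarrow> 'f) \<Rightarrow> 'm set \<times> ('w \<Rightarrow> 'f) \<Rightarrow> ('e \<times> 'w, ('a \<times> 'f) \<times> 'f) chart" where
  "fchart k y y' = adapted_chart (pullback (tot E) (prj E) Eb) (E.ch k y)
     ({x \<in> tot E. prj E x \<in> fst y'}, snd y' \<circ> snd)"

lemma fst_fchart: "fst (fchart k y y') = {(x, v). x \<in> tot E \<and> v \<in> fibre Eb (prj E x) \<and>
    prj E x \<in> fst k \<and> prj E x \<in> fst y \<and> prj E x \<in> fst y'}"
  by (auto simp: fchart_def pullback_def pb_tot_def fibre_def)

lemma snd_fchart: "snd (fchart k y y') p = ((snd k (prj E (fst p)), snd y (fst p)), snd y' (snd p))"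
  by (simp add: fchart_def pullback_def)

lemma FA_eq: "FA = {fchart k y y' | k y y'. k \<in> A \<and> y \<in> trivs E \<and> y' \<in> trivs Eb}"
proof -
  have t: "trivs (pullback (tot E) (prj E) Eb) = (\<lambda>y'. ({x \<in> tot E. prj E x \<in> fst y'}, snd y' \<circ> snd)) ` trivs Eb"
    by (simp add: pullback_def pb_trivs_def)
  show ?thesis
  proof (intro equalityI subsetI)
    fix C assume "C \<in> FA"
    then obtain C0 z where C: "C = adapted_chart (pullback (tot E) (prj E) Eb) C0 z" "C0 \<in> bundle_atlas A E"
        "z \<in> trivs (pullback (tot E) (prj E) Eb)"
      unfolding fp_atlas_def by (rule bundle_atlasE)
    obtain k y where "C0 = E.ch k y" "k \<in> A" "y \<in> trivs E" using C(2) by (rule bundle_atlasE)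
    moreover obtain y' where "z = ({x \<in> tot E. prj E x \<in> fst y'}, snd y' \<circ> snd)" "y' \<in> trivs Eb"
      using C(3) unfolding t by (rule imageE)
    ultimately show "C \<in> {fchart k y y' | k y y'. k \<in> A \<and> y \<in> trivs E \<and> y' \<in> trivs Eb}"
      unfolding fchart_def C(1) by blast
  next
    fix C assume "C \<in> {fchart k y y' | k y y'. k \<in> A \<and> y \<in> trivs E \<and> y' \<in> trivs Eb}"
    then obtain k y y' where C: "C = fchart k y y'" "k \<in> A" "y \<in> trivs E" "y' \<in> trivs Eb" by blast
    show "C \<in> FA"
      unfolding C(1) fchart_def fp_atlas_def
      by (intro adapted_chart_in_bundle_atlas C(2,3)) (use C(4) t in blast)
  qed
qed

lemma fchart_in_FA: "k \<in> A \<Longrightarrow> y \<in> trivs E \<Longrightarrow> y' \<in> trivs Eb \<Longrightarrow> fchart k y y' \<in> FA"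
  unfolding FA_eq by blast

lemma FA_E:
  assumes "C \<in> FA"
  obtains k y y' where "C = fchart k y y'" "k \<in> A" "y \<in> trivs E" "y' \<in> trivs Eb"
  using assms unfolding FA_eq by blast

lemma pts_FA: "pts FA \<subseteq> pb_tot (tot E) (prj E) Eb"
  by (auto simp: pts_def fst_fchart pb_tot_def fibre_def elim!: FA_E)

lemma openin_FA:
  assumes "openin (atlas_top A) W"
  shows "openin (atlas_top FA) {p \<in> pts FA. prj E (fst p) \<in> W}"
proof -
  have "{p \<in> pts FA. prj (pullback (tot E) (prj E) Eb) p \<in> {x \<in> pts (bundle_atlas A E). prj E x \<in> W}}
      = {p \<in> pts FA. prj E (fst p) \<in> W}"
    using pts_FA by (auto simp: pullback_def pts_bundle_atlas[OF E.B] pb_tot_def)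
  then show ?thesis
    using openin_bundle_preimage[OF openin_bundle_preimage[OF assms, of E], of "pullback (tot E) (prj E) Eb"]
    by (simp add: fp_atlas_def)
qed

lemma inj_fchart:
  assumes "k \<in> A" "y \<in> trivs E" "y' \<in> trivs Eb"
  shows "inj_on (snd (fchart k y y')) (fst (fchart k y y'))"
proof (rule inj_onI)
  fix p p' assume p: "p \<in> fst (fchart k y y')" "p' \<in> fst (fchart k y y')" "snd (fchart k y y') p = snd (fchart k y y') p'"
  obtain x v x' v' where xv: "p = (x, v)" "p' = (x', v')" by fastforce
  have m: "prj E x = prj E x'"
    using p inj_onD[OF manifoldD(1)[OF E.A assms(1,1)]] by (auto simp: xv fst_fchart snd_fchart)
  have "x = x'"
    using p m inj_onD[OF fibre_bundleD(6)[OF E.B assms(2), of "prj E x"], of x x']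
    by (auto simp: xv fst_fchart snd_fchart fibre_def)
  moreover have "v = v'"
    using p m inj_onD[OF fibre_bundleD(6)[OF Eb.B assms(3), of "prj E x"], of v v']
    by (auto simp: xv fst_fchart snd_fchart)
  ultimately show "p = p'" by (simp add: xv)
qed

text \<open>Surjectivity of both trivializations makes the image a full product over base
  coordinates, which gives openness and thus thickness.\<close>

lemma fchart_image:
  assumes "k \<in> A" "y \<in> trivs E" "y' \<in> trivs Eb"
  shows "snd (fchart k y y') ` (fst (fchart k y y') \<inter> fst (fchart k2 y2 y2'))
    = (snd k ` (fst k \<inter> (fst y \<inter> fst y' \<inter> fst k2 \<inter> fst y2 \<inter> fst y2')) \<times> UNIV) \<times> UNIV"
proof (intro equalityI subsetI)
  fix z assume "z \<in> (snd k ` (fst k \<inter> (fst y \<inter> fst y' \<inter> fst k2 \<inter> fst y2 \<inter> fst y2')) \<times> (UNIV :: 'f set)) \<times> (UNIV :: 'f set)"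
  then obtain m q l where z: "z = ((snd k m, q), l)" "m \<in> fst k" "m \<in> fst y" "m \<in> fst y'" "m \<in> fst k2" "m \<in> fst y2" "m \<in> fst y2'"
    by auto
  let ?x = "tinv E y m q" and ?v = "tinv Eb y' m l"
  have x: "?x \<in> fibre E m" "snd y ?x = q" using tinv(1,2)[OF E.B assms(2) z(3)] by blast+
  have v: "?v \<in> fibre Eb m" "snd y' ?v = l" using tinv(1,2)[OF Eb.B assms(3) z(4)] by blast+
  show "z \<in> snd (fchart k y y') ` (fst (fchart k y y') \<inter> fst (fchart k2 y2 y2'))"
    by (rule image_eqI[of _ _ "(?x, ?v)"]) (use x v z in \<open>auto simp: snd_fchart fst_fchart fibre_def\<close>)
qed (auto simp: snd_fchart fst_fchart)

lemma FA_thick: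
  assumes "k \<in> A" "y \<in> trivs E" "y' \<in> trivs Eb" "k2 \<in> A" "y2 \<in> trivs E" "y2' \<in> trivs Eb"
    "p \<in> fst (fchart k y y')" "p \<in> fst (fchart k2 y2 y2')"
  shows "thick (snd (fchart k y y') p) (snd (fchart k y y') ` (fst (fchart k y y') \<inter> fst (fchart k2 y2 y2')))"
proof (rule thick_open)
  have "openin (atlas_top A) (fst y \<inter> fst y' \<inter> fst k2 \<inter> fst y2 \<inter> fst y2')"
    by (intro openin_Int manifold_openin_chart[OF E.A] fibre_bundleD(4)[OF E.B] fibre_bundleD(4)[OF Eb.B] assms)
  from manifold_open_image[OF E.A assms(1) this]
  show "open (snd (fchart k y y') ` (fst (fchart k y y') \<inter> fst (fchart k2 y2 y2')))"
    unfolding fchart_image[OF assms(1-3)] by (intro open_Times open_UNIV)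
qed (use assms in blast)

lemma fchart_transition_derivative:
  assumes C: "k \<in> A" "y \<in> trivs E" "y' \<in> trivs Eb" and p: "(x, v) \<in> fst (fchart k y y')"
    and W: "openin (atlas_top A) W" "prj E x \<in> W"
    and F: "(F has_derivative D) (at ((snd k (prj E x), snd y x), snd y' v))"
    and eq: "\<And>x v. (x, v) \<in> fst (fchart k y y') \<Longrightarrow> prj E x \<in> W \<Longrightarrow> (x, v) \<in> S \<Longrightarrow>
      snd d (f (x, v)) = F ((snd k (prj E x), snd y x), snd y' v)"
    and S: "(x, v) \<in> S"
  shows "(transition (fchart k y y') d f has_derivative D)
    (at (snd (fchart k y y') (x, v)) within snd (fchart k y y') ` (fst (fchart k y y') \<inter> S))"
proof (rule transition_has_derivativeI[OF fchart_in_FA[OF C] inj_fchart[OF C] openin_FA[OF W(1)] p])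
  show "(x, v) \<in> {p \<in> pts FA. prj E (fst p) \<in> W}"
    using p W(2) chart_subset_pts[OF fchart_in_FA[OF C]] by auto
  show "(F has_derivative D) (at (snd (fchart k y y') (x, v)) within
      snd (fchart k y y') ` (fst (fchart k y y') \<inter> S \<inter> {p \<in> pts FA. prj E (fst p) \<in> W}))"
    using has_derivative_at_withinI[OF F] by (simp only: snd_fchart fst_conv snd_conv)
  fix p assume "p \<in> fst (fchart k y y')" "p \<in> S" "p \<in> {p \<in> pts FA. prj E (fst p) \<in> W}"
  then show "snd d (f p) = F (snd (fchart k y y') p)"
    using eq[of "fst p" "snd p"] by (simp only: prod.collapse snd_fchart mem_Collect_eq)
qed (rule S)

text \<open>The second fibre coordinate changes with the base point but not with the first fibre
  coordinate, which is why the last component only sees \<open>(fst (fst v), snd v)\<close>.\<close>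

lemma FA_transition:
  assumes C: "k \<in> A" "y \<in> trivs E" "y' \<in> trivs Eb" and C2: "k2 \<in> A" "y2 \<in> trivs E" "y2' \<in> trivs Eb"
    and x: "x \<in> fibre E m" "v \<in> fibre Eb m" and m: "m \<in> fst k" "m \<in> fst y" "m \<in> fst y'" "m \<in> fst k2" "m \<in> fst y2" "m \<in> fst y2'"
    and K: "(E.tr k y k2 y2 has_derivative K) (at (snd k m, snd y x))"
    and K': "(Eb.tr k y' k2 y2' has_derivative K') (at (snd k m, snd y' v))"
  shows "(transition (fchart k y y') (fchart k2 y2 y2') id has_derivative (\<lambda>v. (K (fst v), snd (K' (fst (fst v), snd v)))))
    (at (snd (fchart k y y') (x, v)) within snd (fchart k y y') ` (fst (fchart k y y') \<inter> fst (fchart k2 y2 y2')))"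
proof -
  let ?T = "E.tr k y k2 y2"
  let ?T' = "Eb.tr k y' k2 y2'"
  let ?C2 = "fchart k2 y2 y2'"
  have px: "prj E x = m" using x by (simp add: fibre_def)
  show ?thesis
  proof (rule fchart_transition_derivative[OF C _ manifold_openin_chart[OF E.A C(1)]])
    show "((\<lambda>v. (?T (fst v), snd (?T' (fst (fst v), snd v)))) has_derivative
        (\<lambda>v. (K (fst v), snd (K' (fst (fst v), snd v))))) (at ((snd k (prj E x), snd y x), snd y' v))"
      unfolding px by (rule has_derivative_Pair[OF has_derivative_compose_fst[OF K] has_derivative_snd[OF has_derivative_compose_fst_fst_snd[OF K']]])
    fix x v assume xv: "(x, v) \<in> fst (fchart k y y')" "(x, v) \<in> fst ?C2"
    have "?T (snd k (prj E x), snd y x) = (snd k2 (prj E x), snd y2 x)"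
      by (rule E.transition_B(1)[OF C(1) C2(1) C(2) C2(2)]) (use xv in \<open>auto simp: fst_fchart fibre_def\<close>)
    moreover have "?T' (snd k (prj E x), snd y' v) = (snd k2 (prj E x), snd y2' v)"
      by (rule Eb.transition_B(1)[OF C(1) C2(1) C(3) C2(3)]) (use xv in \<open>auto simp: fst_fchart fibre_def\<close>)
    ultimately show "snd ?C2 (id (x, v)) = (?T (fst ((snd k (prj E x), snd y x), snd y' v)),
        snd (?T' (fst (fst ((snd k (prj E x), snd y x), snd y' v)), snd ((snd k (prj E x), snd y x), snd y' v))))"
      by (simp only: snd_fchart id_apply fst_conv snd_conv)
  qed (use x m in \<open>auto simp: fst_fchart fibre_def\<close>)
qed

lemma FA_regular: "regular_atlas FA"
  unfolding regular_atlas_def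
proof (intro conjI ballI)
  fix C assume "C \<in> FA"
  then obtain k y y' where C: "C = fchart k y y'" "k \<in> A" "y \<in> trivs E" "y' \<in> trivs Eb" by (rule FA_E)
  show "inj_on (snd C) (fst C)" unfolding C(1) by (rule inj_fchart[OF C(2-4)])
  have "openin (atlas_top A) (fst k \<inter> fst y \<inter> fst y')"
    by (intro openin_Int manifold_openin_chart[OF E.A] fibre_bundleD(4)[OF E.B] fibre_bundleD(4)[OF Eb.B] C)
  from openin_FA[OF this] have "openin (atlas_top FA) {p \<in> pts FA. prj E (fst p) \<in> fst k \<inter> fst y \<inter> fst y'}" .
  moreover have "{p \<in> pts FA. prj E (fst p) \<in> fst k \<inter> fst y \<inter> fst y'} = fst C"
    using chart_subset_pts[OF \<open>C \<in> FA\<close>] pts_FA by (auto simp: C(1) fst_fchart pb_tot_def fibre_def)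
  ultimately show "openin (atlas_top FA) (fst C)" by simp
next
  fix C C2 p assume C0: "C \<in> FA" "C2 \<in> FA" and p: "p \<in> fst C \<inter> fst C2"
  obtain k y y' where C: "C = fchart k y y'" "k \<in> A" "y \<in> trivs E" "y' \<in> trivs Eb" using C0(1) by (rule FA_E)
  obtain k2 y2 y2' where C2: "C2 = fchart k2 y2 y2'" "k2 \<in> A" "y2 \<in> trivs E" "y2' \<in> trivs Eb" using C0(2) by (rule FA_E)
  show "thick (snd C p) (snd C ` (fst C \<inter> fst C2))"
    unfolding C(1) C2(1) by (rule FA_thick) (use C C2 p in auto)
  obtain x v where xv: "p = (x, v)" by fastforce
  define m where "m = prj E x"
  have x: "x \<in> fibre E m" "v \<in> fibre Eb m" "m \<in> fst k" "m \<in> fst y" "m \<in> fst y'" "m \<in> fst k2" "m \<in> fst y2" "m \<in> fst y2'"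
    using p by (auto simp: C(1) C2(1) xv fst_fchart fibre_def m_def)
  obtain K where K: "(E.tr k y k2 y2 has_derivative K) (at (snd k m, snd y x))"
    using E.transition_B(2)[OF C(2) C2(2) C(3) C2(3) x(1,3,6,4,7)] by (auto simp: differentiable_def)
  obtain K' where K': "(Eb.tr k y' k2 y2' has_derivative K') (at (snd k m, snd y' v))"
    using Eb.transition_B(2)[OF C(2) C2(2) C(4) C2(4) x(2,3,6,5,8)] by (auto simp: differentiable_def)
  note FA_transition[OF C(2-4) C2(2-4) x K K']
  then show "transition C C2 id differentiable (at (snd C p) within snd C ` (fst C \<inter> fst C2))"
    unfolding C(1) C2(1) xv differentiable_def by blast
qed

lemma fst_transition:
  assumes C: "k1 \<in> A" "y1 \<in> trivs E" "y1' \<in> trivs Eb" and k: "k \<in> A" "y \<in> trivs E"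
    and x: "x \<in> fibre E m" "v \<in> fibre Eb m" and m: "m \<in> fst k1" "m \<in> fst y1" "m \<in> fst y1'" "m \<in> fst k" "m \<in> fst y"
    and K: "(E.tr k1 y1 k y has_derivative K) (at (snd k1 m, snd y1 x))"
  shows "(transition (fchart k1 y1 y1') (E.ch k y) fst has_derivative (\<lambda>v. K (fst v)))
    (at (snd (fchart k1 y1 y1') (x, v)) within snd (fchart k1 y1 y1') ` fst (fchart k1 y1 y1'))"
proof -
  let ?T = "E.tr k1 y1 k y"
  have W: "openin (atlas_top A) (fst k \<inter> fst y)"
    by (intro openin_Int manifold_openin_chart[OF E.A] fibre_bundleD(4)[OF E.B] k)
  have px: "prj E x = m" using x by (simp add: fibre_def)
  have "(transition (fchart k1 y1 y1') (E.ch k y) fst has_derivative (\<lambda>v. K (fst v)))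
    (at (snd (fchart k1 y1 y1') (x, v)) within snd (fchart k1 y1 y1') ` (fst (fchart k1 y1 y1') \<inter> UNIV))"
  proof (rule fchart_transition_derivative[OF C _ W])
    show "((\<lambda>v. ?T (fst v)) has_derivative (\<lambda>v. K (fst v))) (at ((snd k1 (prj E x), snd y1 x), snd y1' v))"
      unfolding px by (rule has_derivative_compose_fst[OF K])
    fix x v assume p: "(x, v) \<in> fst (fchart k1 y1 y1')" "prj E x \<in> fst k \<inter> fst y"
    have "?T (snd k1 (prj E x), snd y1 x) = (snd k (prj E x), snd y x)"
      by (rule E.transition_B(1)[OF C(1) k(1) C(2) k(2)]) (use p in \<open>auto simp: fst_fchart fibre_def\<close>)
    then show "snd (E.ch k y) (fst (x, v)) = ?T (fst ((snd k1 (prj E x), snd y1 x), snd y1' v))"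
      by (simp only: snd_adapted_chart fst_conv)
  qed (use x m in \<open>auto simp: fst_fchart fibre_def\<close>)
  then show ?thesis by simp
qed

lemma snd_transition:
  assumes C: "k1 \<in> A" "y1 \<in> trivs E" "y1' \<in> trivs Eb" and k: "k \<in> A" "y' \<in> trivs Eb"
    and x: "x \<in> fibre E m" "v \<in> fibre Eb m" and m: "m \<in> fst k1" "m \<in> fst y1" "m \<in> fst y1'" "m \<in> fst k" "m \<in> fst y'"
    and K: "(Eb.tr k1 y1' k y' has_derivative K) (at (snd k1 m, snd y1' v))"
  shows "(transition (fchart k1 y1 y1') (Eb.ch k y') snd has_derivative (\<lambda>v. K (fst (fst v), snd v)))
    (at (snd (fchart k1 y1 y1') (x, v)) within snd (fchart k1 y1 y1') ` fst (fchart k1 y1 y1'))"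
proof -
  let ?T = "Eb.tr k1 y1' k y'"
  have W: "openin (atlas_top A) (fst k \<inter> fst y')"
    by (intro openin_Int manifold_openin_chart[OF E.A] fibre_bundleD(4)[OF Eb.B] k)
  have px: "prj E x = m" using x by (simp add: fibre_def)
  have "(transition (fchart k1 y1 y1') (Eb.ch k y') snd has_derivative (\<lambda>v. K (fst (fst v), snd v)))
    (at (snd (fchart k1 y1 y1') (x, v)) within snd (fchart k1 y1 y1') ` (fst (fchart k1 y1 y1') \<inter> UNIV))"
  proof (rule fchart_transition_derivative[OF C _ W])
    show "((\<lambda>v. ?T (fst (fst v), snd v)) has_derivative (\<lambda>v. K (fst (fst v), snd v)))
        (at ((snd k1 (prj E x), snd y1 x), snd y1' v))"
      unfolding px by (rule has_derivative_compose_fst_fst_snd[OF K])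
    fix x v assume p: "(x, v) \<in> fst (fchart k1 y1 y1')" "prj E x \<in> fst k \<inter> fst y'"
    have pv: "prj Eb v = prj E x" using p by (simp add: fst_fchart fibre_def)
    have "?T (snd k1 (prj E x), snd y1' v) = (snd k (prj E x), snd y' v)"
      by (rule Eb.transition_B(1)[OF C(1) k(1) C(3) k(2)]) (use p in \<open>auto simp: fst_fchart fibre_def\<close>)
    then show "snd (Eb.ch k y') (snd (x, v))
        = ?T (fst (fst ((snd k1 (prj E x), snd y1 x), snd y1' v)), snd ((snd k1 (prj E x), snd y1 x), snd y1' v))"
      by (simp only: snd_adapted_chart fst_conv snd_conv pv)
  qed (use x m in \<open>auto simp: fst_fchart fibre_def\<close>)
  then show ?thesis by simp
qed

text \<open>The trivialization \<open>z\<close> of \<open>Eb\<close> that is the linear part of \<open>y\<close> need not belong to \<open>trivs Eb\<close>,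
  but it may be adjoined.\<close>

definition linear_part :: "'m set \<times> ('e \<Rightarrow> 'f) \<Rightarrow> ('w \<Rightarrow> 'f) \<Rightarrow> bool" where
  "linear_part y z \<longleftrightarrow> vector_bundle A (Eb\<lparr>trivs := insert (fst y, z) (trivs Eb)\<rparr>) \<and>
     (\<forall>m\<in>fst y. \<forall>e\<in>fibre E m. \<forall>w\<in>fibre Eb m. snd y (act E e w) = snd y e + z w)"

lemma linear_part_exists:
  assumes "y \<in> trivs E"
  obtains z where "linear_part y z"
  using aff assms unfolding affine_bundle_def linear_part_def by blast

lemma act_fibre: "m \<in> pts A \<Longrightarrow> x \<in> fibre E m \<Longrightarrow> v \<in> fibre Eb m \<Longrightarrow> act E x v \<in> fibre E m"
  using aff unfolding affine_bundle_def by blast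

text \<open>The computation takes place in the atlas of the model bundle with \<open>z\<close>
  adjoined, which is again that of a manifold. Adjoining changes neither fibres nor projection, so
  the adapted charts stay the same.\<close>

lemma linear_part_transition:
  assumes z: "linear_part y z" and k: "k1 \<in> A" "y1' \<in> trivs Eb" "k \<in> A" and v: "v \<in> fibre Eb m"
    and m: "m \<in> fst k1" "m \<in> fst y1'" "m \<in> fst k" "m \<in> fst y"
  shows "Eb.tr k1 y1' k (fst y, z) (snd k1 m, snd y1' v) = (snd k m, z v)"
    "Eb.tr k1 y1' k (fst y, z) differentiable (at (snd k1 m, snd y1' v))"
proof -
  let ?Eb = "Eb\<lparr>trivs := insert (fst y, z) (trivs Eb)\<rparr>"
  have man: "manifold (bundle_atlas A ?Eb)"
    using z unfolding linear_part_def vector_bundle_def fibre_bundle_def by blast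
  have "adapted_chart ?Eb k1 y1' \<in> bundle_atlas A ?Eb" "adapted_chart ?Eb k (fst y, z) \<in> bundle_atlas A ?Eb"
    using k by (auto intro!: adapted_chart_in_bundle_atlas simp del: adapted_chart_trivs_update)
  then have C: "Eb.ch k1 y1' \<in> bundle_atlas A ?Eb" "Eb.ch k (fst y, z) \<in> bundle_atlas A ?Eb"
    by (simp_all only: adapted_chart_trivs_update)
  have p: "v \<in> fst (Eb.ch k1 y1')" "v \<in> fst (Eb.ch k (fst y, z))" "prj Eb v = m"
    using v m by (auto simp: fibre_def)
  show "Eb.tr k1 y1' k (fst y, z) (snd k1 m, snd y1' v) = (snd k m, z v)"
    using transition_apply[OF manifoldD(1)[OF man C(1,1)] p(1), of "Eb.ch k (fst y, z)" id] p(3) by simp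
  show "Eb.tr k1 y1' k (fst y, z) differentiable (at (snd k1 m, snd y1' v))"
    using manifold_transition_differentiable[OF man C p(1,2)] p(3) by simp
qed

text \<open>In the trivialization \<open>y\<close> the action adds \<open>z v\<close> to the fibre
  coordinate. As \<open>z\<close> may fail to be among the trivializations of \<open>Eb\<close>,
  this summand is expressed through the given \<open>y1'\<close>, and its derivative includes the
  variation of \<open>z\<close> over the base.\<close>

lemma act_transition:
  assumes C: "k1 \<in> A" "y1 \<in> trivs E" "y1' \<in> trivs Eb" and k: "k \<in> A" "y \<in> trivs E" and z: "linear_part y z"
    and x: "x \<in> fibre E m" "v \<in> fibre Eb m" and m: "m \<in> fst k1" "m \<in> fst y1" "m \<in> fst y1'" "m \<in> fst k" "m \<in> fst y"
    and K: "(E.tr k1 y1 k y has_derivative K) (at (snd k1 m, snd y1 x))"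
    and Kz: "(Eb.tr k1 y1' k (fst y, z) has_derivative Kz)
      (at (snd k1 m, snd y1' v))"
  shows "(transition (fchart k1 y1 y1') (E.ch k y) (\<lambda>(x, v). act E x v) has_derivative
      (\<lambda>v. K (fst v) + (0, snd (Kz (fst (fst v), snd v)))))
    (at (snd (fchart k1 y1 y1') (x, v)) within snd (fchart k1 y1 y1') ` fst (fchart k1 y1 y1'))"
proof -
  let ?T = "E.tr k1 y1 k y"
  let ?Tz = "Eb.tr k1 y1' k (fst y, z)"
  have W: "openin (atlas_top A) (fst k \<inter> fst y)"
    by (intro openin_Int manifold_openin_chart[OF E.A] fibre_bundleD(4)[OF E.B] k)
  have px: "prj E x = m" using x by (simp add: fibre_def)
  have "(transition (fchart k1 y1 y1') (E.ch k y) (\<lambda>(x, v). act E x v) has_derivative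
      (\<lambda>v. K (fst v) + (0, snd (Kz (fst (fst v), snd v)))))
    (at (snd (fchart k1 y1 y1') (x, v)) within snd (fchart k1 y1 y1') ` (fst (fchart k1 y1 y1') \<inter> UNIV))"
  proof (rule fchart_transition_derivative[OF C _ W])
    show "((\<lambda>v. ?T (fst v) + (0, snd (?Tz (fst (fst v), snd v)))) has_derivative
        (\<lambda>v. K (fst v) + (0, snd (Kz (fst (fst v), snd v))))) (at ((snd k1 (prj E x), snd y1 x), snd y1' v))"
      unfolding px
      by (intro has_derivative_add has_derivative_compose_fst[OF K] has_derivative_Pair has_derivative_const
          has_derivative_snd[OF has_derivative_compose_fst_fst_snd[OF Kz]])
    fix x v assume p: "(x, v) \<in> fst (fchart k1 y1 y1')" "prj E x \<in> fst k \<inter> fst y"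
    define m where "m = prj E x"
    have xv: "x \<in> fibre E m" "v \<in> fibre Eb m" "m \<in> fst k1" "m \<in> fst y1" "m \<in> fst y1'" "m \<in> fst k" "m \<in> fst y"
      using p by (auto simp: fst_fchart fibre_def m_def)
    have 1: "?T (snd k1 m, snd y1 x) = (snd k m, snd y x)"
      by (rule E.transition_B(1)[OF C(1) k(1) C(2) k(2) xv(1,3,6,4,7)])
    have 2: "?Tz (snd k1 m, snd y1' v) = (snd k m, z v)"
      by (rule linear_part_transition(1)[OF z C(1,3) k(1) xv(2,3,5,6,7)])
    have "m \<in> pts A" using xv(6) k(1) chart_subset_pts by blast
    then have 3: "prj E (act E x v) = m" using act_fibre xv by (simp add: fibre_def)
    have 4: "snd y (act E x v) = snd y x + z v" using z xv unfolding linear_part_def by blast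
    show "snd (E.ch k y) (case (x, v) of (x, v) \<Rightarrow> act E x v)
        = ?T (fst ((snd k1 (prj E x), snd y1 x), snd y1' v))
          + (0, snd (?Tz (fst (fst ((snd k1 (prj E x), snd y1 x), snd y1' v)), snd ((snd k1 (prj E x), snd y1 x), snd y1' v))))"
      unfolding m_def[symmetric] by (simp only: prod.case snd_adapted_chart fst_conv snd_conv 1 2 3 4) simp
  qed (use x m in \<open>auto simp: fst_fchart fibre_def\<close>)
  then show ?thesis by simp
qed

section \<open>The affine condition on the connection in coordinates\<close>

context
  fixes u :: real and x :: 'e and v :: 'w
  assumes u: "u \<in> I" and x: "x \<in> fibre E (base u)" and v: "v \<in> fibre Eb (base u)"
begin

private abbreviation X where "X \<equiv> h (x, c u)"
private abbreviation X' where "X' \<equiv> hb (v, c u)"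
private abbreviation val where
  "val k y y' \<equiv> ((snd (\<rho> (c u)) k, E.hcomp k y u x), Eb.hcomp k y' u v)"

lemma fchart_mem: "base u \<in> fst k \<Longrightarrow> base u \<in> fst y \<Longrightarrow> base u \<in> fst y' \<Longrightarrow> (x, v) \<in> fst (fchart k y y')"
  using x v by (auto simp: fst_fchart fibre_def)

lemma FA_chartE:
  assumes "C \<in> FA" "(x, v) \<in> fst C"
  obtains k y y' where "C = fchart k y y'" "k \<in> A" "y \<in> trivs E" "y' \<in> trivs Eb"
    "base u \<in> fst k" "base u \<in> fst y" "base u \<in> fst y'"
proof -
  obtain k y y' where C: "C = fchart k y y'" "k \<in> A" "y \<in> trivs E" "y' \<in> trivs Eb" using assms(1) by (rule FA_E)
  show ?thesis by (rule that[OF C]) (use assms(2) x in \<open>auto simp: C(1) fst_fchart fibre_def\<close>)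
qed

text \<open>The first two formulas show that the two projections determine \<open>Z\<close>. The
  third evaluates the tangent of the addition map on it.\<close>

lemma tmap_FA:
  assumes Z: "Z \<in> tspace FA (x, v)" and k: "k \<in> A" "y \<in> trivs E" "y' \<in> trivs Eb"
    "base u \<in> fst k" "base u \<in> fst y" "base u \<in> fst y'"
  shows "snd (tmap FA (bundle_atlas A E) (pb_tot (tot E) (prj E) Eb) fst Z) (E.ch k y)
      = fst (snd Z (fchart k y y'))"
    "snd (tmap FA (bundle_atlas A Eb) (pb_tot (tot E) (prj E) Eb) snd Z) (Eb.ch k y')
      = (fst (fst (snd Z (fchart k y y'))), snd (snd Z (fchart k y y')))"
    "linear_part y z \<Longrightarrow> (Eb.tr k y' k (fst y, z) has_derivative Kz)
        (at (snd k (base u), snd y' v)) \<Longrightarrow>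
      snd (tmap FA (bundle_atlas A E) (pb_tot (tot E) (prj E) Eb) (\<lambda>(x, v). act E x v) Z) (E.ch k y)
      = fst (snd Z (fchart k y y')) + (0, snd (Kz (fst (fst (snd Z (fchart k y y'))), snd (snd Z (fchart k y y')))))"
proof -
  have C: "fchart k y y' \<in> FA" "(x, v) \<in> fst (fchart k y y')" using k fchart_in_FA fchart_mem by auto
  have idE: "(E.tr k y k y has_derivative (\<lambda>v. v)) (at (snd k (base u), snd y x))"
    by (rule E.transition_self[OF k(1,2) x k(4,5)])
  show "snd (tmap FA (bundle_atlas A E) (pb_tot (tot E) (prj E) Eb) fst Z) (E.ch k y)
      = fst (snd Z (fchart k y y'))"
  proof (rule tmap_component[OF FA_regular Z pts_FA _ _ _ C fst_transition[OF k(1-3,1,2) x v k(4-6,4,5) idE]])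
    fix C assume C: "C \<in> FA" "(x, v) \<in> fst C"
    obtain k1 y1 y1' where C1: "C = fchart k1 y1 y1'" "k1 \<in> A" "y1 \<in> trivs E" "y1' \<in> trivs Eb"
      "base u \<in> fst k1" "base u \<in> fst y1" "base u \<in> fst y1'" using C by (rule FA_chartE)
    obtain K where "(E.tr k1 y1 k y has_derivative K) (at (snd k1 (base u), snd y1 x))"
      using E.transition_B(2)[OF C1(2) k(1) C1(3) k(2) x C1(5) k(4) C1(6) k(5)] by (auto simp: differentiable_def)
    from fst_transition[OF C1(2-4) k(1,2) x v C1(5-7) k(4,5) this]
    show "transition C (E.ch k y) fst differentiable (at (snd C (x, v)) within snd C ` fst C)"
      unfolding C1(1) differentiable_def by blast
  qed (use k x in \<open>auto simp: fibre_def intro: adapted_chart_in_bundle_atlas\<close>)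
  show "snd (tmap FA (bundle_atlas A Eb) (pb_tot (tot E) (prj E) Eb) snd Z) (Eb.ch k y')
      = (fst (fst (snd Z (fchart k y y'))), snd (snd Z (fchart k y y')))"
  proof (rule tmap_component[OF FA_regular Z pts_FA _ _ _ C
        snd_transition[OF k(1-3,1,3) x v k(4-6,4,6) Eb.transition_self[OF k(1,3) v k(4,6)]]])
    fix C assume C: "C \<in> FA" "(x, v) \<in> fst C"
    obtain k1 y1 y1' where C1: "C = fchart k1 y1 y1'" "k1 \<in> A" "y1 \<in> trivs E" "y1' \<in> trivs Eb"
      "base u \<in> fst k1" "base u \<in> fst y1" "base u \<in> fst y1'" using C by (rule FA_chartE)
    obtain K where "(Eb.tr k1 y1' k y' has_derivative K) (at (snd k1 (base u), snd y1' v))"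
      using Eb.transition_B(2)[OF C1(2) k(1) C1(4) k(3) v C1(5) k(4) C1(7) k(6)] by (auto simp: differentiable_def)
    from snd_transition[OF C1(2-4) k(1,3) x v C1(5-7) k(4,6) this]
    show "transition C (Eb.ch k y') snd differentiable (at (snd C (x, v)) within snd C ` fst C)"
      unfolding C1(1) differentiable_def by blast
  qed (use k v in \<open>auto simp: fibre_def intro: adapted_chart_in_bundle_atlas\<close>)
  assume z: "linear_part y z"
    and Kz: "(Eb.tr k y' k (fst y, z) has_derivative Kz) (at (snd k (base u), snd y' v))"
  show "snd (tmap FA (bundle_atlas A E) (pb_tot (tot E) (prj E) Eb) (\<lambda>(x, v). act E x v) Z) (E.ch k y)
      = fst (snd Z (fchart k y y')) + (0, snd (Kz (fst (fst (snd Z (fchart k y y'))), snd (snd Z (fchart k y y')))))"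
  proof (rule tmap_component[OF FA_regular Z pts_FA _ _ _ C act_transition[OF k(1-3,1,2) z x v k(4-6,4,5) idE Kz]])
    show "E.ch k y \<in> bundle_atlas A E" by (intro adapted_chart_in_bundle_atlas k)
    show "(case (x, v) of (x, v) \<Rightarrow> act E x v) \<in> fst (E.ch k y)"
      using act_fibre[OF E.base_pts[OF u] x v] k by (auto simp: fibre_def)
    fix C assume C: "C \<in> FA" "(x, v) \<in> fst C"
    obtain k1 y1 y1' where C1: "C = fchart k1 y1 y1'" "k1 \<in> A" "y1 \<in> trivs E" "y1' \<in> trivs Eb"
      "base u \<in> fst k1" "base u \<in> fst y1" "base u \<in> fst y1'" using C by (rule FA_chartE)
    obtain K where K: "(E.tr k1 y1 k y has_derivative K) (at (snd k1 (base u), snd y1 x))"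
      using E.transition_B(2)[OF C1(2) k(1) C1(3) k(2) x C1(5) k(4) C1(6) k(5)] by (auto simp: differentiable_def)
    obtain K1 where K1: "(Eb.tr k1 y1' k (fst y, z) has_derivative K1)
        (at (snd k1 (base u), snd y1' v))"
      using linear_part_transition(2)[OF z C1(2,4) k(1) v C1(5,7) k(4,5)] by (auto simp: differentiable_def)
    from act_transition[OF C1(2-4) k(1,2) z x v C1(5-7) k(4,5) K K1]
    show "transition C (E.ch k y) (\<lambda>(x, v). act E x v) differentiable (at (snd C (x, v)) within snd C ` fst C)"
      unfolding C1(1) differentiable_def by blast
  qed
qed

abbreviation is_fp :: "('e \<times> 'w, ('a \<times> 'f) \<times> 'f) tvec \<Rightarrow> bool" where
  "is_fp Z \<equiv> Z \<in> tspace FA (fst X, fst X') \<and>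
     tmap FA (bundle_atlas A E) (pb_tot (tot E) (prj E) Eb) fst Z = X \<and>
     tmap FA (bundle_atlas A Eb) (pb_tot (tot E) (prj E) Eb) snd Z = X'"

lemma fst_X: "fst X = x" "fst X' = v"
  using tspaceD(1)[OF E.h_tspace[OF u x]] tspaceD(1)[OF Eb.h_tspace[OF u v]] by auto

lemma is_fp_component:
  assumes Z: "is_fp Z" and k: "k \<in> A" "y \<in> trivs E" "y' \<in> trivs Eb" "base u \<in> fst k" "base u \<in> fst y" "base u \<in> fst y'"
  shows "snd Z (fchart k y y') = val k y y'"
proof -
  have Z': "Z \<in> tspace FA (x, v)" using Z fst_X by simp
  have "fst (snd Z (fchart k y y')) = snd X (E.ch k y)"
    using tmap_FA(1)[OF Z' k] Z by simp
  also have "\<dots> = (snd (\<rho> (c u)) k, E.hcomp k y u x)" by (rule E.h_chart[OF u x k(1,2,4,5)])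
  finally have 1: "fst (snd Z (fchart k y y')) = (snd (\<rho> (c u)) k, E.hcomp k y u x)" .
  have "snd (snd Z (fchart k y y')) = Eb.hcomp k y' u v"
    using tmap_FA(2)[OF Z' k] Z by simp
  with 1 show ?thesis by (rule prod_eqI[of _ "val k y y'", unfolded fst_conv snd_conv])
qed

lemma val_transition:
  assumes k: "k \<in> A" "y \<in> trivs E" "y' \<in> trivs Eb" "base u \<in> fst k" "base u \<in> fst y" "base u \<in> fst y'"
    and k2: "k2 \<in> A" "y2 \<in> trivs E" "y2' \<in> trivs Eb" "base u \<in> fst k2" "base u \<in> fst y2" "base u \<in> fst y2'"
  shows "frechet_derivative (transition (fchart k y y') (fchart k2 y2 y2') id)
      (at (snd (fchart k y y') (x, v)) within snd (fchart k y y') ` (fst (fchart k y y') \<inter> fst (fchart k2 y2 y2')))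
      (val k y y') = val k2 y2 y2'"
proof -
  obtain K where K: "(E.tr k y k2 y2 has_derivative K) (at (snd k (base u), snd y x))"
    using E.transition_B(2)[OF k(1) k2(1) k(2) k2(2) x k(4) k2(4) k(5) k2(5)] by (auto simp: differentiable_def)
  obtain K' where K': "(Eb.tr k y' k2 y2' has_derivative K') (at (snd k (base u), snd y' v))"
    using Eb.transition_B(2)[OF k(1) k2(1) k(3) k2(3) v k(4) k2(4) k(6) k2(6)] by (auto simp: differentiable_def)
  have th: "thick (snd (fchart k y y') (x, v)) (snd (fchart k y y') ` (fst (fchart k y y') \<inter> fst (fchart k2 y2 y2')))"
    by (rule FA_thick[OF k(1-3) k2(1-3)]) (use k k2 fchart_mem in auto)
  show ?thesis
    unfolding frechet_derivative_within_eq[OF FA_transition[OF k(1-3) k2(1-3) x v k(4-6) k2(4-6) K K'] th]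
    by (simp only: fst_conv snd_conv E.h_transition[OF u k(1) k2(1) k(2) k2(2) x k(4) k2(4) k(5) k2(5) K]
        Eb.h_transition[OF u k(1) k2(1) k(3) k2(3) v k(4) k2(4) k(6) k2(6) K'])
qed

lemma is_fp_exists: "\<exists>Z. is_fp Z"
proof -
  obtain k0 y0 where k0: "k0 \<in> A" "y0 \<in> trivs E" "base u \<in> fst k0" "base u \<in> fst y0" using E.charts[OF u] .
  obtain y0' where y0': "y0' \<in> trivs Eb" "base u \<in> fst y0'" using Eb.charts[OF u] by metis
  let ?d = "fchart k0 y0 y0'"
  \<comment> \<open>All components are transported from one fixed chart;
    \<open>val_transition\<close> then shows that in every chart they are the values forced by the
    two projections.\<close>
  define Z :: "('e \<times> 'w, ('a \<times> 'f) \<times> 'f) tvec" where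
    "Z = ((x, v), \<lambda>d. if d \<in> FA \<and> (x, v) \<in> fst d then
      frechet_derivative (transition ?d d id) (at (snd ?d (x, v)) within snd ?d ` (fst ?d \<inter> fst d)) (val k0 y0 y0') else 0)"
  have comp: "snd Z (fchart k y y') = val k y y'"
    if k: "k \<in> A" "y \<in> trivs E" "y' \<in> trivs Eb" "base u \<in> fst k" "base u \<in> fst y" "base u \<in> fst y'" for k y y'
    using val_transition[OF k0(1,2) y0'(1) k0(3,4) y0'(2) k] fchart_in_FA[OF k(1-3)] fchart_mem[OF k(4-6)]
    unfolding Z_def snd_conv by (simp only: simp_thms if_True)
  have Z: "Z \<in> tspace FA (x, v)"
    unfolding tspace_def mem_Collect_eq
  proof (rule exI[of _ "snd Z"], intro conjI allI impI ballI)
    fix b d assume bd: "b \<in> FA" "d \<in> FA" "(x, v) \<in> fst b \<inter> fst d"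
    obtain k y y' where b: "b = fchart k y y'" "k \<in> A" "y \<in> trivs E" "y' \<in> trivs Eb"
      "base u \<in> fst k" "base u \<in> fst y" "base u \<in> fst y'" using FA_chartE[OF bd(1)] bd(3) by blast
    obtain k2 y2 y2' where d: "d = fchart k2 y2 y2'" "k2 \<in> A" "y2 \<in> trivs E" "y2' \<in> trivs Eb"
      "base u \<in> fst k2" "base u \<in> fst y2" "base u \<in> fst y2'" using FA_chartE[OF bd(2)] bd(3) by blast
    show "snd Z d = frechet_derivative (transition b d id)
        (at (snd b (x, v)) within snd b ` (fst b \<inter> fst d)) (snd Z b)"
      unfolding b(1) d(1) comp[OF b(2-7)] comp[OF d(2-7)] by (rule val_transition[OF b(2-7) d(2-7), symmetric])
  qed (auto simp: Z_def)
  have "tmap FA (bundle_atlas A E) (pb_tot (tot E) (prj E) Eb) fst Z = X"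
  proof (rule prod_eqI)
    show "fst (tmap FA (bundle_atlas A E) (pb_tot (tot E) (prj E) Eb) fst Z) = fst X" by (simp add: Z_def fst_X)
    show "snd (tmap FA (bundle_atlas A E) (pb_tot (tot E) (prj E) Eb) fst Z) = snd X"
    proof
      fix d
      show "snd (tmap FA (bundle_atlas A E) (pb_tot (tot E) (prj E) Eb) fst Z) d = snd X d"
      proof (cases "d \<in> bundle_atlas A E \<and> x \<in> fst d")
        case True
        then obtain k y where d: "d = E.ch k y" "k \<in> A" "y \<in> trivs E" "base u \<in> fst k" "base u \<in> fst y"
          using x by (auto simp: fibre_def elim!: bundle_atlasE)
        show ?thesis
          unfolding d(1) tmap_FA(1)[OF Z d(2,3) y0'(1) d(4,5) y0'(2)] comp[OF d(2,3) y0'(1) d(4,5) y0'(2)] fst_conv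
          by (rule E.h_chart[OF u x d(2-5), symmetric])
      next
        case False
        then show ?thesis using tspaceD(2)[OF E.h_tspace[OF u x], of d] by (auto simp: tmap_def Z_def)
      qed
    qed
  qed
  moreover have "tmap FA (bundle_atlas A Eb) (pb_tot (tot E) (prj E) Eb) snd Z = X'"
  proof (rule prod_eqI)
    show "fst (tmap FA (bundle_atlas A Eb) (pb_tot (tot E) (prj E) Eb) snd Z) = fst X'" by (simp add: Z_def fst_X)
    show "snd (tmap FA (bundle_atlas A Eb) (pb_tot (tot E) (prj E) Eb) snd Z) = snd X'"
    proof
      fix d
      show "snd (tmap FA (bundle_atlas A Eb) (pb_tot (tot E) (prj E) Eb) snd Z) d = snd X' d"
      proof (cases "d \<in> bundle_atlas A Eb \<and> v \<in> fst d")
        case True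
        then obtain k y' where d: "d = Eb.ch k y'" "k \<in> A" "y' \<in> trivs Eb" "base u \<in> fst k" "base u \<in> fst y'"
          using v by (auto simp: fibre_def elim!: bundle_atlasE)
        show ?thesis
          unfolding d(1) tmap_FA(2)[OF Z d(2) k0(2) d(3,4) k0(4) d(5)] comp[OF d(2) k0(2) d(3,4) k0(4) d(5)] fst_conv snd_conv
          by (rule Eb.h_chart[OF u v d(2-5), symmetric])
      next
        case False
        then show ?thesis using tspaceD(2)[OF Eb.h_tspace[OF u v], of d] by (auto simp: tmap_def Z_def)
      qed
    qed
  qed
  ultimately show ?thesis using Z unfolding fst_X by (intro exI[of _ Z]) simp
qed

text \<open>The components of \<open>fp_tvec\<close> are known from its uniqueness, and the tangent
  of the addition map is known in charts. Substituting both into the affine condition leaves this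
  identity; \<open>Kz\<close> also receives the anchor, since the linear trivialization varies over
  the base.\<close>

lemma act_hcomp:
  assumes k: "k \<in> A" "y \<in> trivs E" "y' \<in> trivs Eb" "base u \<in> fst k" "base u \<in> fst y" "base u \<in> fst y'"
    and z: "linear_part y z"
    and Kz: "(Eb.tr k y' k (fst y, z) has_derivative Kz) (at (snd k (base u), snd y' v))"
  shows "E.hcomp k y u (act E x v) = E.hcomp k y u x + snd (Kz (snd (\<rho> (c u)) k, Eb.hcomp k y' u v))"
proof -
  obtain Z where Z: "is_fp Z" using is_fp_exists by blast
  have "Z' = Z" if Z': "is_fp Z'" for Z'
  proof (rule tspace_eqI)
    show "Z' \<in> tspace FA (x, v)" "Z \<in> tspace FA (x, v)" using Z Z' fst_X by simp_all
    fix C assume "C \<in> FA" "(x, v) \<in> fst C"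
    then obtain k y y' where C: "C = fchart k y y'" "k \<in> A" "y \<in> trivs E" "y' \<in> trivs Eb"
      "base u \<in> fst k" "base u \<in> fst y" "base u \<in> fst y'" by (rule FA_chartE)
    show "snd Z' C = snd Z C"
      unfolding C(1) is_fp_component[OF Z C(2-7)] is_fp_component[OF Z' C(2-7)] ..
  qed
  then have fp: "fp_tvec A E Eb X X' = Z" unfolding fp_tvec_def using Z by (intro the_equality) blast+
  have "h (act E x v, c u) = tmap FA (bundle_atlas A E) (pb_tot (tot E) (prj E) Eb) (\<lambda>(x, v). act E x v) (fp_tvec A E Eb X X')"
    using affc E.base_pts[OF u] E.c_fibre[OF u] x v unfolding affine_connection_def by blast
  then have "snd (h (act E x v, c u)) (E.ch k y)
      = fst (val k y y') + (0, snd (Kz (fst (fst (val k y y')), snd (val k y y'))))"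
    using tmap_FA(3)[OF _ k z Kz, of Z] Z unfolding fp fst_X is_fp_component[OF Z k] by metis
  then show ?thesis by (simp only: fst_conv snd_conv) simp
qed

end

text \<open>In \<open>y\<close> the sum has the coordinate of \<open>\<psi>\<close> plus
  \<open>z\<close> applied to \<open>\<psi>'\<close>. The second summand is differentiated through a
  trivialization \<open>y'\<close> of \<open>Eb\<close>, where the equation for
  \<open>\<psi>'\<close> is available, and the total is the right-hand side of
  \<open>act_hcomp\<close>.\<close>

theorem act_coord:
  assumes \<psi>: "E.coord J \<psi>" and \<psi>': "Eb.coord J \<psi>'"
  shows "E.coord J (\<lambda>u. act E (\<psi> u) (\<psi>' u))"
proof (rule E.coordI)
  note J = E.coordD(1,2)[OF \<psi>]
  show "is_interval J" "J \<subseteq> I" by (rule J)+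
  fix u assume uJ: "u \<in> J"
  then have u: "u \<in> I" using J by blast
  note x = E.coordD(3)[OF \<psi>] and v = Eb.coordD(3)[OF \<psi>']
  show "act E (\<psi> u) (\<psi>' u) \<in> fibre E (base u)" by (rule act_fibre[OF E.base_pts[OF u] x[OF uJ] v[OF uJ]])
  obtain k y where k: "k \<in> A" "y \<in> trivs E" "base u \<in> fst k" "base u \<in> fst y" using E.charts[OF u] .
  obtain y' where y': "y' \<in> trivs Eb" "base u \<in> fst y'" using Eb.charts[OF u] by metis
  obtain z where z: "linear_part y z" using linear_part_exists[OF k(2)] .
  let ?Tz = "Eb.tr k y' k (fst y, z)"
  obtain Kz where Kz: "(?Tz has_derivative Kz) (at (snd k (base u), snd y' (\<psi>' u)))"
    using linear_part_transition(2)[OF z k(1) y'(1) k(1) v[OF uJ] k(3) y'(2) k(3,4)] by (auto simp: differentiable_def)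
  have b: "((\<lambda>s. snd k (base s)) has_vector_derivative snd (\<rho> (c u)) k) (at u within J)"
    by (rule has_vector_derivative_within_subset[OF E.base_derivative[OF k(1) u k(3)] J(2)])
  have "((\<lambda>s. snd (?Tz (snd k (base s), snd y' (\<psi>' s)))) has_vector_derivative
      snd (Kz (snd (\<rho> (c u)) k, Eb.hcomp k y' u (\<psi>' u)))) (at u within J)"
    by (rule has_vector_derivative_compose_has_derivative[OF
          has_vector_derivative_Pair[OF b Eb.coordD(4)[OF \<psi>' uJ k(1) y'(1) k(3) y'(2)]] has_derivative_snd[OF Kz]])
  from has_vector_derivative_add[OF E.coordD(4)[OF \<psi> uJ k] this]
  have "((\<lambda>s. snd y (\<psi> s) + snd (?Tz (snd k (base s), snd y' (\<psi>' s)))) has_vector_derivative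
      E.hcomp k y u (act E (\<psi> u) (\<psi>' u))) (at u within J)"
    unfolding act_hcomp[OF u x[OF uJ] v[OF uJ] k(1,2) y'(1) k(3,4) y'(2) z Kz] .
  then have "((\<lambda>s. snd y (act E (\<psi> s) (\<psi>' s))) has_vector_derivative
      E.hcomp k y u (act E (\<psi> u) (\<psi>' u))) (at u within J)"
  proof (rule has_vector_derivative_transform_eventually)
    have eq: "snd y (\<psi> s) + snd (?Tz (snd k (base s), snd y' (\<psi>' s))) = snd y (act E (\<psi> s) (\<psi>' s))"
      if s: "s \<in> J" "base s \<in> fst k" "base s \<in> fst y" "base s \<in> fst y'" for s
    proof -
      have "snd y (act E (\<psi> s) (\<psi>' s)) = snd y (\<psi> s) + z (\<psi>' s)"
        using z s x v unfolding linear_part_def by blast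
      then show ?thesis
        using linear_part_transition(1)[OF z k(1) y'(1) k(1) v[OF s(1)] s(2,4,2,3)] by simp
    qed
    show "snd y (\<psi> u) + snd (?Tz (snd k (base u), snd y' (\<psi>' u))) = snd y (act E (\<psi> u) (\<psi>' u))"
      by (rule eq[OF uJ k(3,4) y'(2)])
    have "openin (atlas_top A) (fst k \<inter> fst y \<inter> fst y')"
      by (intro openin_Int manifold_openin_chart[OF E.A] fibre_bundleD(4)[OF E.B] fibre_bundleD(4)[OF Eb.B] k y')
    then have "eventually (\<lambda>s. base s \<in> fst k \<inter> fst y \<inter> fst y') (at u within J)"
      by (rule E.base_eventually) (use u k y' J in auto)
    moreover have "eventually (\<lambda>s. s \<in> J) (at u within J)" by (simp add: eventually_at_filter)
    ultimately show "eventually (\<lambda>s. snd y (\<psi> s) + snd (?Tz (snd k (base s), snd y' (\<psi>' s))) = snd y (act E (\<psi> s) (\<psi>' s))) (at u within J)"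
      by eventually_elim (use eq in blast)
  qed (rule uJ)
  then show "\<exists>k\<in>A. \<exists>y\<in>trivs E. base u \<in> fst k \<and> base u \<in> fst y \<and>
      ((\<lambda>s. snd y (act E (\<psi> s) (\<psi>' s))) has_vector_derivative E.hcomp k y u (act E (\<psi> u) (\<psi>' u))) (at u within J)"
    using k by blast
qed

lemma scale_fibre: "m \<in> pts A \<Longrightarrow> v \<in> fibre Eb m \<Longrightarrow> vscale Eb r v \<in> fibre Eb m"
  and scale_chart: "y \<in> trivs Eb \<Longrightarrow> m \<in> fst y \<Longrightarrow> v \<in> fibre Eb m \<Longrightarrow> snd y (vscale Eb r v) = r *\<^sub>R snd y v"
proof -
  have Eb: "vector_bundle A Eb" using aff unfolding affine_bundle_def by blast
  show "m \<in> pts A \<Longrightarrow> v \<in> fibre Eb m \<Longrightarrow> vscale Eb r v \<in> fibre Eb m"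
    using Eb unfolding vector_bundle_def by blast
  show "y \<in> trivs Eb \<Longrightarrow> m \<in> fst y \<Longrightarrow> v \<in> fibre Eb m \<Longrightarrow> snd y (vscale Eb r v) = r *\<^sub>R snd y v"
    using Eb unfolding vector_bundle_def by blast
qed

text \<open>Connection coefficients that are linear in the fibre coordinate make the equation
  homogeneous, and trivializations of the model bundle commute with scaling.\<close>

theorem scale_coord:
  assumes \<psi>: "Eb.coord J \<psi>"
  shows "Eb.coord J (\<lambda>u. vscale Eb r (\<psi> u))"
proof (rule Eb.coordI)
  note J = Eb.coordD(1,2)[OF \<psi>]
  show "is_interval J" "J \<subseteq> I" by (rule J)+
  fix u assume uJ: "u \<in> J"
  then have u: "u \<in> I" using J by blast
  note v = Eb.coordD(3)[OF \<psi>]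
  have fib: "vscale Eb r (\<psi> s) \<in> fibre Eb (base s)" if "s \<in> J" for s
    using scale_fibre E.base_pts J(2) v[OF that] that by blast
  show "vscale Eb r (\<psi> u) \<in> fibre Eb (base u)" by (rule fib[OF uJ])
  obtain k y where k: "k \<in> A" "y \<in> trivs Eb" "base u \<in> fst k" "base u \<in> fst y" using Eb.charts[OF u] .
  obtain z where z: "z \<in> trivs V" "base u \<in> fst z" using fibre_bundle_charts[OF E.Vb E.base_pts[OF u]] by metis
  \<comment> \<open>With the coordinates of \<open>c u\<close> inserted, the coefficient is the
    fibre component of the lift as a function of the fibre coordinate.\<close>
  define G where "G f = conn_coeff Eb V hb k y z (base u) f (snd z (c u))" for f
  have "linear G"
    using affc k z unfolding affine_connection_def linear_connection_def G_def by blast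
  have G: "Eb.hcomp k y u w = G (snd y w)" if w: "w \<in> fibre Eb (base u)" for w
    unfolding G_def conn_coeff_def tinv(3)[OF Eb.B k(2,4) w] tinv(3)[OF E.Vb z E.c_fibre[OF u]] ..
  have h: "Eb.hcomp k y u (vscale Eb r (\<psi> u)) = r *\<^sub>R Eb.hcomp k y u (\<psi> u)"
    unfolding G[OF fib[OF uJ]] G[OF v[OF uJ]] scale_chart[OF k(2,4) v[OF uJ]] by (rule linear_cmul[OF \<open>linear G\<close>])
  have "((\<lambda>s. r *\<^sub>R snd y (\<psi> s)) has_vector_derivative Eb.hcomp k y u (vscale Eb r (\<psi> u))) (at u within J)"
    unfolding h by (rule bounded_linear.has_vector_derivative[OF bounded_linear_scaleR_right Eb.coordD(4)[OF \<psi> uJ k]])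
  then have "((\<lambda>s. snd y (vscale Eb r (\<psi> s))) has_vector_derivative Eb.hcomp k y u (vscale Eb r (\<psi> u))) (at u within J)"
  proof (rule has_vector_derivative_transform_eventually)
    show "r *\<^sub>R snd y (\<psi> u) = snd y (vscale Eb r (\<psi> u))" by (rule scale_chart[OF k(2,4) v[OF uJ], symmetric])
    have "eventually (\<lambda>s. base s \<in> fst y) (at u within J)"
      by (rule E.base_eventually[OF fibre_bundleD(4)[OF Eb.B k(2)] u k(4) J(2)])
    moreover have "eventually (\<lambda>s. s \<in> J) (at u within J)" by (simp add: eventually_at_filter)
    ultimately show "eventually (\<lambda>s. r *\<^sub>R snd y (\<psi> s) = snd y (vscale Eb r (\<psi> s))) (at u within J)"
      by eventually_elim (use scale_chart[OF k(2)] v in simp)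
  qed (rule uJ)
  then show "\<exists>k\<in>A. \<exists>y\<in>trivs Eb. base u \<in> fst k \<and> base u \<in> fst y \<and>
      ((\<lambda>s. snd y (vscale Eb r (\<psi> s))) has_vector_derivative Eb.hcomp k y u (vscale Eb r (\<psi> u))) (at u within J)"
    using k by blast
qed

text \<open>Two lifts can be added on the intersection of their intervals, which contains both
  \<open>a\<close> and \<open>u\<close>; uniqueness identifies the sum with the maximal
  lift.\<close>

lemma hlift_act:
  assumes e: "u \<in> hlift_dom A E V h I c a e" and w: "u \<in> hlift_dom A Eb V hb I c a w"
  shows "hlift A E V h I c a (act E e w) u = act E (hlift A E V h I c a e u) (hlift A Eb V hb I c a w u)"
    and "u \<in> hlift_dom A E V h I c a (act E e w)"
proof -
  obtain J \<psi> where s: "E.coord J \<psi>" "a \<in> J" "\<psi> a = e" "u \<in> J" using e by (rule E.domE)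
  obtain J' \<psi>' where s': "Eb.coord J' \<psi>'" "a \<in> J'" "\<psi>' a = w" "u \<in> J'" using w by (rule Eb.domE)
  have K: "is_interval (J \<inter> J')" using E.coordD(1)[OF s(1)] Eb.coordD(1)[OF s'(1)] by (rule is_interval_Int)
  have sum: "E.coord (J \<inter> J') (\<lambda>u. act E (\<psi> u) (\<psi>' u))"
    by (intro act_coord E.coord_subset[OF s(1) _ K] Eb.coord_subset[OF s'(1) _ K]) auto
  show "hlift A E V h I c a (act E e w) u = act E (hlift A E V h I c a e u) (hlift A Eb V hb I c a w u)"
    using E.lft_eq[OF sum, of a "act E e w" u] E.lft_eq[OF s] Eb.lft_eq[OF s'] s s' by simp
  show "u \<in> hlift_dom A E V h I c a (act E e w)"
    unfolding E.dom_iff using sum s s' by (intro exI[of _ "J \<inter> J'"] exI[of _ "\<lambda>u. act E (\<psi> u) (\<psi>' u)"]) simp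
qed

lemma hlift_scale:
  assumes w: "u \<in> hlift_dom A Eb V hb I c a w"
  shows "hlift A Eb V hb I c a (vscale Eb r w) u = vscale Eb r (hlift A Eb V hb I c a w u)"
    and "u \<in> hlift_dom A Eb V hb I c a (vscale Eb r w)"
proof -
  obtain J \<psi> where s: "Eb.coord J \<psi>" "a \<in> J" "\<psi> a = w" "u \<in> J" using w by (rule Eb.domE)
  note s' = scale_coord[OF s(1), of r]
  show "hlift A Eb V hb I c a (vscale Eb r w) u = vscale Eb r (hlift A Eb V hb I c a w u)"
    using Eb.lft_eq[OF s', of a "vscale Eb r w" u] Eb.lft_eq[OF s] s by simp
  show "u \<in> hlift_dom A Eb V hb I c a (vscale Eb r w)"
    unfolding Eb.dom_iff using s' s by (intro exI[of _ J] exI[of _ "\<lambda>u. vscale Eb r (\<psi> u)"]) simp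
qed

text \<open>Scaling does not shrink the domain of a lift of the linear part, so the flow takes the
  line through \<open>e\<close> to a line for all \<open>t\<close> at once. Its velocity at 0 is
  then a vertical lift by definition.\<close>

lemma hlift_act_line:
  assumes "u \<in> hlift_dom A E V h I c a e" "u \<in> hlift_dom A Eb V hb I c a w"
  shows "hlift A E V h I c a (act E e (vscale Eb t w)) u
    = act E (hlift A E V h I c a e u) (vscale Eb t (hlift A Eb V hb I c a w u))"
  using hlift_act(1)[OF assms(1) hlift_scale(2)[OF assms(2)]] hlift_scale(1)[OF assms(2)] by simp

end

theorem proposition4:
  fixes A :: "('m, 'a::banach) atlas"
    and E :: "('e, 'm, 'f::banach, 'w) abundle"
    and Eb :: "('w, 'm, 'f) vbundle"
    and V :: "('v, 'm, 'k::banach) vbundle"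
    and \<rho> :: "'v \<Rightarrow> ('m, 'a) tvec"
    and h :: "'e \<times> 'v \<Rightarrow> ('e, 'a \<times> 'f) tvec"
    and c :: "real \<Rightarrow> 'v" and I :: "real set" and a :: real and e :: 'e and w :: 'w
  assumes "manifold A"
    and "affine_bundle A E Eb"
    and "vector_bundle A V" and "anchor A V \<rho>"
    and "connection A E V \<rho> h"
    and "is_interval I" and "interior I \<noteq> {}"
    and "admissible A V \<rho> I c"
    and "a \<in> I" and "e \<in> fibre E (prj V (c a))" and "w \<in> fibre Eb (prj V (c a))"
  shows
    "(\<forall>u \<in> icurve_dom A E V h I c a e.
        tmap (curve_atlas E V I c) (bundle_atlas A E) (tot (curve_pb E V I c)) snd
          (lie_Ups A E Eb V h I c a e w u) = lie_Y A E Eb V h I c a e w u) \<and>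
     (\<forall>hb. affine_connection A E Eb V \<rho> h hb \<longrightarrow>
        (\<forall>u \<in> hlift_dom A E V h I c a (act E e w) \<inter> hlift_dom A E V h I c a e
              \<inter> hlift_dom A Eb V hb I c a w.
           hflow A E V h I c u a (act E e w)
             = act E (hlift A E V h I c a e u) (hlift A Eb V hb I c a w u)) \<and>
        (\<forall>u \<in> icurve_dom A E V h I c a (act E e w) \<inter> icurve_dom A E V h I c a e
              \<inter> icurve_dom A Eb V hb I c a w.
           icurve A E V h I c a (act E e w) u
             = act (apullback I (prj V \<circ> c) E)
                 (icurve A E V h I c a e u) (icurve A Eb V hb I c a w u)) \<and>
        (\<forall>u \<in> hlift_dom A E V h I c a e \<inter> hlift_dom A Eb V hb I c a w.
           lie_Y A E Eb V h I c a e w u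
             = vlift A E Eb (hlift A E V h I c a e u) (hlift A Eb V hb I c a w u)) \<and>
        (\<forall>u \<in> icurve_dom A E V h I c a e \<inter> icurve_dom A Eb V hb I c a w.
           lie_Ups A E Eb V h I c a e w u
             = vlift (interval_atlas I) (apullback I (prj V \<circ> c) E) (vpullback I (prj V \<circ> c) Eb)
                 (icurve A E V h I c a e u) (icurve A Eb V hb I c a w u)))"
proof -
  have fE: "fibre_bundle A E" and fEb: "fibre_bundle A Eb"
    using assms(2) by (auto simp: affine_bundle_def vector_bundle_def)
  interpret X: affine_lifted_curve A E V \<rho> h c I Eb
    by unfold_locales (use assms fE in auto)
  note aew = assms(9,10,11)
  show ?thesis
  proof (intro conjI allI impI ballI)
    fix u assume "u \<in> icurve_dom A E V h I c a e"
    then show "tmap (curve_atlas E V I c) (bundle_atlas A E) (tot (curve_pb E V I c)) snd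
        (lie_Ups A E Eb V h I c a e w u) = lie_Y A E Eb V h I c a e w u"
      unfolding X.icurve_dom_eq by (rule X.tmap_lie_Ups[OF aew])
  next
    fix hb assume hb: "affine_connection A E Eb V \<rho> h hb"
    \<comment> \<open>The linear part is itself a connection on the model bundle, so the whole
      theory of lifts and of the pullback field applies to it over the same curve.\<close>
    interpret Y: affine_connection_curve A E V \<rho> h c I Eb hb
    proof unfold_locales
      show "connection A Eb V \<rho> hb"
        using hb unfolding affine_connection_def linear_connection_def by blast
    qed (use hb fEb assms in auto)
    fix u
    show "hflow A E V h I c u a (act E e w) = act E (hlift A E V h I c a e u) (hlift A Eb V hb I c a w u)"
      if "u \<in> hlift_dom A E V h I c a (act E e w) \<inter> hlift_dom A E V h I c a e \<inter> hlift_dom A Eb V hb I c a w"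
      using that Y.hlift_act(1) unfolding hflow_def by blast
    show "icurve A E V h I c a (act E e w) u
        = act (apullback I (prj V \<circ> c) E) (icurve A E V h I c a e u) (icurve A Eb V hb I c a w u)"
      if u: "u \<in> icurve_dom A E V h I c a (act E e w) \<inter> icurve_dom A E V h I c a e \<inter> icurve_dom A Eb V hb I c a w"
    proof -
      have u': "u \<in> hlift_dom A E V h I c a (act E e w)" "u \<in> hlift_dom A E V h I c a e" "u \<in> hlift_dom A Eb V hb I c a w"
        using u unfolding X.icurve_dom_eq Y.Eb.icurve_dom_eq by blast+
      show ?thesis
        unfolding X.icurve_eq[OF u'(1)] X.icurve_eq[OF u'(2)] Y.Eb.icurve_eq[OF u'(3)] Y.hlift_act(1)[OF u'(2,3)]
        by (simp add: apullback_def)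
    qed
    show "lie_Y A E Eb V h I c a e w u = vlift A E Eb (hlift A E V h I c a e u) (hlift A Eb V hb I c a w u)"
      if u: "u \<in> hlift_dom A E V h I c a e \<inter> hlift_dom A Eb V hb I c a w"
    proof -
      have u': "u \<in> hlift_dom A E V h I c a e" "u \<in> hlift_dom A Eb V hb I c a w" using u by blast+
      show ?thesis unfolding X.lie_Y_eq[OF aew u'(1)] vlift_def Y.hlift_act_line[OF u'] ..
    qed
    show "lie_Ups A E Eb V h I c a e w u
        = vlift (interval_atlas I) (apullback I (prj V \<circ> c) E) (vpullback I (prj V \<circ> c) Eb)
            (icurve A E V h I c a e u) (icurve A Eb V hb I c a w u)"
      if u: "u \<in> icurve_dom A E V h I c a e \<inter> icurve_dom A Eb V hb I c a w"
    proof -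
      have u': "u \<in> hlift_dom A E V h I c a e" "u \<in> hlift_dom A Eb V hb I c a w"
        using u unfolding X.icurve_dom_eq Y.Eb.icurve_dom_eq by blast+
      show ?thesis
        unfolding X.lie_Ups_eq[OF aew u'(1)] X.icurve_eq[OF u'(1)] Y.Eb.icurve_eq[OF u'(2)] X.vlift_apullback
          Y.hlift_act_line[OF u'] ..
    qed
  qed
qed

end
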